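(* Let $m\in\mathbb{N}$, $S=\{1,\ldots,m\}$, $S'\subseteq S$, and let $\lambda_1,\ldots,\lambda_m\in\mathbb{C}^*$. Let $\alpha_i,\beta_i\in\mathbb{C}$ ($i\in S$) be such that $\beta_i\neq 0$ for $i\in S'$, and $\alpha_j\neq0$, $\beta_j=0$ for $j\in S\setminus S'$. Let $e\in\mathbb{Z}_+$ and let $M$ be a simple $\mathcal{H}_e$-module on which $I_0,C_1,C_2,C_3$ act as scalars $c_0,c_1,c_2,c_3$ respectively, with $c_3=0$. Assume there exists $k\in\mathbb{Z}_+$ such that (a) if $k\neq0$, the action of $I_k$ on $M$ is injective; if $k=0$, $c_0+(n-1)c_2\neq0$ for all $n\in\mathbb{Z}\setminus\{0\}$; (b) $I_nM=L_{n'}M=0$ for all $n>k$ and $n'>k+e$. Then the tensor product $\big(\bigotimes_{i=1}^m\Omega(\lambda_i,\alpha_i,\beta_i)\big)\otimes\mathrm{Ind}(M)$ is an irreducible $\mathcal{H}$-module if and only if $\lambda_1,\ldots,\lambda_m$ are pairwise distinct.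
   Context: $\mathbb{C}^*$, $\mathbb{Z}_+$, $\mathbb{N}$ denote the nonzero complex numbers, nonnegative integers and positive integers. All vector spaces are over $\mathbb{C}$. The twisted Heisenberg-Virasoro algebra $\mathcal{H}$ is the complex Lie algebra with basis $\{L_m,I_m,C_1,C_2,C_3\mid m\in\mathbb{Z}\}$ and brackets $$[L_m,L_n]=(n-m)L_{m+n}+\delta_{m+n,0}\tfrac{m^3-m}{12}C_1,\quad [L_m,I_n]=nI_{m+n}+\delta_{m+n,0}(m^2+m)C_2,\quad [I_m,I_n]=n\delta_{m+n,0}C_3,$$ with $C_1,C_2,C_3$ central. For $\lambda\in\mathbb{C}^*$, $\alpha,\beta\in\mathbb{C}$, $\Omega(\lambda,\alpha,\beta)$ is the $\mathcal{H}$-module with underlying space the polynomial algebra $\mathbb{C}[\partial]$ and action $L_k\partial^n=\lambda^k(\partial+k\alpha)(\partial-k)^n$, $I_k\partial^n=\lambda^k\beta(\partial-k)^n$, $C_j\partial^n=0$ for $k\in\mathbb{Z}$, $n\in\mathbb{Z}_+$, $j=1,2,3$. For $e\in\mathbb{Z}_+$, $\mathcal{H}_e$ is the subalgebra $\sum_{m\in\mathbb{Z}_+}(\mathbb{C}L_m\oplus\mathbb{C}I_{m-e})\oplus\mathbb{C}C_1\oplus\mathbb{C}C_2\oplus\mathbb{C}C_3$ of $\mathcal{H}$. For an $\mathcal{H}_e$-module $M$, $\mathrm{Ind}(M)=\mathcal{U}(\mathcal{H})\otimes_{\mathcal{U}(\mathcal{H}_e)}M$ is the induced $\mathcal{H}$-module.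 Tensor products of $\mathcal{H}$-modules are over $\mathbb{C}$ with the usual Lie algebra action. *)

theory Defs
  imports
    Complex_Main
    "HOL-Library.Poly_Mapping"
    "HOL-Library.FuncSet"
    "HOL-Computational_Algebra.Polynomial"
    "HOL-Algebra.Module"
    "HOL-Algebra.QuotRing"
begin

section \<open>Complex Lie algebras and their modules\<close>

definition complex_ring :: "complex ring" where
  "complex_ring = \<lparr>carrier = UNIV, mult = (*), one = 1, zero = 0, add = (+)\<rparr>"

text \<open>
  Complex vector spaces are records of type \<^typ>\<open>(complex, 'v) module\<close>. Their fields
  \<open>mult\<close> and \<open>one\<close> carry information only when the space is an associative algebra.
\<close>

record 'g lie_algebra = "(complex, 'g) module" +
  bracket :: "'g \<Rightarrow> 'g \<Rightarrow> 'g"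

record ('g, 'v) lie_module = "(complex, 'v) module" +
  act :: "'g \<Rightarrow> 'v \<Rightarrow> 'v"

locale lie_algebra = module complex_ring g for g (structure) +
  assumes bracket_closed:
      "\<lbrakk>x \<in> carrier g; y \<in> carrier g\<rbrakk> \<Longrightarrow> bracket g x y \<in> carrier g"
    and bracket_add_left:
      "\<lbrakk>x \<in> carrier g; y \<in> carrier g; z \<in> carrier g\<rbrakk>
        \<Longrightarrow> bracket g (x \<oplus> y) z = bracket g x z \<oplus> bracket g y z"
    and bracket_add_right:
      "\<lbrakk>x \<in> carrier g; y \<in> carrier g; z \<in> carrier g\<rbrakk>
        \<Longrightarrow> bracket g x (y \<oplus> z) = bracket g x y \<oplus> bracket g x z"
    and bracket_smult_left:
      "\<lbrakk>x \<in> carrier g; y \<in> carrier g\<rbrakk> \<Longrightarrow> bracket g (c \<odot> x) y = c \<odot> bracket g x y"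
    and bracket_smult_right:
      "\<lbrakk>x \<in> carrier g; y \<in> carrier g\<rbrakk> \<Longrightarrow> bracket g x (c \<odot> y) = c \<odot> bracket g x y"
    and bracket_alternating:
      "x \<in> carrier g \<Longrightarrow> bracket g x x = \<zero>"
    and jacobi:
      "\<lbrakk>x \<in> carrier g; y \<in> carrier g; z \<in> carrier g\<rbrakk>
        \<Longrightarrow> bracket g x (bracket g y z) \<oplus> bracket g y (bracket g z x)
              \<oplus> bracket g z (bracket g x y) = \<zero>"

locale lie_module = g: lie_algebra g + V: module complex_ring V for g and V +
  assumes act_closed:
      "\<lbrakk>x \<in> carrier g; v \<in> carrier V\<rbrakk> \<Longrightarrow> act V x v \<in> carrier V"
    and act_add_left:
      "\<lbrakk>x \<in> carrier g; y \<in> carrier g; v \<in> carrier V\<rbrakk>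
        \<Longrightarrow> act V (x \<oplus>\<^bsub>g\<^esub> y) v = act V x v \<oplus>\<^bsub>V\<^esub> act V y v"
    and act_smult_left:
      "\<lbrakk>x \<in> carrier g; v \<in> carrier V\<rbrakk> \<Longrightarrow> act V (c \<odot>\<^bsub>g\<^esub> x) v = c \<odot>\<^bsub>V\<^esub> act V x v"
    and act_add_right:
      "\<lbrakk>x \<in> carrier g; v \<in> carrier V; w \<in> carrier V\<rbrakk>
        \<Longrightarrow> act V x (v \<oplus>\<^bsub>V\<^esub> w) = act V x v \<oplus>\<^bsub>V\<^esub> act V x w"
    and act_smult_right:
      "\<lbrakk>x \<in> carrier g; v \<in> carrier V\<rbrakk> \<Longrightarrow> act V x (c \<odot>\<^bsub>V\<^esub> v) = c \<odot>\<^bsub>V\<^esub> act V x v"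
    and act_bracket:
      "\<lbrakk>x \<in> carrier g; y \<in> carrier g; v \<in> carrier V\<rbrakk>
        \<Longrightarrow> act V (bracket g x y) v = act V x (act V y v) \<ominus>\<^bsub>V\<^esub> act V y (act V x v)"

definition lie_submodule ::
    "'g lie_algebra \<Rightarrow> 'v set \<Rightarrow> ('g, 'v) lie_module \<Rightarrow> bool" where
  "lie_submodule g N V \<longleftrightarrow>
    submodule N complex_ring V \<and> (\<forall>x\<in>carrier g. \<forall>v\<in>N. act V x v \<in> N)"

definition irreducible_lie_module :: "'g lie_algebra \<Rightarrow> ('g, 'v) lie_module \<Rightarrow> bool" where
  "irreducible_lie_module g V \<longleftrightarrow>
    lie_module g V \<and> carrier V \<noteq> {\<zero>\<^bsub>V\<^esub>} \<and>
    (\<forall>N. lie_submodule g N V \<longrightarrow> N = {\<zero>\<^bsub>V\<^esub>} \<or> N = carrier V)"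


section \<open>Free vector spaces and quotients\<close>

definition pm_scale :: "complex \<Rightarrow> ('x \<Rightarrow>\<^sub>0 complex) \<Rightarrow> ('x \<Rightarrow>\<^sub>0 complex)" where
  "pm_scale c p = Poly_Mapping.map ((*) c) p"

abbreviation pm_basis :: "'x \<Rightarrow> ('x \<Rightarrow>\<^sub>0 complex)" where
  "pm_basis x \<equiv> Poly_Mapping.single x 1"

definition lin_ext :: "('x \<Rightarrow> ('y \<Rightarrow>\<^sub>0 complex)) \<Rightarrow> ('x \<Rightarrow>\<^sub>0 complex) \<Rightarrow> ('y \<Rightarrow>\<^sub>0 complex)" where
  "lin_ext f p = (\<Sum>x\<in>Poly_Mapping.keys p. pm_scale (Poly_Mapping.lookup p x) (f x))"

definition free_space :: "'x set \<Rightarrow> (complex, 'x \<Rightarrow>\<^sub>0 complex) module" where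
  "free_space X =
    \<lparr>carrier = {p. Poly_Mapping.keys p \<subseteq> X}, mult = undefined, one = undefined,
     zero = 0, add = (+), smult = pm_scale\<rparr>"

text \<open>The map on \<open>V / N\<close> induced by a map \<open>T\<close> on \<open>V\<close> that respects cosets of \<open>N\<close>.\<close>

definition quotient_map ::
    "('v, 'e) ring_scheme \<Rightarrow> 'v set \<Rightarrow> ('v \<Rightarrow> 'v) \<Rightarrow> 'v set \<Rightarrow> 'v set" where
  "quotient_map V N T A = (\<Union>a\<in>A. N +>\<^bsub>V\<^esub> T a)"

text \<open>
  For a subspace \<open>N\<close> this is the quotient vector space, for an ideal \<open>N\<close> of an associative
  algebra it is the quotient algebra.
\<close>

definition quotient_module ::
    "(complex, 'v) module \<Rightarrow> 'v set \<Rightarrow> (complex, 'v set) module" where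
  "quotient_module V N =
    ring.extend (V Quot N) (module.fields (\<lambda>c. quotient_map V N (smult V c)))"

definition with_act ::
    "(complex, 'v) module \<Rightarrow> ('g \<Rightarrow> 'v \<Rightarrow> 'v) \<Rightarrow> ('g, 'v) lie_module" where
  "with_act V a = module.extend V (lie_module.fields a)"


section \<open>Tensor products\<close>

definition tensor_rels ::
    "(complex, 'v, 'e) module_scheme \<Rightarrow> (complex, 'w, 'f) module_scheme
      \<Rightarrow> (('v \<times> 'w) \<Rightarrow>\<^sub>0 complex) set" where
  "tensor_rels V W =
     {pm_basis (v \<oplus>\<^bsub>V\<^esub> v', w) - pm_basis (v, w) - pm_basis (v', w) | v v' w.
        v \<in> carrier V \<and> v' \<in> carrier V \<and> w \<in> carrier W} \<union>
     {pm_basis (v, w \<oplus>\<^bsub>W\<^esub> w') - pm_basis (v, w) - pm_basis (v, w') | v w w'.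
        v \<in> carrier V \<and> w \<in> carrier W \<and> w' \<in> carrier W} \<union>
     {pm_basis (c \<odot>\<^bsub>V\<^esub> v, w) - pm_scale c (pm_basis (v, w)) | c v w.
        v \<in> carrier V \<and> w \<in> carrier W} \<union>
     {pm_basis (v, c \<odot>\<^bsub>W\<^esub> w) - pm_scale c (pm_basis (v, w)) | c v w.
        v \<in> carrier V \<and> w \<in> carrier W}"

definition lie_tensor ::
    "('g, 'v) lie_module \<Rightarrow> ('g, 'w) lie_module \<Rightarrow> ('g, (('v \<times> 'w) \<Rightarrow>\<^sub>0 complex) set) lie_module"
  where
  "lie_tensor V W =
    (let F = free_space (carrier V \<times> carrier W);
         N = module.span pm_scale (tensor_rels V W)
     in with_act (quotient_module F N)
          (\<lambda>x. quotient_map F N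
            (lin_ext (\<lambda>(v, w). pm_basis (act V x v, w) + pm_basis (v, act W x w)))))"

text \<open>
  The tensor product of a finite family; the pure tensors are indexed by the
  extensional functions \<open>f\<close> on \<open>S\<close> with \<open>f i \<in> V i\<close>.
\<close>

definition family_tensor_rels ::
    "'i set \<Rightarrow> ('i \<Rightarrow> (complex, 'v, 'e) module_scheme) \<Rightarrow> (('i \<Rightarrow> 'v) \<Rightarrow>\<^sub>0 complex) set" where
  "family_tensor_rels S V =
     {pm_basis (f(i := v \<oplus>\<^bsub>V i\<^esub> v')) - pm_basis (f(i := v)) - pm_basis (f(i := v')) | f i v v'.
        i \<in> S \<and> f \<in> (\<Pi>\<^sub>E j\<in>S. carrier (V j)) \<and> v \<in> carrier (V i) \<and> v' \<in> carrier (V i)} \<union>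
     {pm_basis (f(i := c \<odot>\<^bsub>V i\<^esub> v)) - pm_scale c (pm_basis (f(i := v))) | f i c v.
        i \<in> S \<and> f \<in> (\<Pi>\<^sub>E j\<in>S. carrier (V j)) \<and> v \<in> carrier (V i)}"

definition lie_tensor_family ::
    "'i set \<Rightarrow> ('i \<Rightarrow> ('g, 'v) lie_module) \<Rightarrow> ('g, (('i \<Rightarrow> 'v) \<Rightarrow>\<^sub>0 complex) set) lie_module"
  where
  "lie_tensor_family S V =
    (let F = free_space (\<Pi>\<^sub>E i\<in>S. carrier (V i));
         N = module.span pm_scale (family_tensor_rels S V)
     in with_act (quotient_module F N)
          (\<lambda>x. quotient_map F N
            (lin_ext (\<lambda>f. \<Sum>i\<in>S. pm_basis (f(i := act (V i) x (f i)))))))"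


section \<open>Universal enveloping algebras and induced modules\<close>

text \<open>The free unital associative algebra on the underlying set of \<open>g\<close>, spanned by words.\<close>

definition free_alg :: "'g lie_algebra \<Rightarrow> (complex, 'g list \<Rightarrow>\<^sub>0 complex) module" where
  "free_alg g = (free_space (lists (carrier g)))
    \<lparr>mult := (\<lambda>p q. lin_ext (\<lambda>a. lin_ext (\<lambda>b. pm_basis (a @ b)) q) p),
     one := pm_basis []\<rparr>"

text \<open>
  The first two families of relations turn the free algebra on the set \<open>g\<close> into the tensor
  algebra of the vector space \<open>g\<close>.
\<close>

definition uea_rels :: "'g lie_algebra \<Rightarrow> ('g list \<Rightarrow>\<^sub>0 complex) set" where
  "uea_rels g =
     {pm_basis [x \<oplus>\<^bsub>g\<^esub> y] - pm_basis [x] - pm_basis [y] | x y. x \<in> carrier g \<and> y \<in> carrier g} \<union>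
     {pm_basis [c \<odot>\<^bsub>g\<^esub> x] - pm_scale c (pm_basis [x]) | c x. x \<in> carrier g} \<union>
     {pm_basis [x, y] - pm_basis [y, x] - pm_basis [bracket g x y] | x y.
        x \<in> carrier g \<and> y \<in> carrier g}"

definition uea_ideal :: "'g lie_algebra \<Rightarrow> ('g list \<Rightarrow>\<^sub>0 complex) set" where
  "uea_ideal g = Idl\<^bsub>free_alg g\<^esub> (uea_rels g)"

definition uea :: "'g lie_algebra \<Rightarrow> (complex, ('g list \<Rightarrow>\<^sub>0 complex) set) module" where
  "uea g = quotient_module (free_alg g) (uea_ideal g)"

definition uea_class :: "'g lie_algebra \<Rightarrow> ('g list \<Rightarrow>\<^sub>0 complex) \<Rightarrow> ('g list \<Rightarrow>\<^sub>0 complex) set" where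
  "uea_class g p = uea_ideal g +>\<^bsub>free_alg g\<^esub> p"

definition free_alg_act :: "('g, 'v) lie_module \<Rightarrow> ('g list \<Rightarrow>\<^sub>0 complex) \<Rightarrow> 'v \<Rightarrow> 'v" where
  "free_alg_act M p v =
    (\<Oplus>\<^bsub>M\<^esub>w\<in>Poly_Mapping.keys p. Poly_Mapping.lookup p w \<odot>\<^bsub>M\<^esub> foldr (act M) w v)"

text \<open>
  \<open>U(g) \<otimes>\<^bsub>U(h)\<^esub> M\<close> for a Lie subalgebra \<open>h\<close> of \<open>g\<close>. An element of \<open>U(h)\<close> is given by a
  representative \<open>p\<close> in the free algebra of \<open>h\<close>; its image in \<open>U(g)\<close> is the class of \<open>p\<close> there.
\<close>

definition induced_rels ::
    "'g lie_algebra \<Rightarrow> 'g lie_algebra \<Rightarrow> ('g, 'v) lie_module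
      \<Rightarrow> ((('g list \<Rightarrow>\<^sub>0 complex) set \<times> 'v) \<Rightarrow>\<^sub>0 complex) set" where
  "induced_rels g h M =
     tensor_rels (uea g) M \<union>
     {pm_basis (u \<otimes>\<^bsub>uea g\<^esub> uea_class g p, v) - pm_basis (u, free_alg_act M p v) | u p v.
        u \<in> carrier (uea g) \<and> p \<in> carrier (free_alg h) \<and> v \<in> carrier M}"

definition induced_module ::
    "'g lie_algebra \<Rightarrow> 'g lie_algebra \<Rightarrow> ('g, 'v) lie_module
      \<Rightarrow> ('g, ((('g list \<Rightarrow>\<^sub>0 complex) set \<times> 'v) \<Rightarrow>\<^sub>0 complex) set) lie_module" where
  "induced_module g h M =
    (let F = free_space (carrier (uea g) \<times> carrier M);
         N = module.span pm_scale (induced_rels g h M)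
     in with_act (quotient_module F N)
          (\<lambda>x. quotient_map F N
            (lin_ext (\<lambda>(u, v). pm_basis (uea_class g (pm_basis [x]) \<otimes>\<^bsub>uea g\<^esub> u, v)))))"


section \<open>The twisted Heisenberg-Virasoro algebra\<close>

datatype hv_index = HL int | HI int | HC1 | HC2 | HC3

type_synonym hv_elem = "hv_index \<Rightarrow>\<^sub>0 complex"

abbreviation hv_L :: "int \<Rightarrow> hv_elem" where "hv_L n \<equiv> pm_basis (HL n)"
abbreviation hv_I :: "int \<Rightarrow> hv_elem" where "hv_I n \<equiv> pm_basis (HI n)"
abbreviation hv_C1 :: hv_elem where "hv_C1 \<equiv> pm_basis HC1"
abbreviation hv_C2 :: hv_elem where "hv_C2 \<equiv> pm_basis HC2"
abbreviation hv_C3 :: hv_elem where "hv_C3 \<equiv> pm_basis HC3"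

fun hv_bracket_basis :: "hv_index \<Rightarrow> hv_index \<Rightarrow> hv_elem" where
  "hv_bracket_basis (HL m) (HL n) =
     pm_scale (of_int (n - m)) (hv_L (m + n)) +
     (if m + n = 0 then pm_scale (of_int (m ^ 3 - m) / 12) hv_C1 else 0)"
| "hv_bracket_basis (HL m) (HI n) =
     pm_scale (of_int n) (hv_I (m + n)) +
     (if m + n = 0 then pm_scale (of_int (m ^ 2 + m)) hv_C2 else 0)"
| "hv_bracket_basis (HI n) (HL m) =
     - (pm_scale (of_int n) (hv_I (m + n)) +
        (if m + n = 0 then pm_scale (of_int (m ^ 2 + m)) hv_C2 else 0))"
| "hv_bracket_basis (HI m) (HI n) = (if m + n = 0 then pm_scale (of_int n) hv_C3 else 0)"
| "hv_bracket_basis _ _ = 0"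

definition hv :: "hv_elem lie_algebra" where
  "hv = module.extend (free_space UNIV)
    (lie_algebra.fields (\<lambda>x y. lin_ext (\<lambda>a. lin_ext (\<lambda>b. hv_bracket_basis a b) y) x))"

definition hv_sub :: "nat \<Rightarrow> hv_elem lie_algebra" where
  "hv_sub e = hv
    \<lparr>carrier := {x. Poly_Mapping.keys x \<subseteq>
       {HL m | m. m \<ge> 0} \<union> {HI (m - int e) | m. m \<ge> 0} \<union> {HC1, HC2, HC3}}\<rparr>"

text \<open>
  On \<open>\<complex>[\<partial>]\<close>: \<open>pcompose f [:- k, 1:]\<close> is the linear extension of \<open>\<partial>\<^sup>n \<mapsto> (\<partial> - k)\<^sup>n\<close>.
\<close>

fun omega_basis :: "complex \<Rightarrow> complex \<Rightarrow> complex \<Rightarrow> hv_index \<Rightarrow> complex poly \<Rightarrow> complex poly" where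
  "omega_basis l a b (HL k) f =
     Polynomial.smult (l powi k) ([:of_int k * a, 1:] * pcompose f [:- of_int k, 1:])"
| "omega_basis l a b (HI k) f = Polynomial.smult (l powi k * b) (pcompose f [:- of_int k, 1:])"
| "omega_basis l a b _ f = 0"

definition Omega :: "complex \<Rightarrow> complex \<Rightarrow> complex \<Rightarrow> (hv_elem, complex poly) lie_module" where
  "Omega l a b =
    \<lparr>carrier = UNIV, mult = (*), one = 1, zero = 0, add = (+), smult = Polynomial.smult,
     act = (\<lambda>x f. \<Sum>i\<in>Poly_Mapping.keys x.
              Polynomial.smult (Poly_Mapping.lookup x i) (omega_basis l a b i f))\<rparr>"

end

theory Submission
  imports Defs "HOL-Library.Multiset" "HOL-Library.Function_Algebras"
begin

text \<open>
  Nothing is computed inside quotients of free vector spaces: each module is transported to a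
  subspace \<open>C\<close> of an ordinary vector space on which the basis vectors of \<open>\<H>\<close> act by operators
  (\<open>hv_rep\<close>): whenever a linear map on a free space has the relations as kernel and intertwines the
  actions, the quotient module is irreducible if and only if its image is (\<open>irreducible_iff\<close> of
  \<open>quotient_transport\<close>). So \<open>Ind(M)\<close> becomes a complement of its relations, and the full tensor
  product becomes the space of polynomial functions \<open>z \<mapsto> f z\<close> of \<open>z \<in> \<complex>\<^sup>m\<close> with values in \<open>Ind(M)\<close>,
  on which \<open>L k\<close> acts by
  \<open>f \<mapsto> (z \<mapsto> L k (f z) + (\<Sum>i. \<lambda>\<^sub>i\<^sup>k (z\<^sub>i + k \<alpha>\<^sub>i) f (z\<^sub>1, \<dots>, z\<^sub>i - k, \<dots>, z\<^sub>m)))\<close>, and \<open>I k\<close> similarly.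

  \<^emph>\<open>\<open>Ind(M)\<close> is simple.\<close> It is spanned by products of operators \<open>L (-1 - n)\<close>, times products of
  operators \<open>I (-e - 1 - n)\<close>, applied to \<open>M\<close>. Two families of operators of positive index undo these
  generators one at a time. The operators \<open>I (k + 1 + n)\<close> kill \<open>M\<close> and commute with all other \<open>I\<close>s as
  \<open>c\<^sub>3 = 0\<close>; their bracket with \<open>L (-1 - n)\<close> is a multiple of \<open>I k\<close>, or for \<open>k = 0\<close> the scalar
  \<open>c\<^sub>0 + n c\<^sub>2\<close>, up to a nonzero factor, and this is injective by hypothesis (a). The
  operators \<open>L (k + e + 1 + n)\<close> kill \<open>M\<close> too, and treat the \<open>I (-e - 1 - n)\<close> in the same way. Applied
  to a suitable leading term of a nonzero vector, the operators that belong to its factors leave a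
  nonzero vector of \<open>M\<close> and kill all other terms (\<open>C_lowering\<close>, \<open>V0_lowering\<close>). Hence every nonzero
  submodule meets \<open>M\<close>, and is everything because \<open>M\<close> is simple and generates (\<open>simple_C\<close>). No
  Poincare-Birkhoff-Witt theorem enters: linear independence of the monomials is a consequence of
  the lowering argument. What has to be known beforehand is only that \<open>M\<close> survives in \<open>Ind(M)\<close>.
  This is seen from an explicitly constructed \<open>\<H>\<close>-module of functions on words (the coinduced
  module), in which \<open>M\<close> can be found again (\<open>coinduced_rep\<close>, \<open>generator_nonzero\<close>).

  \<^emph>\<open>Distinct parameters.\<close> Each vector of \<open>Ind(M)\<close> is killed by \<open>L n\<close> and \<open>I n\<close> for all large \<open>n\<close>. For
  such \<open>n\<close> a vector \<open>f\<close> of the tensor product is sent to an exponential polynomial in \<open>n\<close>, with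
  bases \<open>\<lambda>\<^sub>i\<close>. If the \<open>\<lambda>\<^sub>i\<close> are distinct, the functions \<open>n \<mapsto> \<lambda>\<^sub>i\<^sup>n n\<^sup>j\<close> are linearly independent on every
  final segment, so a submodule that contains \<open>f\<close> contains every coefficient
  (\<open>coefficients_in_submodule\<close>). Coefficients of top order in \<open>n\<close> remove the variable \<open>z\<^sub>i\<close> from \<open>f\<close>,
  through \<open>I n\<close> if \<open>\<beta>\<^sub>i \<noteq> 0\<close> and through \<open>L n\<close> if \<open>\<alpha>\<^sub>i \<noteq> 0\<close>; the remaining constants form a submodule of
  \<open>Ind(M)\<close>. Coefficients of low order in turn put all powers of \<open>z\<^sub>i\<close> back, so the submodule is
  everything (\<open>tensor_simple\<close>).

  \<^emph>\<open>Coinciding parameters.\<close> If \<open>\<lambda>\<^sub>i = \<lambda>\<^sub>j\<close> with \<open>i \<noteq> j\<close>, the functions that depend on \<open>z\<^sub>i\<close> and \<open>z\<^sub>j\<close> only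
  through \<open>z\<^sub>i + z\<^sub>j\<close> form a submodule, since the two shifts by \<open>k\<close> agree on them and the two
  contributions add up to one with the factor \<open>z\<^sub>i + z\<^sub>j + k (\<alpha>\<^sub>i + \<alpha>\<^sub>j)\<close>. It is neither zero nor everything
  (\<open>tensor_not_simple\<close>).
\<close>

section \<open>Linear combinations over free vector spaces\<close>

lemma lookup_pm_scale [simp]:
  "Poly_Mapping.lookup (pm_scale c p) x = c * Poly_Mapping.lookup p x"
  by (simp add: pm_scale_def Poly_Mapping.map.rep_eq when_def)

interpretation pm: vector_space pm_scale
  by unfold_locales (auto intro!: poly_mapping_eqI simp: lookup_add algebra_simps)

definition lcomb ::
    "(complex \<Rightarrow> 'e \<Rightarrow> 'e::ab_group_add) \<Rightarrow> ('x \<Rightarrow> 'e) \<Rightarrow> ('x \<Rightarrow>\<^sub>0 complex) \<Rightarrow> 'e" where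
  "lcomb s f p = (\<Sum>x\<in>Poly_Mapping.keys p. s (Poly_Mapping.lookup p x) (f x))"

lemma lin_ext_lcomb: "lin_ext f = lcomb pm_scale f"
  by (simp add: fun_eq_iff lin_ext_def lcomb_def)

locale cvs = vector_space scale
  for scale :: "complex \<Rightarrow> 'e::ab_group_add \<Rightarrow> 'e" (infixr "*s" 75)
begin

lemma lcomb_superset:
  assumes "finite A" "Poly_Mapping.keys p \<subseteq> A"
  shows "lcomb (*s) f p = (\<Sum>x\<in>A. Poly_Mapping.lookup p x *s f x)"
  unfolding lcomb_def
  by (rule sum.mono_neutral_left) (use assms in \<open>auto simp: in_keys_iff\<close>)

lemma lcomb_add: "lcomb (*s) f (p + q) = lcomb (*s) f p + lcomb (*s) f q"
proof -
  let ?A = "Poly_Mapping.keys p \<union> Poly_Mapping.keys q"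
  have "lcomb (*s) f r = (\<Sum>x\<in>?A. Poly_Mapping.lookup r x *s f x)" if "r \<in> {p, q, p + q}" for r
    using that keys_add[of p q] by (intro lcomb_superset) auto
  then show ?thesis
    by (simp add: lookup_add scale_left_distrib sum.distrib)
qed

lemma lcomb_scale: "lcomb (*s) f (pm_scale c p) = c *s lcomb (*s) f p"
proof -
  have "lcomb (*s) f r = (\<Sum>x\<in>Poly_Mapping.keys p. Poly_Mapping.lookup r x *s f x)"
    if "r \<in> {p, pm_scale c p}" for r
    using that by (intro lcomb_superset) (auto simp: in_keys_iff)
  then show ?thesis
    by (simp add: scale_sum_right)
qed

lemma linear_lcomb: "Vector_Spaces.linear pm_scale (*s) (lcomb (*s) f)"
  by unfold_locales (simp_all add: lcomb_add lcomb_scale)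

lemma lcomb_zero [simp]: "lcomb (*s) f 0 = 0"
  by (simp add: lcomb_def)

lemma lcomb_minus: "lcomb (*s) f (- p) = - lcomb (*s) f p"
  by (metis add_eq_0_iff lcomb_add lcomb_zero ab_left_minus)

lemma lcomb_diff: "lcomb (*s) f (p - q) = lcomb (*s) f p - lcomb (*s) f q"
  by (metis diff_conv_add_uminus lcomb_add lcomb_minus)

lemma lcomb_sum: "lcomb (*s) f (\<Sum>i\<in>A. p i) = (\<Sum>i\<in>A. lcomb (*s) f (p i))"
  by (induction A rule: infinite_finite_induct) (simp_all add: lcomb_add)

lemma lcomb_single [simp]: "lcomb (*s) f (Poly_Mapping.single x c) = c *s f x"
  by (cases "c = 0") (simp_all add: lcomb_def)

lemma lcomb_lcomb: "lcomb (*s) f (lcomb pm_scale g p) = lcomb (*s) (\<lambda>x. lcomb (*s) f (g x)) p"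
  by (simp add: lcomb_def[of pm_scale] lcomb_sum lcomb_scale) (simp add: lcomb_def)

lemma lcomb_cong:
  "(\<And>x. x \<in> Poly_Mapping.keys p \<Longrightarrow> f x = g x) \<Longrightarrow> lcomb (*s) f p = lcomb (*s) g p"
  by (simp add: lcomb_def)

lemma lcomb_add_fun: "lcomb (*s) (\<lambda>x. f x + g x) p = lcomb (*s) f p + lcomb (*s) g p"
  by (simp add: lcomb_def scale_right_distrib sum.distrib)

lemma lcomb_diff_fun: "lcomb (*s) (\<lambda>x. f x - g x) p = lcomb (*s) f p - lcomb (*s) g p"
  by (simp add: lcomb_def scale_right_diff_distrib sum_subtractf)

lemma lcomb_scale_fun: "lcomb (*s) (\<lambda>x. c *s f x) p = c *s lcomb (*s) f p"
  by (simp add: lcomb_def scale_sum_right mult.commute)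

lemma lcomb_zero_fun [simp]: "lcomb (*s) (\<lambda>x. 0) p = 0"
  by (simp add: lcomb_def)

lemma lcomb_in_subspace:
  "subspace W \<Longrightarrow> (\<And>x. x \<in> Poly_Mapping.keys p \<Longrightarrow> f x \<in> W) \<Longrightarrow> lcomb (*s) f p \<in> W"
  unfolding lcomb_def by (intro subspace_sum subspace_scale)

lemma additive_lcomb:
  fixes f :: "'x \<Rightarrow> 'e" and h :: "'e \<Rightarrow> 'e"
  assumes "\<And>x y. h (x + y) = h x + h y" "\<And>c x. h (c *s x) = c *s h x"
  shows "h (lcomb (*s) f p) = lcomb (*s) (\<lambda>x. h (f x)) p"
proof -
  have z: "h 0 = 0" using assms(1)[of 0 0] by simp
  have "h (\<Sum>x\<in>A. g x) = (\<Sum>x\<in>A. h (g x))" for A :: "'x set" and g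
    by (induction A rule: infinite_finite_induct) (simp_all add: assms z)
  then show ?thesis by (simp add: lcomb_def assms)
qed

lemma lcomb_swap:
  "lcomb (*s) (\<lambda>x. lcomb (*s) (\<lambda>y. f x y) q) p = lcomb (*s) (\<lambda>y. lcomb (*s) (\<lambda>x. f x y) p) q"
  by (simp add: lcomb_def scale_sum_right) (subst sum.swap, simp add: mult.commute)

text \<open>A complement of \<open>N\<close> realizes the quotient by \<open>N\<close> inside the space itself; this is how
  quotients and abstract modules are moved to subspaces of a fixed vector space.\<close>

lemma projection_along:
  assumes N: "subspace N"
  obtains \<pi> where "Vector_Spaces.linear (*s) (*s) \<pi>"
    "\<And>x. x \<in> N \<Longrightarrow> \<pi> x = 0" "\<And>x. x - \<pi> x \<in> N"
proof -
  interpret vector_space_pair "(*s)" "(*s)" ..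
  obtain B where B: "B \<subseteq> N" "independent B" "N \<subseteq> span B"
    using maximal_independent_subset by blast
  let ?E = "extend_basis B"
  have E: "independent ?E" "span ?E = UNIV"
    using independent_extend_basis[OF B(2)] span_extend_basis[OF B(2)] by auto
  obtain \<pi> where \<pi>: "Vector_Spaces.linear (*s) (*s) \<pi>" "\<And>b. b \<in> ?E \<Longrightarrow> \<pi> b = (if b \<in> B then 0 else b)"
    using linear_independent_extend[OF E(1), of "\<lambda>b. if b \<in> B then 0 else b"] by blast
  interpret \<pi>: Vector_Spaces.linear "(*s)" "(*s)" \<pi> by fact
  have BE: "B \<subseteq> ?E" using extend_basis_superset[OF B(2)] .
  have 0: "\<pi> x = 0" if "x \<in> span B" for x
    using that BE by (induction rule: span_induct_alt) (auto simp: \<pi>.add \<pi>.scale \<pi>(2) subset_iff)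
  have 1: "x - \<pi> x \<in> N" if "x \<in> span ?E" for x
    using that
  proof (induction rule: span_induct_alt)
    case base
    then show ?case using N by (simp add: subspace_0)
  next
    case (step c b y)
    have "b - \<pi> b \<in> N" using step(1) B(1) \<pi>(2) N by (auto simp: subspace_0)
    then have "c *s (b - \<pi> b) + (y - \<pi> y) \<in> N"
      using N step by (intro subspace_add subspace_scale)
    moreover have "c *s (b - \<pi> b) + (y - \<pi> y) = (c *s b + y) - \<pi> (c *s b + y)"
      by (simp add: \<pi>.add \<pi>.scale scale_right_diff_distrib)
    ultimately show ?case by simp
  qed
  show ?thesis
    using that[OF \<pi>(1)] 0 1 E(2) B(3) by auto
qed

end

interpretation pm: cvs pm_scale ..

lemma lcomb_basis: "lcomb pm_scale pm_basis p = p"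
proof (rule poly_mapping_eqI)
  fix k
  have "(\<Sum>x\<in>Poly_Mapping.keys p. Poly_Mapping.lookup p x * (if x = k then 1 else 0)) =
      Poly_Mapping.lookup p k"
    by (simp add: in_keys_iff if_distrib[where f = "(*) _"] cong: if_cong)
  then show "Poly_Mapping.lookup (lcomb pm_scale pm_basis p) k = Poly_Mapping.lookup p k"
    by (simp add: lcomb_def lookup_sum lookup_single when_def)
qed

lemma pm_in_span_basis:
  "Poly_Mapping.keys p \<subseteq> X \<Longrightarrow> p \<in> pm.span (pm_basis ` X)"
  using pm.lcomb_in_subspace[OF pm.subspace_span, of p pm_basis "pm_basis ` X"]
  by (auto simp: lcomb_basis intro: pm.span_base)

lemma linear_lcomb_comp:
  assumes "Vector_Spaces.linear s1 s2 h" and "cvs s1" and "cvs s2"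
  shows "h (lcomb s1 f p) = lcomb s2 (\<lambda>x. h (f x)) p"
proof -
  interpret Vector_Spaces.linear s1 s2 h by fact
  show ?thesis by (simp add: lcomb_def sum scale)
qed

lemma subspace_free: "pm.subspace {p. Poly_Mapping.keys p \<subseteq> X}"
proof -
  have "Poly_Mapping.keys (p + q) \<subseteq> X"
    if "Poly_Mapping.keys p \<subseteq> X" "Poly_Mapping.keys q \<subseteq> X" for p q :: "'a \<Rightarrow>\<^sub>0 complex"
    using keys_add[of p q] that by blast
  moreover have "Poly_Mapping.keys (pm_scale c p) \<subseteq> X" if "Poly_Mapping.keys p \<subseteq> X" for c p
    using that by (auto simp: in_keys_iff)
  ultimately show ?thesis by (simp add: pm.subspace_def)
qed

lemma free_span: "{p. Poly_Mapping.keys p \<subseteq> X} = pm.span (pm_basis ` X)"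
proof
  show "{p. Poly_Mapping.keys p \<subseteq> X} \<subseteq> pm.span (pm_basis ` X)" using pm_in_span_basis by blast
  show "pm.span (pm_basis ` X) \<subseteq> {p. Poly_Mapping.keys p \<subseteq> X}"
    by (rule pm.span_minimal[OF _ subspace_free]) auto
qed

lemma lcomb_free:
  "(\<And>x. x \<in> Poly_Mapping.keys p \<Longrightarrow> Poly_Mapping.keys (f x) \<subseteq> X) \<Longrightarrow>
    Poly_Mapping.keys (lcomb pm_scale f p) \<subseteq> X"
  using pm.lcomb_in_subspace[OF subspace_free, of p f X] by auto

section \<open>Quotients of free vector spaces\<close>

lemma complex_ring_sel [simp]:
  "carrier complex_ring = UNIV" "a \<otimes>\<^bsub>complex_ring\<^esub> b = a * b" "\<one>\<^bsub>complex_ring\<^esub> = 1"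
  "\<zero>\<^bsub>complex_ring\<^esub> = 0" "a \<oplus>\<^bsub>complex_ring\<^esub> b = a + b"
  by (simp_all add: complex_ring_def)

lemma cring_complex_ring: "cring complex_ring"
proof (rule cringI)
  show "abelian_group complex_ring"
    by (rule abelian_groupI) (auto simp: algebra_simps intro: exI[of _ "- _"] add.right_inverse add.left_inverse)
  show "Group.comm_monoid complex_ring"
    by (rule comm_monoidI) (auto simp: algebra_simps)
qed (auto simp: algebra_simps)

lemma free_space_sel [simp]:
  "carrier (free_space X) = {p. Poly_Mapping.keys p \<subseteq> X}" "\<zero>\<^bsub>free_space X\<^esub> = 0"
  "p \<oplus>\<^bsub>free_space X\<^esub> q = p + q" "c \<odot>\<^bsub>free_space X\<^esub> p = pm_scale c p"
  by (simp_all add: free_space_def)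

text \<open>Cosets are treated for every record whose addition is that of the type, so that the free
  algebra is covered as well as the free vector space.\<close>

locale free_quotient =
  fixes V :: "(complex, 'x \<Rightarrow>\<^sub>0 complex) module" and N :: "('x \<Rightarrow>\<^sub>0 complex) set"
  assumes V_add: "\<And>p q. p \<oplus>\<^bsub>V\<^esub> q = p + q" and V_smult: "\<And>c p. c \<odot>\<^bsub>V\<^esub> p = pm_scale c p"
    and V_sub: "pm.subspace (carrier V)"
    and N_sub: "pm.subspace N" and N_V: "N \<subseteq> carrier V"
begin

abbreviation "cls p \<equiv> N +>\<^bsub>V\<^esub> p"

lemma cls_eq: "cls p = (\<lambda>n. n + p) ` N"
  by (auto simp: a_r_coset_def' V_add)

lemma cls_self: "p \<in> cls p"
  using pm.subspace_0[OF N_sub] by (force simp: cls_eq)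

lemma cls_mem: "q \<in> cls p \<longleftrightarrow> q - p \<in> N"
  by (force simp: cls_eq image_iff)

lemma cls_eq_iff: "cls p = cls q \<longleftrightarrow> p - q \<in> N"
proof
  assume "cls p = cls q"
  then show "p - q \<in> N" using cls_self[of p] by (simp add: cls_mem)
next
  assume pq: "p - q \<in> N"
  have "x - p \<in> N \<longleftrightarrow> x - q \<in> N" for x
    using pm.subspace_add[OF N_sub _ pq, of "x - p"] pm.subspace_diff[OF N_sub _ pq, of "x - q"]
    by auto
  then show "cls p = cls q" by (auto simp: cls_mem)
qed

lemma quotient_carrier: "carrier (quotient_module V N) = cls ` carrier V"
  by (auto simp: quotient_module_def ring.defs FactRing_def A_RCOSETS_def RCOSETS_def a_r_coset_def)

lemma quotient_zero: "\<zero>\<^bsub>quotient_module V N\<^esub> = cls 0"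
  by (auto simp: quotient_module_def ring.defs FactRing_def cls_eq)

lemma quotient_add: "cls p \<oplus>\<^bsub>quotient_module V N\<^esub> cls q = cls (p + q)"
proof -
  have "cls p <+>\<^bsub>V\<^esub> cls q = cls (p + q)"
  proof (intro equalityI subsetI)
    fix x assume "x \<in> cls p <+>\<^bsub>V\<^esub> cls q"
    then obtain n n' where "n \<in> N" "n' \<in> N" "x = n + p + (n' + q)"
      by (auto simp: set_add_def' cls_eq V_add)
    then show "x \<in> cls (p + q)"
      using pm.subspace_add[OF N_sub, of n n'] by (auto simp: cls_mem algebra_simps)
  next
    fix x assume "x \<in> cls (p + q)"
    then obtain n where n: "n \<in> N" "x = (n + p) + (0 + q)" by (auto simp: cls_eq add.assoc)
    then show "x \<in> cls p <+>\<^bsub>V\<^esub> cls q"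
      using pm.subspace_0[OF N_sub] unfolding set_add_def' cls_eq V_add by blast
  qed
  then show ?thesis by (simp add: quotient_module_def ring.defs FactRing_def)
qed

lemma quotient_map_cls:
  assumes "\<And>p q. T (p + q) = T p + T q" "\<And>n. n \<in> N \<Longrightarrow> T n \<in> N"
  shows "quotient_map V N T (cls p) = cls (T p)"
proof -
  have "cls (T a) = cls (T p)" if "a \<in> cls p" for a
  proof -
    obtain n where "n \<in> N" "a = n + p" using \<open>a \<in> cls p\<close> by (auto simp: cls_eq)
    then show ?thesis using assms by (simp add: cls_eq_iff)
  qed
  then show ?thesis unfolding quotient_map_def using cls_self[of p] by blast
qed

lemma quotient_smult: "c \<odot>\<^bsub>quotient_module V N\<^esub> cls p = cls (pm_scale c p)"
proof -
  have "c \<odot>\<^bsub>quotient_module V N\<^esub> cls p = quotient_map V N (smult V c) (cls p)"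
    by (simp add: quotient_module_def ring.defs module.defs)
  also have "\<dots> = cls (pm_scale c p)"
    using quotient_map_cls[of "smult V c" p] by (simp add: V_smult pm.scale_right_distrib pm.subspace_scale[OF N_sub])
  finally show ?thesis .
qed

end

lemma free_quotientI:
  "pm.subspace N \<Longrightarrow> N \<subseteq> {p. Poly_Mapping.keys p \<subseteq> X} \<Longrightarrow> free_quotient (free_space X) N"
  by unfold_locales (simp_all add: subspace_free)

lemma with_act_sel [simp]:
  "carrier (with_act V a) = carrier V" "\<zero>\<^bsub>with_act V a\<^esub> = \<zero>\<^bsub>V\<^esub>"
  "x \<oplus>\<^bsub>with_act V a\<^esub> y = x \<oplus>\<^bsub>V\<^esub> y" "c \<odot>\<^bsub>with_act V a\<^esub> x = c \<odot>\<^bsub>V\<^esub> x"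
  "act (with_act V a) = a"
  by (simp_all add: with_act_def module.defs lie_module.defs)

section \<open>The twisted Heisenberg-Virasoro algebra and its representations\<close>

lemma hv_sel [simp]:
  "carrier hv = UNIV" "\<zero>\<^bsub>hv\<^esub> = 0" "x \<oplus>\<^bsub>hv\<^esub> y = x + y" "c \<odot>\<^bsub>hv\<^esub> x = pm_scale c x"
  by (simp_all add: hv_def module.defs free_space_def)

lemma bracket_hv:
  "bracket hv x y = lcomb pm_scale (\<lambda>a. lcomb pm_scale (hv_bracket_basis a) y) x"
  by (simp add: hv_def module.defs lie_algebra.defs lin_ext_lcomb)

lemma bracket_hv_basis [simp]: "bracket hv (pm_basis a) (pm_basis b) = hv_bracket_basis a b"
  by (simp add: bracket_hv)

lemma bracket_hv_left: "bracket hv x y = lcomb pm_scale (\<lambda>a. bracket hv (pm_basis a) y) x"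
  by (simp add: bracket_hv)

lemma bracket_hv_add:
  "bracket hv (x + y) z = bracket hv x z + bracket hv y z"
  "bracket hv x (y + z) = bracket hv x y + bracket hv x z"
  by (simp_all add: bracket_hv pm.lcomb_add pm.lcomb_add_fun)

lemma bracket_hv_scale:
  "bracket hv (pm_scale c x) y = pm_scale c (bracket hv x y)"
  "bracket hv x (pm_scale c y) = pm_scale c (bracket hv x y)"
  by (simp_all add: bracket_hv pm.lcomb_scale pm.lcomb_scale_fun)

lemma bracket_hv_lcomb:
  "bracket hv (lcomb pm_scale f p) y = lcomb pm_scale (\<lambda>a. bracket hv (f a) y) p"
  "bracket hv x (lcomb pm_scale f p) = lcomb pm_scale (\<lambda>a. bracket hv x (f a)) p"
  by (simp_all add: bracket_hv pm.lcomb_lcomb) (simp add: pm.lcomb_swap[of _ p])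

lemma hv_bracket_basis_antisym: "hv_bracket_basis a b = - hv_bracket_basis b a"
proof (cases a; cases b)
  fix m n assume a: "a = HL m" "b = HL n"
  have "(m ^ 3 - m) = - (n ^ 3 - n)" if "m + n = 0"
  proof -
    have "m = - n" using that by simp
    then show ?thesis by simp
  qed
  then have c: "of_int (m ^ 3 - m) = - (of_int (n ^ 3 - n) :: complex)" if "m + n = 0"
    using that by (metis of_int_minus)
  have d: "of_int (n - m) = - (of_int (m - n) :: complex)" by simp
  show ?thesis unfolding a
    by (intro poly_mapping_eqI)
      (auto simp: lookup_add lookup_minus lookup_single when_def add.commute c d simp del: of_int_diff)
next
  fix m n assume a: "a = HI m" "b = HI n"
  show ?thesis unfolding a
    by (intro poly_mapping_eqI) (auto simp: lookup_single when_def add.commute add_eq_0_iff)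
qed (simp_all add: add.commute)

text \<open>Up to rotation the three basis elements are of one of the types LLL, LLI, LII, III, or one
  of them is central. In each type the identity compares polynomials in the three indices; the
  coefficients of the central elements agree only because these occur for index sum zero.\<close>

lemma hv_jacobi_basis:
  "bracket hv (pm_basis a) (hv_bracket_basis b c) + bracket hv (pm_basis b) (hv_bracket_basis c a)
    + bracket hv (pm_basis c) (hv_bracket_basis a b) = 0" (is "?J a b c = 0")
proof -
  have z: "bracket hv x 0 = 0" for x by (simp add: bracket_hv)
  have nL: "bracket hv x (- y) = - bracket hv x y" for x y by (simp add: bracket_hv_scale(2)[of x "-1" y, simplified])
  have dL: "bracket hv x (y - y') = bracket hv x y - bracket hv x y'" for x y y'
    by (simp add: bracket_hv_add(2) nL diff_conv_add_uminus del: add_uminus_conv_diff)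
  have LL: "bracket hv (hv_L m) (hv_bracket_basis (HL n) (HL p)) =
      pm_scale (of_int (p - n) * of_int (n + p - m)) (hv_L (m + n + p)) +
      (if m + n + p = 0 then pm_scale (of_int (p - n) * (of_int (m ^ 3 - m) / 12)) hv_C1 else 0)" for m n p
    by (auto simp: bracket_hv_add(2) bracket_hv_scale(2) z add.assoc pm.scale_right_distrib simp del: of_int_diff)
  have LLI: "bracket hv (hv_L m) (hv_bracket_basis (HL n) (HI p)) =
      pm_scale (of_int p * of_int (n + p)) (hv_I (m + n + p)) +
      (if m + n + p = 0 then pm_scale (of_int p * of_int (m ^ 2 + m)) hv_C2 else 0)" for m n p
    by (auto simp: bracket_hv_add(2) bracket_hv_scale(2) z add.assoc pm.scale_right_distrib simp del: of_int_add)
  have LIL: "bracket hv (hv_L m) (hv_bracket_basis (HI p) (HL n)) =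
      - bracket hv (hv_L m) (hv_bracket_basis (HL n) (HI p))" for m n p
    by (simp only: hv_bracket_basis_antisym[of "HI p" "HL n"] nL)
  have ILL: "bracket hv (hv_I p) (hv_bracket_basis (HL m) (HL n)) =
      - pm_scale (of_int (n - m) * of_int p) (hv_I (m + n + p)) -
      (if m + n + p = 0 then pm_scale (of_int (n - m) * of_int ((m + n) ^ 2 + (m + n))) hv_C2 else 0)" for m n p
    by (auto simp: bracket_hv_add(2) bracket_hv_scale(2) z pm.scale_right_distrib
        pm.scale_right_diff_distrib simp del: of_int_diff of_int_add)
  have LLL: "?J (HL m) (HL n) (HL p) = 0" for m n p
  proof (rule poly_mapping_eqI)
    fix k
    have c: "n + p + m = m + n + p" "p + m + n = m + n + p" by auto
    have "of_int (p - n) * of_int (n + p - m) + of_int (m - p) * of_int (p + m - n) +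
        of_int (n - m) * of_int (m + n - p) = (0::complex)"
      by (simp add: algebra_simps)
    moreover have "of_int (p - n) * (of_int (m ^ 3 - m) / 12) + of_int (m - p) * (of_int (n ^ 3 - n) / 12) +
        of_int (n - m) * (of_int (p ^ 3 - p) / 12) = (0::complex)" if "m + n + p = 0"
    proof -
      have p: "p = - m - n" using that by simp
      show ?thesis unfolding p by (simp add: power3_eq_cube field_simps)
    qed
    ultimately show "Poly_Mapping.lookup (?J (HL m) (HL n) (HL p)) k = Poly_Mapping.lookup 0 k"
      unfolding LL c
      by (cases k) (auto simp: lookup_add lookup_single when_def simp del: of_int_diff of_int_add)
  qed
  have LLI': "?J (HL m) (HL n) (HI p) = 0" for m n p
  proof (rule poly_mapping_eqI)
    fix k
    have c: "n + m + p = m + n + p" by auto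
    have "of_int p * of_int (n + p) - of_int p * of_int (m + p) - of_int (n - m) * of_int p = (0::complex)"
      by (simp add: algebra_simps)
    moreover have "of_int p * of_int (m ^ 2 + m) - of_int p * of_int (n ^ 2 + n)
        - of_int (n - m) * of_int ((m + n) ^ 2 + (m + n)) = (0::complex)" if "m + n + p = 0"
    proof -
      have p: "p = - m - n" using that by simp
      show ?thesis unfolding p by (simp add: power2_eq_square algebra_simps)
    qed
    ultimately show "Poly_Mapping.lookup (?J (HL m) (HL n) (HI p)) k = Poly_Mapping.lookup 0 k"
      unfolding LIL LLI ILL c
      by (cases k) (auto simp: lookup_add lookup_minus lookup_single when_def simp del: of_int_diff of_int_add)
  qed
  have LII: "?J (HL m) (HI n) (HI p) = 0" for m n p
  proof (rule poly_mapping_eqI)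
    fix k
    have 1: "bracket hv (hv_L m) (hv_bracket_basis (HI n) (HI p)) = 0"
      by (simp add: bracket_hv_scale z)
    have 2: "bracket hv (hv_I n) (hv_bracket_basis (HI p) (HL m)) =
        (if m + n + p = 0 then pm_scale (- of_int p * of_int (m + p)) hv_C3 else 0)" for n p
      by (auto simp: nL dL bracket_hv_add(2) bracket_hv_scale(2) z add_ac simp del: of_int_add)
    have 3: "bracket hv (hv_I p) (hv_bracket_basis (HL m) (HI n)) =
        (if m + n + p = 0 then pm_scale (of_int n * of_int (m + n)) hv_C3 else 0)" for n p
      by (auto simp: nL dL bracket_hv_add(2) bracket_hv_scale(2) z add_ac simp del: of_int_add)
    have "- of_int p * of_int (m + p) + of_int n * of_int (m + n) = (0::complex)" if "m + n + p = 0"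
    proof -
      have p: "m = - n - p" using that by simp
      show ?thesis unfolding p by (simp add: algebra_simps)
    qed
    then show "Poly_Mapping.lookup (?J (HL m) (HI n) (HI p)) k = Poly_Mapping.lookup 0 k"
      unfolding 1 2 3
      by (cases k) (auto simp: lookup_add lookup_minus lookup_single when_def simp del: of_int_diff of_int_add)
  qed
  have III: "?J (HI m) (HI n) (HI p) = 0" for m n p
    by (simp add: bracket_hv_scale z)
  have cyc: "?J a b c = ?J b c a" for a b c by (simp add: add_ac)
  have central: "?J x b c = 0" if "x \<in> {HC1, HC2, HC3}" for x b c
  proof -
    have e: "hv_bracket_basis x y = 0" "hv_bracket_basis y x = 0" for y
      using that by (cases y; auto)+
    have "bracket hv (pm_basis x) y = 0" for y
      by (simp add: bracket_hv e lcomb_def)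
    then show ?thesis by (simp add: e z)
  qed
  have noncentral: "(\<exists>m. x = HL m) \<or> (\<exists>m. x = HI m)" if "x \<notin> {HC1, HC2, HC3}" for x
    using that by (cases x) auto
  define J where "J = (\<lambda>a b c. ?J a b c)"
  have J: "J a b c = J b c a" for a b c unfolding J_def by (rule cyc)
  have LLL: "J (HL m) (HL n) (HL p) = 0" and LLI: "J (HL m) (HL n) (HI p) = 0"
    and LII: "J (HL m) (HI n) (HI p) = 0" and III: "J (HI m) (HI n) (HI p) = 0" for m n p
    unfolding J_def by (fact LLL LLI' LII III)+
  have central: "J x b c = 0" if "x \<in> {HC1, HC2, HC3}" for x b c
    unfolding J_def by (rule central[OF that])
  have "J a b c = 0"
  proof (cases "a \<in> {HC1, HC2, HC3} \<or> b \<in> {HC1, HC2, HC3} \<or> c \<in> {HC1, HC2, HC3}")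
    case True
    then show ?thesis using central J by metis
  next
    case False
    then have "(\<exists>m. a = HL m) \<or> (\<exists>m. a = HI m)" "(\<exists>m. b = HL m) \<or> (\<exists>m. b = HI m)"
      "(\<exists>m. c = HL m) \<or> (\<exists>m. c = HI m)"
      using noncentral by auto
    then show ?thesis
      by (elim disjE exE; hypsubst; metis LLL LLI LII III J)
  qed
  then show ?thesis by (simp only: J_def)
qed

lemma hv_jacobi:
  "bracket hv x (bracket hv y z) + bracket hv y (bracket hv z x) + bracket hv z (bracket hv x y) = 0"
proof -
  let ?l = "lcomb pm_scale"
  have e: "bracket hv x y = ?l (\<lambda>a. ?l (\<lambda>b. hv_bracket_basis a b) y) x" for x y
    by (simp add: bracket_hv)
  have 1: "bracket hv x (bracket hv y z) =
      ?l (\<lambda>a. ?l (\<lambda>b. ?l (\<lambda>c. bracket hv (pm_basis a) (hv_bracket_basis b c)) z) y) x" for x y z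
    by (subst (2) e, subst bracket_hv_left) (simp add: bracket_hv_lcomb)
  have 2: "bracket hv y (bracket hv z x) =
      ?l (\<lambda>a. ?l (\<lambda>b. ?l (\<lambda>c. bracket hv (pm_basis b) (hv_bracket_basis c a)) z) y) x"
    by (subst 1) (simp add: pm.lcomb_swap[of _ x])
  have 3: "bracket hv z (bracket hv x y) =
      ?l (\<lambda>a. ?l (\<lambda>b. ?l (\<lambda>c. bracket hv (pm_basis c) (hv_bracket_basis a b)) z) y) x"
    by (subst 1) (simp add: pm.lcomb_swap[of _ z])
  show ?thesis
    by (subst 1, subst 2, subst 3)
      (simp add: pm.lcomb_add_fun[symmetric] hv_jacobi_basis)
qed

lemma bracket_hv_antisym: "bracket hv x y = - bracket hv y x"
proof -
  have "bracket hv x y + bracket hv y x =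
      lcomb pm_scale (\<lambda>a. lcomb pm_scale (\<lambda>b. hv_bracket_basis a b + hv_bracket_basis b a) y) x"
    by (simp add: bracket_hv pm.lcomb_add_fun pm.lcomb_swap[of _ y])
  also have "\<dots> = 0"
    by (subst hv_bracket_basis_antisym) simp
  finally show ?thesis by (simp add: eq_neg_iff_add_eq_0)
qed

lemma bracket_hv_self: "bracket hv x x = 0"
proof -
  have "Poly_Mapping.lookup (bracket hv x x) k = 0" for k
    using arg_cong[OF bracket_hv_antisym[of x x], of "\<lambda>p. Poly_Mapping.lookup p k"] by simp
  then show ?thesis by (auto intro: poly_mapping_eqI)
qed

lemma lie_algebra_hv: "lie_algebra hv"
proof -
  interpret hv: module complex_ring hv
    by (intro moduleI cring_complex_ring abelian_groupI)
      (auto simp: add_ac pm.scale_left_distrib pm.scale_right_distrib intro: exI[of _ "- _"] left_minus)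
  show ?thesis
    by unfold_locales (auto simp: bracket_hv_add bracket_hv_scale bracket_hv_self hv_jacobi)
qed

text \<open>Every module in sight is isomorphic to a subspace \<open>C\<close> of a vector space on which the basis
  elements act by operators \<open>op\<close>; linearity is required on the whole space because all operators
  below arise as linear extensions, while the bracket relations hold on \<open>C\<close> only.\<close>

locale hv_rep = cvs scale
  for scale :: "complex \<Rightarrow> 'e::ab_group_add \<Rightarrow> 'e" (infixr "*s" 75) +
  fixes C :: "'e set" and op :: "hv_index \<Rightarrow> 'e \<Rightarrow> 'e"
  assumes C_subspace: "subspace C"
    and op_closed: "v \<in> C \<Longrightarrow> op a v \<in> C"
    and op_add: "op a (u + v) = op a u + op a v"
    and op_scale: "op a (c *s v) = c *s op a v"
    and op_bracket: "v \<in> C \<Longrightarrow>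
      op a (op b v) - op b (op a v) = lcomb (*s) (\<lambda>d. op d v) (hv_bracket_basis a b)"
begin

definition ext :: "hv_elem \<Rightarrow> 'e \<Rightarrow> 'e" where "ext x v = lcomb (*s) (\<lambda>a. op a v) x"

definition invariant :: "'e set \<Rightarrow> bool" where
  "invariant W \<longleftrightarrow> subspace W \<and> W \<subseteq> C \<and> (\<forall>a. \<forall>w\<in>W. op a w \<in> W)"

definition simple :: bool where
  "simple \<longleftrightarrow> C \<noteq> {0} \<and> (\<forall>W. invariant W \<longrightarrow> W = {0} \<or> W = C)"

lemma op_zero [simp]: "op a 0 = 0"
  using op_add[of a 0 0] by simp

lemma op_minus: "op a (- v) = - op a v"
  by (metis add_eq_0_iff op_add op_zero ab_left_minus)

lemma op_diff: "op a (u - v) = op a u - op a v"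
  by (metis diff_conv_add_uminus op_add op_minus)

lemma op_sum: "op a (\<Sum>i\<in>A. f i) = (\<Sum>i\<in>A. op a (f i))"
  by (induction A rule: infinite_finite_induct) (simp_all add: op_add)

lemma op_lcomb: "op a (lcomb (*s) f p) = lcomb (*s) (\<lambda>x. op a (f x)) p"
  by (rule additive_lcomb) (simp_all add: op_add op_scale)

lemma op_commute:
  "v \<in> C \<Longrightarrow> op a (op b v) = op b (op a v) + lcomb (*s) (\<lambda>d. op d v) (hv_bracket_basis a b)"
  using op_bracket[of v a b] by (simp add: algebra_simps)

lemma ext_basis [simp]: "ext (pm_basis a) v = op a v"
  by (simp add: ext_def)

lemma ext_add_left: "ext (x + y) v = ext x v + ext y v"
  and ext_scale_left: "ext (pm_scale c x) v = c *s ext x v"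
  and ext_add_right: "ext x (u + v) = ext x u + ext x v"
  and ext_scale_right: "ext x (c *s v) = c *s ext x v"
  by (simp_all add: ext_def lcomb_add lcomb_scale op_add op_scale lcomb_add_fun lcomb_scale_fun)

lemma ext_closed: "subspace W \<Longrightarrow> (\<And>a. op a v \<in> W) \<Longrightarrow> ext x v \<in> W"
  unfolding ext_def by (rule lcomb_in_subspace)

lemma ext_bracket:
  assumes "v \<in> C"
  shows "ext (bracket hv x y) v = ext x (ext y v) - ext y (ext x v)"
proof -
  have "ext x (ext y v) - ext y (ext x v) =
      lcomb (*s) (\<lambda>a. lcomb (*s) (\<lambda>b. op a (op b v) - op b (op a v)) y) x"
    by (simp add: ext_def op_lcomb lcomb_diff_fun lcomb_swap[of _ x])
  also have "\<dots> = ext (bracket hv x y) v"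
    using assms by (simp add: op_bracket ext_def bracket_hv lcomb_lcomb)
  finally show ?thesis ..
qed

end

text \<open>A record module in linear bijection with \<open>C\<close>, compatibly with the actions, inherits the module
  axioms by injectivity, and its submodules correspond to the invariant subspaces of \<open>C\<close>.\<close>

locale hv_transport = hv_rep scale C op
  for scale :: "complex \<Rightarrow> 'e::ab_group_add \<Rightarrow> 'e" (infixr "*s" 75) and C op +
  fixes T :: "(hv_elem, 't) lie_module" and \<Phi> :: "'t \<Rightarrow> 'e"
  assumes bij: "bij_betw \<Phi> (carrier T) C"
    and zero_T: "\<zero>\<^bsub>T\<^esub> \<in> carrier T" "\<Phi> \<zero>\<^bsub>T\<^esub> = 0"
    and add_T: "\<lbrakk>x \<in> carrier T; y \<in> carrier T\<rbrakk> \<Longrightarrow> x \<oplus>\<^bsub>T\<^esub> y \<in> carrier T"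
      "\<lbrakk>x \<in> carrier T; y \<in> carrier T\<rbrakk> \<Longrightarrow> \<Phi> (x \<oplus>\<^bsub>T\<^esub> y) = \<Phi> x + \<Phi> y"
    and smult_T: "x \<in> carrier T \<Longrightarrow> c \<odot>\<^bsub>T\<^esub> x \<in> carrier T"
      "x \<in> carrier T \<Longrightarrow> \<Phi> (c \<odot>\<^bsub>T\<^esub> x) = c *s \<Phi> x"
    and act_T: "x \<in> carrier T \<Longrightarrow> act T g x \<in> carrier T"
      "x \<in> carrier T \<Longrightarrow> \<Phi> (act T g x) = ext g (\<Phi> x)"
begin

lemma inj: "x \<in> carrier T \<Longrightarrow> y \<in> carrier T \<Longrightarrow> \<Phi> x = \<Phi> y \<longleftrightarrow> x = y"
  using bij by (auto simp: bij_betw_def inj_on_def)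

lemma mem_C: "x \<in> carrier T \<Longrightarrow> \<Phi> x \<in> C"
  using bij by (auto simp: bij_betw_def)

lemma surj: assumes "v \<in> C" obtains x where "x \<in> carrier T" "\<Phi> x = v"
  using bij assms by (auto simp: bij_betw_def)

lemma module_T: "module complex_ring T"
proof (intro moduleI cring_complex_ring abelian_groupI)
  fix x assume x: "x \<in> carrier T"
  obtain y where "y \<in> carrier T" "\<Phi> y = - \<Phi> x"
    using surj[of "- \<Phi> x"] subspace_neg[OF C_subspace] mem_C[OF x] by auto
  then have "y \<oplus>\<^bsub>T\<^esub> x = \<zero>\<^bsub>T\<^esub>"
    using x by (subst inj[symmetric]) (auto simp: add_T zero_T)
  then show "\<exists>y\<in>carrier T. y \<oplus>\<^bsub>T\<^esub> x = \<zero>\<^bsub>T\<^esub>" using \<open>y \<in> carrier T\<close> by blast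
qed (auto simp: inj[symmetric] add_T zero_T smult_T scale_left_distrib scale_right_distrib add_ac)

lemma lie_module_T: "lie_module hv T"
proof -
  interpret h: lie_algebra hv by (rule lie_algebra_hv)
  interpret T: module complex_ring T by (rule module_T)
  have minus: "x \<ominus>\<^bsub>T\<^esub> y \<in> carrier T" "\<Phi> (x \<ominus>\<^bsub>T\<^esub> y) = \<Phi> x - \<Phi> y"
    if "x \<in> carrier T" "y \<in> carrier T" for x y
  proof -
    show 1: "x \<ominus>\<^bsub>T\<^esub> y \<in> carrier T" using that by simp
    have "(x \<ominus>\<^bsub>T\<^esub> y) \<oplus>\<^bsub>T\<^esub> y = x"
      using that by (simp add: T.minus_eq T.add.m_assoc T.l_neg)
    then show "\<Phi> (x \<ominus>\<^bsub>T\<^esub> y) = \<Phi> x - \<Phi> y"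
      using add_T(2)[OF 1 that(2)] by simp
  qed
  show ?thesis
    by unfold_locales
      (auto simp: inj[symmetric] act_T add_T smult_T minus ext_add_left ext_scale_left
        ext_add_right ext_scale_right ext_bracket mem_C)
qed

lemma irreducible_T: "irreducible_lie_module hv T \<longleftrightarrow> simple"
proof -
  interpret T: module complex_ring T by (rule module_T)
  have neg: "\<Phi> (\<ominus>\<^bsub>T\<^esub> x) = - \<Phi> x" if "x \<in> carrier T" for x
    using add_T(2)[of "\<ominus>\<^bsub>T\<^esub> x" x] that by (simp add: T.l_neg zero_T eq_neg_iff_add_eq_0)
  have 1: "lie_submodule hv {x \<in> carrier T. \<Phi> x \<in> W} T" if "invariant W" for W
  proof -
    have W: "subspace W" "\<And>a w. w \<in> W \<Longrightarrow> op a w \<in> W" using that by (auto simp: invariant_def)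
    have "submodule {x \<in> carrier T. \<Phi> x \<in> W} complex_ring T"
      by (rule T.submoduleI)
        (use W(1) in \<open>auto simp: zero_T neg add_T smult_T subspace_0 subspace_neg subspace_add subspace_scale\<close>)
    then show ?thesis by (auto simp: lie_submodule_def act_T W intro: ext_closed[OF W(1)])
  qed
  have 2: "invariant (\<Phi> ` K)" "K \<subseteq> carrier T" if "lie_submodule hv K T" for K
  proof -
    have K: "submodule K complex_ring T" "\<And>g v. v \<in> K \<Longrightarrow> act T g v \<in> K"
      using that by (auto simp: lie_submodule_def)
    note KE = T.submoduleE[OF K(1)]
    have K0: "\<zero>\<^bsub>T\<^esub> \<in> K"
      using KE(2) KE(3,5) T.r_neg KE(1) by (metis ex_in_conv subsetD)
    show "K \<subseteq> carrier T" by (rule KE(1))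
    have "subspace (\<Phi> ` K)"
      unfolding subspace_def
    proof (intro conjI ballI allI)
      show "0 \<in> \<Phi> ` K" using K0 zero_T by (metis image_eqI)
      show "u + v \<in> \<Phi> ` K" if "u \<in> \<Phi> ` K" "v \<in> \<Phi> ` K" for u v
        using that KE(1,5) by (auto simp: add_T(2)[symmetric] subset_iff)
      show "c *s u \<in> \<Phi> ` K" if "u \<in> \<Phi> ` K" for c u
        using that KE(1,4) by (auto simp: smult_T(2)[symmetric] subset_iff)
    qed
    moreover have "op a w \<in> \<Phi> ` K" if "w \<in> \<Phi> ` K" for a w
    proof -
      from that obtain x where x: "x \<in> K" "w = \<Phi> x" by auto
      then have "\<Phi> (act T (pm_basis a) x) = op a w"
        using act_T(2)[of x "pm_basis a"] KE(1) by auto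
      then show ?thesis using K(2)[OF x(1), of "pm_basis a"] by (metis imageI)
    qed
    ultimately show "invariant (\<Phi> ` K)"
      using KE(1) mem_C by (auto simp: invariant_def)
  qed
  have im: "\<Phi> ` {x \<in> carrier T. \<Phi> x \<in> W} = W" if "W \<subseteq> C" for W
    using that by (auto elim!: surj)
  have inj': "K = K'" if "K \<subseteq> carrier T" "K' \<subseteq> carrier T" "\<Phi> ` K = \<Phi> ` K'" for K K'
    using that bij by (meson bij_betw_def inj_on_image_eq_iff)
  have z: "\<Phi> ` {\<zero>\<^bsub>T\<^esub>} = {0}" using zero_T by simp
  have c: "\<Phi> ` carrier T = C" using bij by (simp add: bij_betw_def)
  have nz: "carrier T \<noteq> {\<zero>\<^bsub>T\<^esub>} \<longleftrightarrow> C \<noteq> {0}"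
    using c z inj'[of "carrier T" "{\<zero>\<^bsub>T\<^esub>}"] zero_T by auto
  have "(\<forall>K. lie_submodule hv K T \<longrightarrow> K = {\<zero>\<^bsub>T\<^esub>} \<or> K = carrier T) \<longleftrightarrow>
      (\<forall>W. invariant W \<longrightarrow> W = {0} \<or> W = C)"
  proof (intro iffI allI impI)
    fix W assume a: "\<forall>K. lie_submodule hv K T \<longrightarrow> K = {\<zero>\<^bsub>T\<^esub>} \<or> K = carrier T"
      and W: "invariant W"
    then show "W = {0} \<or> W = C"
      using 1[OF W] im[of W] c z by (metis invariant_def)
  next
    fix K assume a: "\<forall>W. invariant W \<longrightarrow> W = {0} \<or> W = C"
      and K: "lie_submodule hv K T"
    then show "K = {\<zero>\<^bsub>T\<^esub>} \<or> K = carrier T"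
      using 2[OF K] inj'[of K "carrier T"] inj'[of K "{\<zero>\<^bsub>T\<^esub>}"] c z zero_T
      by (metis empty_subsetI insert_subset order_refl)
  qed
  then show ?thesis
    by (simp add: irreducible_lie_module_def lie_module_T simple_def nz)
qed

end

text \<open>The workhorse for the three quotient constructions: a linear map with kernel \<open>N\<close> that
  intertwines the actions identifies the quotient of the free space by \<open>N\<close> with its image.\<close>

locale quotient_transport = hv_rep scale C op
  for scale :: "complex \<Rightarrow> 'e::ab_group_add \<Rightarrow> 'e" (infixr "*s" 75) and C op +
  fixes X :: "'x set" and N :: "('x \<Rightarrow>\<^sub>0 complex) set"
    and a :: "hv_elem \<Rightarrow> ('x \<Rightarrow>\<^sub>0 complex) \<Rightarrow> ('x \<Rightarrow>\<^sub>0 complex)" and \<phi> :: "('x \<Rightarrow>\<^sub>0 complex) \<Rightarrow> 'e"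
  assumes lin: "Vector_Spaces.linear pm_scale (*s) \<phi>"
    and N_X: "N \<subseteq> {p. Poly_Mapping.keys p \<subseteq> X}"
    and kernel: "Poly_Mapping.keys p \<subseteq> X \<Longrightarrow> \<phi> p = 0 \<longleftrightarrow> p \<in> N"
    and image: "\<phi> ` {p. Poly_Mapping.keys p \<subseteq> X} = C"
    and a_add: "a g (p + q) = a g p + a g q"
    and a_X: "Poly_Mapping.keys p \<subseteq> X \<Longrightarrow> Poly_Mapping.keys (a g p) \<subseteq> X"
    and a_\<phi>: "Poly_Mapping.keys p \<subseteq> X \<Longrightarrow> \<phi> (a g p) = ext g (\<phi> p)"
begin

interpretation \<phi>: Vector_Spaces.linear pm_scale "(*s)" \<phi> by (rule lin)

lemma N_subspace: "pm.subspace N"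
proof -
  have "N = {p. Poly_Mapping.keys p \<subseteq> X} \<inter> {p. \<phi> p = 0}" using N_X kernel by blast
  moreover have "pm.subspace {p. \<phi> p = 0}"
    by (auto simp: pm.subspace_def \<phi>.add \<phi>.scale)
  ultimately show ?thesis by (simp add: pm.subspace_inter subspace_free)
qed

lemma fq: "free_quotient (free_space X) N"
  by (rule free_quotientI[OF N_subspace N_X])

interpretation fq: free_quotient "free_space X" N by (rule fq)

definition Phi :: "('x \<Rightarrow>\<^sub>0 complex) set \<Rightarrow> 'e" where "Phi A = \<phi> (SOME p. p \<in> A)"

abbreviation T where
  "T \<equiv> with_act (quotient_module (free_space X) N) (\<lambda>g. quotient_map (free_space X) N (a g))"

lemma Phi_cls: "Phi (fq.cls p) = \<phi> p"
proof -
  have "(SOME q. q \<in> fq.cls p) \<in> fq.cls p" by (rule someI[of _ p]) (rule fq.cls_self)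
  then have "(SOME q. q \<in> fq.cls p) - p \<in> N" by (simp add: fq.cls_mem)
  then have "\<phi> ((SOME q. q \<in> fq.cls p) - p) = 0" using N_X kernel by blast
  then show ?thesis by (simp add: Phi_def \<phi>.diff)
qed

lemma T_carrier: "carrier T = fq.cls ` {p. Poly_Mapping.keys p \<subseteq> X}"
  by (simp add: fq.quotient_carrier)

lemma T_act: "Poly_Mapping.keys p \<subseteq> X \<Longrightarrow> act T g (fq.cls p) = fq.cls (a g p)"
proof -
  assume p: "Poly_Mapping.keys p \<subseteq> X"
  have "a g n \<in> N" if "n \<in> N" for n
  proof -
    have "\<phi> n = 0" "Poly_Mapping.keys n \<subseteq> X" using that N_X kernel by auto
    then have "\<phi> (a g n) = 0" "Poly_Mapping.keys (a g n) \<subseteq> X"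
      using a_\<phi>[of n g] a_X[of n g] ext_scale_right[of g 0 0] by auto
    then show ?thesis using kernel by blast
  qed
  then show ?thesis by (simp add: fq.quotient_map_cls a_add)
qed

sublocale hv_transport scale C op T Phi
proof unfold_locales
  have "inj_on Phi (carrier T)"
  proof (rule inj_onI)
    fix A B assume "A \<in> carrier T" "B \<in> carrier T" "Phi A = Phi B"
    then obtain p q where pq: "A = fq.cls p" "B = fq.cls q" "Poly_Mapping.keys p \<subseteq> X"
      "Poly_Mapping.keys q \<subseteq> X" "\<phi> (p - q) = 0"
      unfolding T_carrier by (auto simp: Phi_cls \<phi>.diff)
    moreover have "Poly_Mapping.keys (p - q) \<subseteq> X"
      using pm.subspace_diff[OF subspace_free[of X], of p q] pq by simp
    ultimately show "A = B" by (simp add: fq.cls_eq_iff kernel)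
  qed
  moreover have "Phi ` carrier T = C"
    unfolding T_carrier image[symmetric] by (simp add: image_image Phi_cls)
  ultimately show "bij_betw Phi (carrier T) C" by (simp add: bij_betw_def)
next
  show "\<zero>\<^bsub>T\<^esub> \<in> carrier T" "Phi \<zero>\<^bsub>T\<^esub> = 0"
    by (simp_all add: fq.quotient_zero fq.quotient_carrier Phi_cls)
next
  fix A B assume "A \<in> carrier T" "B \<in> carrier T"
  then obtain p q where pq: "A = fq.cls p" "B = fq.cls q" "Poly_Mapping.keys p \<subseteq> X"
    "Poly_Mapping.keys q \<subseteq> X"
    unfolding T_carrier by auto
  moreover have "Poly_Mapping.keys (p + q) \<subseteq> X"
    using pm.subspace_add[OF subspace_free[of X], of p q] pq by simp
  ultimately show "A \<oplus>\<^bsub>T\<^esub> B \<in> carrier T" "Phi (A \<oplus>\<^bsub>T\<^esub> B) = Phi A + Phi B"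
    by (simp_all add: fq.quotient_add fq.quotient_carrier Phi_cls \<phi>.add)
next
  fix A c assume "A \<in> carrier T"
  then obtain p where p: "A = fq.cls p" "Poly_Mapping.keys p \<subseteq> X"
    unfolding T_carrier by auto
  moreover have "Poly_Mapping.keys (pm_scale c p) \<subseteq> X"
    using pm.subspace_scale[OF subspace_free[of X], of p] p by simp
  ultimately show "c \<odot>\<^bsub>T\<^esub> A \<in> carrier T" "Phi (c \<odot>\<^bsub>T\<^esub> A) = c *s Phi A"
    by (simp_all add: fq.quotient_smult fq.quotient_carrier Phi_cls \<phi>.scale)
next
  fix A g assume "A \<in> carrier T"
  then obtain p where p: "A = fq.cls p" "Poly_Mapping.keys p \<subseteq> X"
    unfolding T_carrier by auto
  then show "act T g A \<in> carrier T" "Phi (act T g A) = ext g (Phi A)"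
    using T_act[OF p(2), of g] a_X[OF p(2), of g] a_\<phi>[OF p(2), of g]
    by (simp_all add: fq.quotient_carrier Phi_cls)
qed

end

section \<open>Simplicity of modules induced from a simple module\<close>

text \<open>A vector spanned by the images of the maps \<open>T \<mu>\<close> has an expression with one nonzero vector for
  each index that occurs; leading terms are chosen from such expressions.\<close>

lemma (in cvs) span_family_rep:
  fixes T :: "'i \<Rightarrow> 'm::ab_group_add \<Rightarrow> 'e"
  assumes s2: "cvs s2"
    and T: "\<And>\<mu> u v. \<lbrakk>u \<in> M; v \<in> M\<rbrakk> \<Longrightarrow> T \<mu> (u + v) = T \<mu> u + T \<mu> v"
      "\<And>\<mu> c v. v \<in> M \<Longrightarrow> T \<mu> (s2 c v) = c *s T \<mu> v"
    and M: "module.subspace s2 M" and u: "u \<in> span {T \<mu> v |\<mu> v. \<mu> \<in> A \<and> v \<in> M}"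
  obtains F v where "finite F" "F \<subseteq> A" "\<And>\<mu>. \<mu> \<in> F \<Longrightarrow> v \<mu> \<in> M \<and> v \<mu> \<noteq> 0"
    "u = (\<Sum>\<mu>\<in>F. T \<mu> (v \<mu>))"
proof -
  interpret s2: cvs s2 by (rule s2)
  have T0: "T \<mu> 0 = 0" for \<mu> using T(1)[of 0 0 \<mu>] s2.subspace_0[OF M] by simp
  have "\<exists>v. (\<forall>\<mu>. v \<mu> \<in> M) \<and> finite {\<mu>. v \<mu> \<noteq> 0} \<and> {\<mu>. v \<mu> \<noteq> 0} \<subseteq> A \<and>
      u = (\<Sum>\<mu> | v \<mu> \<noteq> 0. T \<mu> (v \<mu>))"
    using u
  proof (induction rule: span_induct_alt)
    case base
    show ?case by (rule exI[of _ "\<lambda>_. 0"]) (simp add: s2.subspace_0[OF M])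
  next
    case (step c x y)
    obtain \<mu>0 v0 where x: "x = T \<mu>0 v0" "\<mu>0 \<in> A" "v0 \<in> M" using step(1) by auto
    obtain v where v: "\<And>\<mu>. v \<mu> \<in> M" "finite {\<mu>. v \<mu> \<noteq> 0}" "{\<mu>. v \<mu> \<noteq> 0} \<subseteq> A"
      "y = (\<Sum>\<mu> | v \<mu> \<noteq> 0. T \<mu> (v \<mu>))"
      using step(2) by auto
    let ?v = "v(\<mu>0 := s2 c v0 + v \<mu>0)" and ?B = "insert \<mu>0 {\<mu>. v \<mu> \<noteq> 0}"
    have sub: "{\<mu>. ?v \<mu> \<noteq> 0} \<subseteq> ?B" by auto
    have "(\<Sum>\<mu> | ?v \<mu> \<noteq> 0. T \<mu> (?v \<mu>)) = (\<Sum>\<mu>\<in>?B. T \<mu> (?v \<mu>))"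
      by (rule sum.mono_neutral_left) (use v(2) sub in \<open>auto simp: T0\<close>)
    also have "\<dots> = c *s x + (\<Sum>\<mu>\<in>?B. T \<mu> (v \<mu>))"
      using v(1,2) x(3) s2.subspace_scale[OF M] by (simp add: sum.insert_remove T x(1) add.assoc)
    also have "(\<Sum>\<mu>\<in>?B. T \<mu> (v \<mu>)) = y"
      unfolding v(4) by (rule sum.mono_neutral_right) (use v(2) in \<open>auto simp: T0\<close>)
    finally have "c *s x + y = (\<Sum>\<mu> | ?v \<mu> \<noteq> 0. T \<mu> (?v \<mu>))" ..
    moreover have "\<forall>\<mu>. ?v \<mu> \<in> M"
      using v(1) x(3) M by (simp add: s2.subspace_add s2.subspace_scale)
    moreover have "finite {\<mu>. ?v \<mu> \<noteq> 0}"
      by (rule finite_subset[OF sub]) (use v(2) in simp)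
    moreover have "{\<mu>. ?v \<mu> \<noteq> 0} \<subseteq> A"
      using sub v(3) x(2) by blast
    ultimately show ?case by blast
  qed
  then show thesis using that by blast
qed

definition del_nth :: "nat \<Rightarrow> 'a list \<Rightarrow> 'a list" where
  "del_nth i xs = take i xs @ drop (Suc i) xs"

lemma del_nth_simps [simp]:
  "del_nth 0 (x # xs) = xs" "del_nth (Suc i) (x # xs) = x # del_nth i xs"
  by (simp_all add: del_nth_def)

lemma mset_del_nth: "i < length xs \<Longrightarrow> mset xs = add_mset (xs ! i) (mset (del_nth i xs))"
  by (subst id_take_nth_drop[of i xs]) (simp_all add: del_nth_def)

lemma length_del_nth: "i < length xs \<Longrightarrow> length xs = Suc (length (del_nth i xs))"
  by (simp add: del_nth_def)

lemma sum_list_mset_cong: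
  "mset xs = mset ys \<Longrightarrow> sum_list (map f xs) = (sum_list (map f ys) :: nat)"
  by (metis mset_map sum_mset_sum_list)

lemma sum_list_del_nth:
  "i < length xs \<Longrightarrow> sum_list (map f xs) = f (xs ! i) + (sum_list (map f (del_nth i xs)) :: nat)"
  using mset_del_nth[of i xs] by (metis list.simps(9) mset.simps(2) sum_list.Cons sum_list_mset_cong)

lemma sum_count_nth:
  "(\<Sum>i<length xs. if xs ! i = x then 1 else 0) = (of_nat (count (mset xs) x) :: complex)"
  by (induction xs) (simp_all add: sum.lessThan_Suc_shift del: sum.lessThan_Suc)

text \<open>The basis of the subalgebra from which the modules are induced.\<close>

fun nonneg_part :: "nat \<Rightarrow> hv_index \<Rightarrow> bool" where
  "nonneg_part e (HL m) \<longleftrightarrow> m \<ge> 0"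
| "nonneg_part e (HI m) \<longleftrightarrow> m \<ge> - int e"
| "nonneg_part e _ \<longleftrightarrow> True"

text \<open>A representation \<open>C\<close> generated by a simple module \<open>M\<close> over the subalgebra. Freeness of \<open>C\<close> over the
  enveloping algebra of the complement is not assumed: operators of large positive index lower
  monomials in the generators of negative index back to \<open>M\<close>, and this shows at the same time that
  the monomials are independent and that every nonzero submodule meets \<open>M\<close>.\<close>

locale hv_induced = hv_rep scale C op
  for scale :: "complex \<Rightarrow> 'e::ab_group_add \<Rightarrow> 'e" (infixr "*s" 75) and C op +
  fixes M :: "'e set" and e k :: nat and c0 c1 c2 :: complex
  assumes M_subspace: "subspace M" and M_C: "M \<subseteq> C" and M_nz: "M \<noteq> {0}"
    and M_closed: "\<lbrakk>v \<in> M; nonneg_part e a\<rbrakk> \<Longrightarrow> op a v \<in> M"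
    and M_simple: "\<lbrakk>subspace W; W \<subseteq> M; W \<noteq> {0}; \<And>a w. \<lbrakk>nonneg_part e a; w \<in> W\<rbrakk> \<Longrightarrow> op a w \<in> W\<rbrakk>
      \<Longrightarrow> W = M"
    and generated: "\<lbrakk>invariant W; M \<subseteq> W\<rbrakk> \<Longrightarrow> W = C"
    and M_I0: "v \<in> M \<Longrightarrow> op (HI 0) v = c0 *s v"
    and M_C1: "v \<in> M \<Longrightarrow> op HC1 v = c1 *s v"
    and M_C2: "v \<in> M \<Longrightarrow> op HC2 v = c2 *s v"
    and M_C3: "v \<in> M \<Longrightarrow> op HC3 v = 0"
    and inj_Ik: "\<lbrakk>k \<noteq> 0; v \<in> M; op (HI (int k)) v = 0\<rbrakk> \<Longrightarrow> v = 0"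
    and nondegenerate: "\<lbrakk>k = 0; n \<noteq> 0\<rbrakk> \<Longrightarrow> c0 + (of_int n - 1) * c2 \<noteq> 0"
    and M_I: "\<lbrakk>n > int k; v \<in> M\<rbrakk> \<Longrightarrow> op (HI n) v = 0"
    and M_L: "\<lbrakk>n > int k + int e; v \<in> M\<rbrakk> \<Longrightarrow> op (HL n) v = 0"
begin

abbreviation "L n \<equiv> op (HL n)"
abbreviation "I n \<equiv> op (HI n)"

lemma central:
  assumes z: "\<And>a. hv_bracket_basis z a = 0" and M: "\<And>v. v \<in> M \<Longrightarrow> op z v = c *s v" and v: "v \<in> C"
  shows "op z v = c *s v"
proof -
  have "invariant {v \<in> C. op z v = c *s v}"
    unfolding invariant_def
  proof (intro conjI ballI allI)
    show "subspace {v \<in> C. op z v = c *s v}"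
      using C_subspace
      by (auto simp: subspace_def op_add op_scale scale_right_distrib scale_left_commute)
    show "op a w \<in> {v \<in> C. op z v = c *s v}" if "w \<in> {v \<in> C. op z v = c *s v}" for a w
      using that op_commute[of w z a] by (auto simp: op_closed z op_scale)
  qed auto
  then have "{v \<in> C. op z v = c *s v} = C"
    using M M_C by (intro generated) auto
  then show ?thesis using v by blast
qed

lemma C_I0: "v \<in> C \<Longrightarrow> I 0 v = c0 *s v"
proof (rule central)
  show "hv_bracket_basis (HI 0) a = 0" for a by (cases a) auto
qed (auto simp: M_I0)

lemma C_C1: "v \<in> C \<Longrightarrow> op HC1 v = c1 *s v"
  and C_C2: "v \<in> C \<Longrightarrow> op HC2 v = c2 *s v"
  and C_C3: "v \<in> C \<Longrightarrow> op HC3 v = 0"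
  using central[of HC1 c1 v] central[of HC2 c2 v] central[of HC3 0 v] M_C1 M_C2 M_C3 by auto

lemma LL: "v \<in> C \<Longrightarrow> L m (L n v) = L n (L m v) + of_int (n - m) *s L (m + n) v
    + (if m + n = 0 then of_int (m ^ 3 - m) / 12 * c1 else 0) *s v"
  using op_commute[of v "HL m" "HL n"] by (auto simp: lcomb_add lcomb_scale C_C1 add.assoc)

lemma LI: "v \<in> C \<Longrightarrow> L m (I n v) = I n (L m v) + of_int n *s I (m + n) v
    + (if m + n = 0 then of_int (m ^ 2 + m) * c2 else 0) *s v"
  using op_commute[of v "HL m" "HI n"] by (auto simp: lcomb_add lcomb_scale C_C2 add.assoc)

lemma II: "v \<in> C \<Longrightarrow> I m (I n v) = I n (I m v)"
  using op_commute[of v "HI m" "HI n"] by (auto simp: lcomb_scale C_C3)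

lemma IL: "v \<in> C \<Longrightarrow> I n (L m v) = L m (I n v) - of_int n *s I (m + n) v
    - (if m + n = 0 then of_int (m ^ 2 + m) * c2 else 0) *s v"
  using LI[of v m n] by simp

subsection \<open>The part generated by the operators \<open>I\<close>\<close>

definition Iw :: "nat list \<Rightarrow> 'e \<Rightarrow> 'e" where
  "Iw \<mu> v = foldr (\<lambda>m. I (- int e - 1 - int m)) \<mu> v"

definition V0 :: "'e set" where "V0 = span {Iw \<mu> v |\<mu> v. v \<in> M}"

lemma Iw_simps [simp]: "Iw [] v = v" "Iw (m # \<mu>) v = I (- int e - 1 - int m) (Iw \<mu> v)"
  by (simp_all add: Iw_def)

lemma Iw_append: "Iw (\<mu> @ \<nu>) v = Iw \<mu> (Iw \<nu> v)"
  by (simp add: Iw_def)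

lemma Iw_add: "Iw \<mu> (u + v) = Iw \<mu> u + Iw \<mu> v" and Iw_scale: "Iw \<mu> (c *s v) = c *s Iw \<mu> v"
  by (induction \<mu>) (simp_all add: op_add op_scale)

lemma Iw_zero [simp]: "Iw \<mu> 0 = 0" by (induction \<mu>) simp_all

lemma Iw_C: "v \<in> C \<Longrightarrow> Iw \<mu> v \<in> C"
  by (induction \<mu>) (simp_all add: op_closed)

text \<open>All \<open>I\<close>s commute because \<open>C3\<close> acts by zero.\<close>

lemma I_Iw: "v \<in> C \<Longrightarrow> I p (Iw \<mu> v) = Iw \<mu> (I p v)"
  by (induction \<mu>) (simp_all add: II[of _ p] Iw_C)

lemma Iw_mset: "v \<in> C \<Longrightarrow> Iw (sort \<mu>) v = Iw \<mu> v"
proof (induction \<mu>)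
  case (Cons m \<mu>)
  have "Iw (insort m xs) v = Iw (m # xs) v" for xs
    using Cons.prems by (induction xs) (simp_all add: II[of _ "- int e - 1 - int m"] Iw_C)
  then show ?case using Cons by simp
qed simp

lemma M_V0: "M \<subseteq> V0"
  unfolding V0_def by (metis (mono_tags, lifting) CollectI Iw_simps(1) span_base subsetI)

lemma V0_subspace: "subspace V0" unfolding V0_def by (rule subspace_span)

lemma V0_C: "V0 \<subseteq> C"
  unfolding V0_def using M_C by (intro span_minimal C_subspace) (auto intro: Iw_C)

lemma Iw_V0: "v \<in> M \<Longrightarrow> Iw \<mu> v \<in> V0" unfolding V0_def by (rule span_base) auto

lemma V0_induct:
  assumes "v \<in> V0" and "subspace W" and "\<And>\<mu> v. v \<in> M \<Longrightarrow> Iw \<mu> v \<in> W"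
  shows "v \<in> W"
  using span_minimal[of "{Iw \<mu> v |\<mu> v. v \<in> M}" W] assms unfolding V0_def by blast

lemma subspace_vimage_op: "subspace W \<Longrightarrow> subspace {v. op a v \<in> W}"
  by (auto simp: subspace_def op_add op_scale)

lemma I_V0: "v \<in> V0 \<Longrightarrow> I p v \<in> V0"
proof -
  have "I p (Iw \<mu> v) \<in> V0" if v: "v \<in> M" for \<mu> v
  proof (cases "p \<ge> - int e")
    case True
    then have "I p v \<in> M" using M_closed[OF v, of "HI p"] by simp
    then show ?thesis using v M_C Iw_V0 by (auto simp: I_Iw)
  next
    case False
    then have "Iw (nat (- int e - 1 - p) # \<mu>) v = I p (Iw \<mu> v)" by simp
    then show ?thesis using Iw_V0[OF v] by metis
  qed
  then show "v \<in> V0 \<Longrightarrow> I p v \<in> V0"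
    using V0_induct[of v "{v. I p v \<in> V0}"] subspace_vimage_op[OF V0_subspace] by auto
qed

lemma I_kills_V0: "v \<in> V0 \<Longrightarrow> p > int k \<Longrightarrow> I p v = 0"
proof -
  assume v: "v \<in> V0" and p: "p > int k"
  have "I p (Iw \<mu> v) = 0" if "v \<in> M" for \<mu> v
    using that p M_C by (simp add: I_Iw M_I subset_iff)
  then show "I p v = 0"
    using V0_induct[OF v subspace_vimage_op[of "{0}" "HI p"]] by simp
qed

lemma L_V0: "v \<in> V0 \<Longrightarrow> p \<ge> 0 \<Longrightarrow> L p v \<in> V0"
proof -
  assume p: "p \<ge> 0"
  have "L p (Iw \<mu> v) \<in> V0" if v: "v \<in> M" for \<mu> v
  proof (induction \<mu>)
    case Nil
    show ?case using M_closed[OF v, of "HL p"] p M_V0 by auto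
  next
    case (Cons m \<mu>)
    have "Iw \<mu> v \<in> C" using v M_C by (auto intro: Iw_C)
    with Cons Iw_V0[OF v, of \<mu>] V0_subspace show ?case
      by (simp add: LI I_V0 subspace_add subspace_scale)
  qed
  then show "v \<in> V0 \<Longrightarrow> L p v \<in> V0"
    using V0_induct[of v "{v. L p v \<in> V0}"] subspace_vimage_op[OF V0_subspace] by auto
qed

text \<open>\<open>Zi n m\<close> is the bracket of the lowering operator \<open>L (k + e + 1 + n)\<close> with the generator
  \<open>I (-e - 1 - m)\<close>: zero on \<open>V0\<close> for \<open>m < n\<close> and injective on \<open>M\<close> for \<open>m = n\<close>.\<close>

definition Zi :: "nat \<Rightarrow> nat \<Rightarrow> 'e \<Rightarrow> 'e" where
  "Zi n m v = of_int (- int e - 1 - int m) *s I (int k + int n - int m) v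
    + (if k + n = m then of_int ((int k + int e + 1 + int n) ^ 2 + (int k + int e + 1 + int n)) * c2
       else 0) *s v"

lemma X_Id: "v \<in> C \<Longrightarrow> L (int k + int e + 1 + int n) (I (- int e - 1 - int m) v) =
    I (- int e - 1 - int m) (L (int k + int e + 1 + int n) v) + Zi n m v"
proof -
  assume v: "v \<in> C"
  have i: "int k + int e + 1 + int n + (- int e - 1 - int m) = int k + int n - int m" by simp
  have j: "int k + int n - int m = 0 \<longleftrightarrow> k + n = m" by linarith
  show ?thesis unfolding LI[OF v] i Zi_def j by (simp only: add.assoc)
qed

lemma Zi_Iw: "v \<in> C \<Longrightarrow> Zi n m (Iw \<mu> v) = Iw \<mu> (Zi n m v)"
  by (simp add: Zi_def I_Iw Iw_add Iw_scale)

lemma X_Iw: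
  assumes v: "v \<in> M"
  shows "L (int k + int e + 1 + int n) (Iw \<mu> v) =
    (\<Sum>i<length \<mu>. Iw (del_nth i \<mu>) (Zi n (\<mu> ! i) v))"
proof (induction \<mu>)
  case Nil
  show ?case using v by (simp add: M_L)
next
  case (Cons m \<mu>)
  have "v \<in> C" using v M_C by blast
  then show ?case
    using Cons by (simp add: X_Id Iw_C Zi_Iw op_sum sum.lessThan_Suc_shift del: sum.lessThan_Suc)
qed

lemma Zi_less: "m < n \<Longrightarrow> v \<in> M \<Longrightarrow> Zi n m v = 0"
  by (simp add: Zi_def M_I)

lemma Zi_ge_M: "int m \<le> int k + int n + int e \<Longrightarrow> v \<in> M \<Longrightarrow> Zi n m v \<in> M"
  unfolding Zi_def using M_closed[of v "HI (int k + int n - int m)"]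
  by (intro subspace_add[OF M_subspace] subspace_scale[OF M_subspace]) auto

lemma Zi_low:
  assumes "int m > int k + int n + int e"
  shows "Zi n m v = of_int (- int e - 1 - int m) *s Iw [m - n - k - e - 1] v"
proof -
  have "- int e - 1 - int (m - n - k - e - 1) = int k + int n - int m" using assms by linarith
  then have "Iw [m - n - k - e - 1] v = I (int k + int n - int m) v" by (simp only: Iw_simps)
  moreover have "k + n \<noteq> m" using assms by linarith
  ultimately show ?thesis by (simp add: Zi_def)
qed

lemma Zi_scale: "Zi n m (c *s v) = c *s Zi n m v"
  by (simp add: Zi_def op_scale scale_right_distrib mult.commute)

lemma Zi_inj: "v \<in> M \<Longrightarrow> Zi n n v = 0 \<Longrightarrow> v = 0"
proof (cases "k = 0")
  case True
  assume v: "v \<in> M" and z: "Zi n n v = 0"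
  let ?N = "of_int (int e + 1 + int n) :: complex"
  have "Zi n n v = - ?N *s c0 *s v + ((?N ^ 2 + ?N) * c2) *s v"
    using v unfolding Zi_def by (simp add: True M_I0 add_ac)
  also have "\<dots> = (- ?N * (c0 + (of_int (- (int e + 1 + int n)) - 1) * c2)) *s v"
    by (simp only: scale_scale scale_left_distrib[symmetric])
      (simp add: power2_eq_square algebra_simps)
  finally have eq: "Zi n n v = (- ?N * (c0 + (of_int (- (int e + 1 + int n)) - 1) * c2)) *s v" .
  have "c0 + (of_int (- (int e + 1 + int n)) - 1) * c2 \<noteq> 0"
    by (rule nondegenerate[OF True]) simp
  moreover have "?N \<noteq> 0" by (metis of_int_eq_0_iff add.commute add_pos_nonneg of_nat_0_le_iff zero_less_one less_irrefl add.assoc)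
  ultimately have "- ?N * (c0 + (of_int (- (int e + 1 + int n)) - 1) * c2) \<noteq> 0"
    by (simp only: mult_eq_0_iff neg_equal_0_iff_equal) blast
  then show "v = 0" using z eq by (metis scale_eq_0_iff)
next
  case False
  assume v: "v \<in> M" and z: "Zi n n v = 0"
  have "of_int (- int e - 1 - int n) \<noteq> (0::complex)"
    unfolding of_int_eq_0_iff by linarith
  then have "I (int k) v = 0" using z False by (simp add: Zi_def del: of_int_diff of_int_minus)
  then show "v = 0" using inj_Ik[OF False v] by simp
qed

fun Gi :: "nat list \<Rightarrow> 'e \<Rightarrow> 'e" where
  "Gi [] v = v"
| "Gi (n # \<nu>) v = Gi \<nu> (of_nat (count (mset (n # \<nu>)) n) *s Zi n n v)"

lemma Gi_scale: "Gi \<nu> (c *s v) = c *s Gi \<nu> v"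
  by (induction \<nu> arbitrary: v c)
    (simp_all add: Zi_scale mult.commute del: of_nat_Suc)

lemma Gi_M: "v \<in> M \<Longrightarrow> Gi \<nu> v \<in> M"
  by (induction \<nu> arbitrary: v) (simp_all add: subspace_scale[OF M_subspace] Zi_ge_M)

lemma Gi_inj: "v \<in> M \<Longrightarrow> Gi \<nu> v = 0 \<Longrightarrow> v = 0"
proof (induction \<nu> arbitrary: v)
  case (Cons n \<nu>)
  have "Zi n n v \<in> M" using Cons.prems by (simp add: Zi_ge_M)
  then have "of_nat (count (mset (n # \<nu>)) n) *s Zi n n v = 0"
    using Cons by (simp only: Gi.simps) (meson M_subspace subspace_scale)
  then have "Zi n n v = 0" by (simp del: of_nat_Suc)
  then show ?case using Zi_inj Cons.prems by blast
qed simp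

definition Xs :: "nat list \<Rightarrow> 'e \<Rightarrow> 'e" where
  "Xs \<nu> v = fold (\<lambda>n. L (int k + int e + 1 + int n)) \<nu> v"

lemma Xs_simps [simp]: "Xs [] v = v" "Xs (n # \<nu>) v = Xs \<nu> (L (int k + int e + 1 + int n) v)"
  by (simp_all add: Xs_def)

lemma Xs_add: "Xs \<nu> (u + v) = Xs \<nu> u + Xs \<nu> v" and Xs_scale: "Xs \<nu> (c *s v) = c *s Xs \<nu> v"
  by (induction \<nu> arbitrary: u v) (simp_all add: op_add op_scale)

lemma Xs_zero [simp]: "Xs \<nu> 0 = 0" by (induction \<nu>) simp_all

lemma Xs_sum: "Xs \<nu> (\<Sum>i\<in>A. f i) = (\<Sum>i\<in>A. Xs \<nu> (f i))"
  by (induction A rule: infinite_finite_induct) (simp_all add: Xs_add)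

abbreviation wt :: "nat list \<Rightarrow> nat" where "wt \<mu> \<equiv> sum_list (map Suc \<mu>)"

text \<open>The lowering operator with index \<open>n\<close> either removes a generator of index at least \<open>n\<close> or
  replaces a generator of index \<open>m > n + k + e\<close> by the one of index \<open>m - n - k - e - 1\<close>. Both
  decrease the weight by at least \<open>n + 1\<close>, and only the removal of a generator of index exactly
  \<open>n\<close> decreases weight and length by the least possible amount simultaneously.\<close>

lemma Xs_Iw:
  assumes "v \<in> M" "wt \<mu> \<le> wt \<nu>" "wt \<mu> < wt \<nu> \<or> length \<mu> \<ge> length \<nu>"
  shows "Xs \<nu> (Iw \<mu> v) = (if mset \<mu> = mset \<nu> then Gi \<nu> v else 0)"
  using assms
proof (induction \<nu> arbitrary: \<mu> v)
  case Nil
  then show ?case by simp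
next
  case (Cons n \<nu>)
  note wt = sum_list_mset_cong[where f = Suc]
  have *: "Xs \<nu> (Iw (del_nth i \<mu>) (Zi n (\<mu> ! i) v)) =
      (if \<mu> ! i = n \<and> mset \<mu> = mset (n # \<nu>) then Gi \<nu> (Zi n n v) else 0)"
    if i: "i < length \<mu>" for i
  proof -
    let ?\<mu> = "del_nth i \<mu>" and ?m = "\<mu> ! i"
    have ms: "mset \<mu> = add_mset ?m (mset ?\<mu>)" and ln: "length \<mu> = Suc (length ?\<mu>)"
      and w: "wt \<mu> = Suc ?m + wt ?\<mu>"
      using mset_del_nth[OF i] length_del_nth[OF i] sum_list_del_nth[OF i, of Suc] by simp_all
    consider "?m < n" | "?m = n" | "?m > n" "int ?m \<le> int k + int n + int e" | "int ?m > int k + int n + int e"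
      by linarith
    then show ?thesis
    proof cases
      case 1
      then show ?thesis using Cons.prems by (simp add: Zi_less)
    next
      case 2
      have "Xs \<nu> (Iw ?\<mu> (Zi n ?m v)) = (if mset ?\<mu> = mset \<nu> then Gi \<nu> (Zi n ?m v) else 0)"
        using Cons.prems ln w 2 by (intro Cons.IH Zi_ge_M) auto
      then show ?thesis using 2 ms by auto
    next
      case 3
      have "Xs \<nu> (Iw ?\<mu> (Zi n ?m v)) = (if mset ?\<mu> = mset \<nu> then Gi \<nu> (Zi n ?m v) else 0)"
        using Cons.prems ln w 3 by (intro Cons.IH Zi_ge_M) auto
      moreover have "mset ?\<mu> \<noteq> mset \<nu>" using Cons.prems(2) w 3 wt[of ?\<mu> \<nu>] by auto
      ultimately show ?thesis using 3 by auto
    next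
      case 4
      let ?\<mu>' = "?\<mu> @ [?m - n - k - e - 1]"
      have w': "wt ?\<mu>' + n + k + e + 1 = wt \<mu>" using w 4 by simp
      have "Xs \<nu> (Iw ?\<mu>' v) = (if mset ?\<mu>' = mset \<nu> then Gi \<nu> v else 0)"
        using Cons.prems ln w' by (intro Cons.IH) auto
      moreover have "mset ?\<mu>' \<noteq> mset \<nu>"
      proof
        assume "mset ?\<mu>' = mset \<nu>"
        then have "length ?\<mu>' = length \<nu>" "wt ?\<mu>' = wt \<nu>" using wt by (blast dest: mset_eq_length)+
        then show False using Cons.prems(2,3) ln w' by auto
      qed
      moreover have "Iw ?\<mu> (Zi n ?m v) = of_int (- int e - 1 - int ?m) *s Iw ?\<mu>' v"
        using Zi_low[OF 4, of v] by (simp only: Iw_scale Iw_append)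
      ultimately show ?thesis using 4 by (simp add: Xs_scale)
    qed
  qed
  have "Xs (n # \<nu>) (Iw \<mu> v) = (\<Sum>i<length \<mu>. Xs \<nu> (Iw (del_nth i \<mu>) (Zi n (\<mu> ! i) v)))"
    using Cons.prems(1) by (simp add: X_Iw Xs_sum)
  also have "\<dots> = (\<Sum>i<length \<mu>. if \<mu> ! i = n \<and> mset \<mu> = mset (n # \<nu>) then Gi \<nu> (Zi n n v) else 0)"
    by (rule sum.cong) (use * in auto)
  also have "\<dots> = (if mset \<mu> = mset (n # \<nu>) then Gi (n # \<nu>) v else 0)"
  proof (cases "mset \<mu> = mset (n # \<nu>)")
    case True
    then have "(\<Sum>i<length \<mu>. if \<mu> ! i = n \<and> mset \<mu> = mset (n # \<nu>) then Gi \<nu> (Zi n n v) else 0) =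
        (\<Sum>i<length \<mu>. (if \<mu> ! i = n then 1 else 0) *s Gi \<nu> (Zi n n v))"
      by (intro sum.cong) auto
    also have "\<dots> = of_nat (count (mset \<mu>) n) *s Gi \<nu> (Zi n n v)"
      by (simp only: scale_sum_left[symmetric] sum_count_nth)
    finally show ?thesis using True by (simp add: Gi_scale)
  qed auto
  finally show ?case .
qed

lemma V0_rep:
  assumes "u \<in> V0"
  obtains F v where "finite F" "F \<subseteq> {\<mu>. sorted \<mu>}" "\<And>\<mu>. \<mu> \<in> F \<Longrightarrow> v \<mu> \<in> M \<and> v \<mu> \<noteq> 0"
    "u = (\<Sum>\<mu>\<in>F. Iw \<mu> (v \<mu>))"
proof -
  have "u \<in> span {Iw \<mu> v |\<mu> v. \<mu> \<in> {\<mu>. sorted \<mu>} \<and> v \<in> M}"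
  proof (rule V0_induct[OF assms subspace_span])
    fix \<mu> v assume v: "v \<in> M"
    then have "Iw \<mu> v = Iw (sort \<mu>) v" using M_C by (auto simp: Iw_mset)
    then show "Iw \<mu> v \<in> span {Iw \<mu> v |\<mu> v. \<mu> \<in> {\<mu>. sorted \<mu>} \<and> v \<in> M}"
      using v by (intro span_base) (use sorted_sort in blast)
  qed
  from span_family_rep[OF cvs_axioms Iw_add Iw_scale M_subspace this] that show thesis by metis
qed

text \<open>Among the monomials of maximal weight a shortest one \<open>\<nu>\<close> is the only one that survives the
  lowering operators with the indices of \<open>\<nu>\<close>. The same \<open>\<nu>\<close> serves for \<open>u\<close> and for \<open>I k u\<close>, since
  \<open>I k\<close> acts on the coefficients in \<open>M\<close>.\<close>

lemma V0_lowering: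
  assumes u: "u \<in> V0" "u \<noteq> 0"
  obtains \<nu> where "Xs \<nu> u \<in> M" "Xs \<nu> u \<noteq> 0" "k \<noteq> 0 \<Longrightarrow> Xs \<nu> (I (int k) u) \<noteq> 0"
proof -
  obtain F v where F: "finite F" "F \<subseteq> {\<mu>. sorted \<mu>}" "\<And>\<mu>. \<mu> \<in> F \<Longrightarrow> v \<mu> \<in> M \<and> v \<mu> \<noteq> 0"
    "u = (\<Sum>\<mu>\<in>F. Iw \<mu> (v \<mu>))"
    using V0_rep[OF u(1)] by metis
  then have "F \<noteq> {}" using u by auto
  define W where "W = Max (wt ` F)"
  have W: "\<And>\<mu>. \<mu> \<in> F \<Longrightarrow> wt \<mu> \<le> W" "{\<mu> \<in> F. wt \<mu> = W} \<noteq> {}"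
  proof -
    have "W \<in> wt ` F" unfolding W_def by (rule Max_in) (use F(1) \<open>F \<noteq> {}\<close> in auto)
    then show "{\<mu> \<in> F. wt \<mu> = W} \<noteq> {}" by blast
    show "wt \<mu> \<le> W" if "\<mu> \<in> F" for \<mu> unfolding W_def using F(1) that by (intro Max_ge) auto
  qed
  obtain \<nu> where \<nu>: "\<nu> \<in> F" "wt \<nu> = W" "\<And>\<mu>. \<mu> \<in> F \<Longrightarrow> wt \<mu> = W \<Longrightarrow> length \<nu> \<le> length \<mu>"
    using ex_min_if_finite[of "length ` {\<mu> \<in> F. wt \<mu> = W}"] F(1) W(2)
    by (force simp: not_less)
  have *: "Xs \<nu> (\<Sum>\<mu>\<in>F. Iw \<mu> (f \<mu>)) = Gi \<nu> (f \<nu>)" if f: "\<And>\<mu>. \<mu> \<in> F \<Longrightarrow> f \<mu> \<in> M" for f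
  proof -
    have "Xs \<nu> (Iw \<mu> (f \<mu>)) = (if \<mu> = \<nu> then Gi \<nu> (f \<nu>) else 0)" if \<mu>: "\<mu> \<in> F" for \<mu>
    proof -
      have "wt \<mu> < wt \<nu> \<or> length \<mu> \<ge> length \<nu>" using W(1)[OF \<mu>] \<nu>(2) \<nu>(3)[OF \<mu>] by linarith
      moreover have "mset \<mu> = mset \<nu> \<longleftrightarrow> \<mu> = \<nu>"
        using F(2) \<mu> \<nu>(1) by (metis mem_Collect_eq properties_for_sort subsetD sort_key_id_if_sorted sorted_sort_id)
      ultimately show ?thesis using Xs_Iw[OF f[OF \<mu>], of \<mu> \<nu>] W(1)[OF \<mu>] \<nu>(2) by auto
    qed
    then show ?thesis using F(1) \<nu>(1) by (simp add: Xs_sum)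
  qed
  have "Xs \<nu> u = Gi \<nu> (v \<nu>)" unfolding F(4) by (rule *) (use F in auto)
  moreover have "Xs \<nu> (I (int k) u) \<noteq> 0" if k: "k \<noteq> 0"
  proof -
    have "I (int k) u = (\<Sum>\<mu>\<in>F. Iw \<mu> (I (int k) (v \<mu>)))"
      unfolding F(4) op_sum by (intro sum.cong refl I_Iw) (use F(3) M_C in blast)
    also have "Xs \<nu> \<dots> = Gi \<nu> (I (int k) (v \<nu>))"
      by (rule *) (use F(3) M_closed[of _ "HI (int k)"] in auto)
    finally show ?thesis
      using Gi_inj[of "I (int k) (v \<nu>)" \<nu>] inj_Ik[OF k, of "v \<nu>"] F(3)[OF \<nu>(1)]
        M_closed[of "v \<nu>" "HI (int k)"] by auto
  qed
  ultimately show thesis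
    using that[of \<nu>] Gi_M Gi_inj F(3)[OF \<nu>(1)] by metis
qed

lemma Ik_inj_V0: "k \<noteq> 0 \<Longrightarrow> u \<in> V0 \<Longrightarrow> I (int k) u = 0 \<Longrightarrow> u = 0"
  using V0_lowering[of u] by (metis Xs_zero)

end

context hv_induced
begin

subsection \<open>The operators \<open>L\<close> of negative index\<close>

definition Lw :: "nat list \<Rightarrow> 'e \<Rightarrow> 'e" where
  "Lw \<mu> v = foldr (\<lambda>m. L (- 1 - int m)) \<mu> v"

text \<open>The filtration by the number of \<open>L\<close>s; the order of the \<open>L\<close>s, and the place of an \<open>I\<close> among them,
  matter only for the lower terms.\<close>

definition FL :: "nat \<Rightarrow> 'e set" where
  "FL d = span {Lw \<mu> u |\<mu> u. length \<mu> < d \<and> u \<in> V0}"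

lemma Lw_simps [simp]: "Lw [] v = v" "Lw (m # \<mu>) v = L (- 1 - int m) (Lw \<mu> v)"
  by (simp_all add: Lw_def)

lemma Lw_add: "Lw \<mu> (u + v) = Lw \<mu> u + Lw \<mu> v" and Lw_scale: "Lw \<mu> (c *s v) = c *s Lw \<mu> v"
  by (induction \<mu>) (simp_all add: op_add op_scale)

lemma Lw_diff: "Lw \<mu> (u - v) = Lw \<mu> u - Lw \<mu> v"
  by (induction \<mu>) (simp_all add: op_diff)

lemma Lw_zero [simp]: "Lw \<mu> 0 = 0" by (induction \<mu>) simp_all

lemma Lw_C: "u \<in> V0 \<Longrightarrow> Lw \<mu> u \<in> C"
  using V0_C by (induction \<mu>) (auto simp: op_closed)

lemma FL_subspace: "subspace (FL d)" unfolding FL_def by (rule subspace_span)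

lemma FL_0: "FL 0 = {0}" by (simp add: FL_def)

lemma Lw_FL: "length \<mu> < d \<Longrightarrow> u \<in> V0 \<Longrightarrow> Lw \<mu> u \<in> FL d"
  unfolding FL_def by (rule span_base) auto

lemma FL_induct:
  assumes "v \<in> FL d" and "subspace W" and "\<And>\<mu> v. length \<mu> < d \<Longrightarrow> v \<in> V0 \<Longrightarrow> Lw \<mu> v \<in> W"
  shows "v \<in> W"
  using span_minimal[of "{Lw \<mu> u |\<mu> u. length \<mu> < d \<and> u \<in> V0}" W] assms unfolding FL_def by blast

lemma FL_mono: "d \<le> d' \<Longrightarrow> v \<in> FL d \<Longrightarrow> v \<in> FL d'"
  using FL_induct[of v d "FL d'"] FL_subspace Lw_FL by auto

lemma Ld_FL: "v \<in> FL d \<Longrightarrow> L (- 1 - int m) v \<in> FL (Suc d)"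
  using FL_induct[of v d "{v. L (- 1 - int m) v \<in> FL (Suc d)}"]
    subspace_vimage_op[OF FL_subspace] Lw_FL[of "m # _" "Suc d"] by simp

lemma I_Ld: "v \<in> C \<Longrightarrow> I p (L (- 1 - int m) v) = L (- 1 - int m) (I p v) - of_int p *s I (p - 1 - int m) v
    - (if p = 1 + int m then of_int ((1 + int m) ^ 2 - (1 + int m)) * c2 else 0) *s v"
proof -
  assume v: "v \<in> C"
  have 1: "- 1 - int m + p = p - 1 - int m" by simp
  have 2: "p - 1 - int m = 0 \<longleftrightarrow> p = 1 + int m" by linarith
  have 3: "(- 1 - int m) ^ 2 + (- 1 - int m) = (1 + int m) ^ 2 - (1 + int m)"
    by (simp add: power2_eq_square algebra_simps)
  show ?thesis unfolding IL[OF v] 1 2 3 ..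
qed

lemma I_Lw_FL: "u \<in> V0 \<Longrightarrow> I p (Lw \<mu> u) \<in> FL (Suc (length \<mu>))"
proof (induction \<mu> arbitrary: p)
  case Nil
  then show ?case using Lw_FL[of "[]" 1 "I p u"] I_V0[of u p] by simp
next
  case (Cons m \<mu>)
  note FL = subspace_diff[OF FL_subspace] subspace_scale[OF FL_subspace]
  have "I q (Lw \<mu> u) \<in> FL (Suc (Suc (length \<mu>)))" for q
    by (rule FL_mono[OF _ Cons.IH[OF Cons.prems]]) simp
  moreover have "Lw \<mu> u \<in> FL (Suc (Suc (length \<mu>)))"
    using Cons.prems by (intro Lw_FL) auto
  moreover have "L (- 1 - int m) (I p (Lw \<mu> u)) \<in> FL (Suc (Suc (length \<mu>)))"
    by (rule Ld_FL[OF Cons.IH[OF Cons.prems]])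
  ultimately show ?case
    unfolding Lw_simps I_Ld[OF Lw_C[OF Cons.prems]] length_Cons by (intro FL)
qed

text \<open>Moving an operator \<open>I p\<close> to the right past \<open>L\<close>s costs only terms with fewer \<open>L\<close>s.\<close>

lemma I_Lw: "u \<in> V0 \<Longrightarrow> I p (Lw \<mu> u) - Lw \<mu> (I p u) \<in> FL (length \<mu>)"
proof (induction \<mu>)
  case Nil
  show ?case by (simp add: FL_0)
next
  case (Cons m \<mu>)
  let ?c = "(if p = 1 + int m then of_int ((1 + int m) ^ 2 - (1 + int m)) * c2 else 0)"
  have "I p (Lw (m # \<mu>) u) - Lw (m # \<mu>) (I p u) =
      L (- 1 - int m) (I p (Lw \<mu> u) - Lw \<mu> (I p u))
      - of_int p *s I (p - 1 - int m) (Lw \<mu> u) - ?c *s Lw \<mu> u"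
    using Cons.prems by (simp add: I_Ld Lw_C op_diff)
  moreover have "L (- 1 - int m) (I p (Lw \<mu> u) - Lw \<mu> (I p u)) \<in> FL (Suc (length \<mu>))"
    using Cons by (intro Ld_FL) auto
  moreover have "I (p - 1 - int m) (Lw \<mu> u) \<in> FL (Suc (length \<mu>))" "Lw \<mu> u \<in> FL (Suc (length \<mu>))"
    using Cons.prems by (auto intro: I_Lw_FL Lw_FL)
  ultimately show ?case
    by (simp only: length_Cons) (intro subspace_diff[OF FL_subspace] subspace_scale[OF FL_subspace])
qed

lemma Lw_sort: "u \<in> V0 \<Longrightarrow> Lw (sort \<mu>) u - Lw \<mu> u \<in> FL (length \<mu>)"
proof (induction \<mu>)
  case Nil
  show ?case by (simp add: FL_0)
next
  case (Cons m \<mu>)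
  note sub = subspace_add[OF FL_subspace] subspace_scale[OF FL_subspace]
  have ins: "Lw (insort m xs) u - Lw (m # xs) u \<in> FL (Suc (length xs))" for xs
  proof (induction xs)
    case Nil
    show ?case using FL_subspace by (simp add: subspace_0)
  next
    case (Cons x xs)
    show ?case
    proof (cases "m \<le> x")
      case True
      then show ?thesis using FL_subspace by (simp add: subspace_0)
    next
      case False
      have "- 1 - int x + (- 1 - int m) = - 1 - int (Suc (x + m))" by simp
      moreover have "- 1 - int x + (- 1 - int m) \<noteq> 0" by linarith
      ultimately have "L (- 1 - int x) (L (- 1 - int m) (Lw xs u)) = L (- 1 - int m) (L (- 1 - int x) (Lw xs u))
          + of_int (- 1 - int m - (- 1 - int x)) *s Lw (Suc (x + m) # xs) u"
        using LL[OF Lw_C[OF \<open>u \<in> V0\<close>], of "- 1 - int x" "- 1 - int m" xs] by (simp only: Lw_simps if_False scale_zero_left add_0_right)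
      then have "Lw (insort m (x # xs)) u - Lw (m # x # xs) u =
          L (- 1 - int x) (Lw (insort m xs) u - Lw (m # xs) u)
          + of_int (- 1 - int m - (- 1 - int x)) *s Lw (Suc (x + m) # xs) u"
        using False by (simp add: op_diff)
      moreover have "L (- 1 - int x) (Lw (insort m xs) u - Lw (m # xs) u) \<in> FL (Suc (length (x # xs)))"
        using Cons by (intro Ld_FL) auto
      moreover have "Lw (Suc (x + m) # xs) u \<in> FL (Suc (length (x # xs)))"
        using \<open>u \<in> V0\<close> by (intro Lw_FL) auto
      ultimately show ?thesis by (simp only:) (intro sub)
    qed
  qed
  have "Lw (sort (m # \<mu>)) u - Lw (m # \<mu>) u =
      (Lw (insort m (sort \<mu>)) u - Lw (m # sort \<mu>) u) + L (- 1 - int m) (Lw (sort \<mu>) u - Lw \<mu> u)"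
    by (simp add: op_diff)
  also have "\<dots> \<in> FL (length (m # \<mu>))"
    using ins[of "sort \<mu>"] Ld_FL[OF Cons.IH[OF Cons.prems], of m] by (simp add: subspace_add[OF FL_subspace])
  finally show ?case .
qed

text \<open>\<open>Zl n m\<close> is the bracket of the lowering operator \<open>I (k + 1 + n)\<close> with \<open>L (-1 - m)\<close>.\<close>

definition Zl :: "nat \<Rightarrow> nat \<Rightarrow> 'e \<Rightarrow> 'e" where
  "Zl n m v = - of_int (int k + 1 + int n) *s I (int k + int n - int m) v
    - (if k + n = m then of_int ((1 + int m) ^ 2 - (1 + int m)) * c2 else 0) *s v"

lemma J_Ld: "v \<in> C \<Longrightarrow> I (int k + 1 + int n) (L (- 1 - int m) v) =
    L (- 1 - int m) (I (int k + 1 + int n) v) + Zl n m v"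
proof -
  assume v: "v \<in> C"
  have i: "int k + 1 + int n - 1 - int m = int k + int n - int m" by simp
  have j: "int k + 1 + int n = 1 + int m \<longleftrightarrow> k + n = m" by linarith
  show ?thesis unfolding I_Ld[OF v] i j Zl_def by (simp only: scale_minus_left) simp
qed

lemma Zl_V0: "v \<in> V0 \<Longrightarrow> Zl n m v \<in> V0"
  unfolding Zl_def
  by (intro subspace_diff[OF V0_subspace] subspace_scale[OF V0_subspace] I_V0)

lemma Zl_scale: "Zl n m (c *s v) = c *s Zl n m v"
  by (simp add: Zl_def op_scale scale_right_diff_distrib mult.commute)

lemma Zl_less: "m < n \<Longrightarrow> v \<in> V0 \<Longrightarrow> Zl n m v = 0"
  by (simp add: Zl_def I_kills_V0)

lemma Zl_Lw: "u \<in> V0 \<Longrightarrow> Zl n m (Lw \<mu> u) - Lw \<mu> (Zl n m u) \<in> FL (length \<mu>)"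
proof -
  assume u: "u \<in> V0"
  have "Zl n m (Lw \<mu> u) - Lw \<mu> (Zl n m u) = - of_int (int k + 1 + int n) *s
      (I (int k + int n - int m) (Lw \<mu> u) - Lw \<mu> (I (int k + int n - int m) u))"
    by (simp add: Zl_def Lw_diff Lw_scale scale_right_diff_distrib)
  then show ?thesis using I_Lw[OF u] by (simp only: subspace_scale[OF FL_subspace])
qed

lemma Zl_inj: "v \<in> V0 \<Longrightarrow> Zl n n v = 0 \<Longrightarrow> v = 0"
proof (cases "k = 0")
  case True
  assume v: "v \<in> V0" and z: "Zl n n v = 0"
  let ?N = "of_int (1 + int n) :: complex"
  have "Zl n n v = - ?N *s c0 *s v - ((?N ^ 2 - ?N) * c2) *s v"
    using v V0_C unfolding Zl_def by (simp add: True C_I0 subset_iff add_ac)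
  also have "\<dots> = (- ?N * (c0 + (of_int (1 + int n) - 1) * c2)) *s v"
    by (simp only: scale_scale scale_left_diff_distrib[symmetric])
      (simp add: power2_eq_square algebra_simps)
  finally have eq: "Zl n n v = (- ?N * (c0 + (of_int (1 + int n) - 1) * c2)) *s v" .
  have "c0 + (of_int (1 + int n) - 1) * c2 \<noteq> 0"
    by (rule nondegenerate[OF True]) simp
  moreover have "?N \<noteq> 0" unfolding of_int_eq_0_iff by linarith
  ultimately have "- ?N * (c0 + (of_int (1 + int n) - 1) * c2) \<noteq> 0"
    by (simp only: mult_eq_0_iff neg_equal_0_iff_equal) blast
  then show "v = 0" using z eq by (metis scale_eq_0_iff)
next
  case False
  assume v: "v \<in> V0" and z: "Zl n n v = 0"
  have "of_int (int k + 1 + int n) \<noteq> (0::complex)"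
    unfolding of_int_eq_0_iff by linarith
  then have "I (int k) v = 0" using z False by (simp add: Zl_def del: of_int_add)
  then show "v = 0" using Ik_inj_V0[OF False v] by simp
qed

lemma J_Lw:
  assumes u: "u \<in> V0"
  shows "I (int k + 1 + int n) (Lw \<mu> u) - (\<Sum>i<length \<mu>. Lw (del_nth i \<mu>) (Zl n (\<mu> ! i) u))
    \<in> FL (length \<mu> - 1)"
proof (induction \<mu>)
  case Nil
  show ?case using u by (simp add: I_kills_V0 FL_0)
next
  case (Cons m \<mu>)
  let ?S = "\<Sum>i<length \<mu>. Lw (del_nth i \<mu>) (Zl n (\<mu> ! i) u)"
  have "I (int k + 1 + int n) (Lw (m # \<mu>) u) -
      (\<Sum>i<length (m # \<mu>). Lw (del_nth i (m # \<mu>)) (Zl n ((m # \<mu>) ! i) u)) =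
      L (- 1 - int m) (I (int k + 1 + int n) (Lw \<mu> u) - ?S)
      + (Zl n m (Lw \<mu> u) - Lw \<mu> (Zl n m u))"
    using u by (simp add: J_Ld Lw_C op_diff op_sum sum.lessThan_Suc_shift del: sum.lessThan_Suc)
  also have "\<dots> \<in> FL (length \<mu>)"
  proof (rule subspace_add[OF FL_subspace _ Zl_Lw[OF u]])
    show "L (- 1 - int m) (I (int k + 1 + int n) (Lw \<mu> u) - ?S) \<in> FL (length \<mu>)"
    proof (cases "length \<mu>")
      case 0
      then show ?thesis using u by (simp add: I_kills_V0 FL_0)
    next
      case (Suc d)
      then show ?thesis using Ld_FL[OF Cons.IH, of m] by simp
    qed
  qed
  finally show ?case by simp
qed

fun Gl :: "nat list \<Rightarrow> 'e \<Rightarrow> 'e" where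
  "Gl [] v = v"
| "Gl (n # \<nu>) v = Gl \<nu> (of_nat (count (mset (n # \<nu>)) n) *s Zl n n v)"

lemma Gl_scale: "Gl \<nu> (c *s v) = c *s Gl \<nu> v"
  by (induction \<nu> arbitrary: v c) (simp_all add: Zl_scale mult.commute del: of_nat_Suc)

lemma Gl_V0: "v \<in> V0 \<Longrightarrow> Gl \<nu> v \<in> V0"
  by (induction \<nu> arbitrary: v) (simp_all add: subspace_scale[OF V0_subspace] Zl_V0)

lemma Gl_inj: "v \<in> V0 \<Longrightarrow> Gl \<nu> v = 0 \<Longrightarrow> v = 0"
proof (induction \<nu> arbitrary: v)
  case (Cons n \<nu>)
  have "Zl n n v \<in> V0" using Cons.prems by (simp add: Zl_V0)
  then have "of_nat (count (mset (n # \<nu>)) n) *s Zl n n v = 0"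
    using Cons by (simp only: Gl.simps) (meson V0_subspace subspace_scale)
  then have "Zl n n v = 0" by (simp del: of_nat_Suc)
  then show ?case using Zl_inj Cons.prems by blast
qed simp

definition Js :: "nat list \<Rightarrow> 'e \<Rightarrow> 'e" where
  "Js \<nu> v = fold (\<lambda>n. I (int k + 1 + int n)) \<nu> v"

lemma Js_simps [simp]: "Js [] v = v" "Js (n # \<nu>) v = Js \<nu> (I (int k + 1 + int n) v)"
  by (simp_all add: Js_def)

lemma Js_add: "Js \<nu> (u + v) = Js \<nu> u + Js \<nu> v" and Js_scale: "Js \<nu> (c *s v) = c *s Js \<nu> v"
  by (induction \<nu> arbitrary: u v) (simp_all add: op_add op_scale)

lemma Js_zero [simp]: "Js \<nu> 0 = 0" by (induction \<nu>) simp_all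

lemma Js_sum: "Js \<nu> (\<Sum>i\<in>A. f i) = (\<Sum>i\<in>A. Js \<nu> (f i))"
  by (induction A rule: infinite_finite_induct) (simp_all add: Js_add)

text \<open>Each operator \<open>I (k + 1 + n)\<close> lowers the number of \<open>L\<close>s by one, up to terms with still fewer
  \<open>L\<close>s that the remaining operators kill. It removes an \<open>L (-1 - m)\<close> with \<open>m \<ge> n\<close>, so that for a
  product of length equal to that of \<open>\<nu>\<close> and index sum at most that of \<open>\<nu>\<close> every removal must have
  \<open>m = n\<close>.\<close>

lemma Js_Lw:
  assumes "u \<in> V0" "length \<mu> < length \<nu> \<or> length \<mu> = length \<nu> \<and> sum_list \<mu> \<le> sum_list \<nu>"
  shows "Js \<nu> (Lw \<mu> u) = (if mset \<mu> = mset \<nu> then Gl \<nu> u else 0)"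
  using assms
proof (induction \<nu> arbitrary: \<mu> u)
  case Nil
  then show ?case by simp
next
  case (Cons n \<nu>)
  have kill: "Js \<nu> v = 0" if "v \<in> FL (length \<nu>)" for v
  proof -
    have "v \<in> {v. Js \<nu> v = 0}"
    proof (rule FL_induct[OF that])
      show "subspace {v. Js \<nu> v = 0}" by (simp add: subspace_def Js_add Js_scale)
      fix \<mu> :: "nat list" and u assume "length \<mu> < length \<nu>" "u \<in> V0"
      then show "Lw \<mu> u \<in> {v. Js \<nu> v = 0}"
        using Cons.IH[of u \<mu>] by (auto dest: mset_eq_length)
    qed
    then show ?thesis by simp
  qed
  have *: "Js \<nu> (Lw (del_nth i \<mu>) (Zl n (\<mu> ! i) u)) =
      (if \<mu> ! i = n \<and> mset \<mu> = mset (n # \<nu>) then Gl \<nu> (Zl n n u) else 0)"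
    if i: "i < length \<mu>" for i
  proof -
    let ?\<mu> = "del_nth i \<mu>" and ?m = "\<mu> ! i"
    have ms: "mset \<mu> = add_mset ?m (mset ?\<mu>)" and ln: "length \<mu> = Suc (length ?\<mu>)"
      and w: "sum_list \<mu> = ?m + sum_list ?\<mu>"
      using mset_del_nth[OF i] length_del_nth[OF i] sum_list_del_nth[OF i, of id] by simp_all
    show ?thesis
    proof (cases "?m < n")
      case True
      then show ?thesis using Cons.prems by (simp add: Zl_less)
    next
      case False
      have "Js \<nu> (Lw ?\<mu> (Zl n ?m u)) = (if mset ?\<mu> = mset \<nu> then Gl \<nu> (Zl n ?m u) else 0)"
        using Cons.prems ln w False by (intro Cons.IH Zl_V0) auto
      moreover have "?m = n" if "mset ?\<mu> = mset \<nu>"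
      proof -
        have "length ?\<mu> = length \<nu>" "sum_list ?\<mu> = sum_list \<nu>"
          using that by (metis mset_eq_length, metis sum_mset_sum_list)
        then show ?thesis using Cons.prems(2) ln w False by simp
      qed
      ultimately show ?thesis using ms by auto
    qed
  qed
  let ?S = "\<Sum>i<length \<mu>. Lw (del_nth i \<mu>) (Zl n (\<mu> ! i) u)"
  have "I (int k + 1 + int n) (Lw \<mu> u) - ?S \<in> FL (length \<nu>)"
    using J_Lw[OF Cons.prems(1), of n \<mu>] Cons.prems(2) by (auto intro: FL_mono[rotated])
  then have "Js \<nu> (?S + (I (int k + 1 + int n) (Lw \<mu> u) - ?S)) = Js \<nu> ?S"
    using kill by (simp only: Js_add) simp
  then have "Js (n # \<nu>) (Lw \<mu> u) = (\<Sum>i<length \<mu>. Js \<nu> (Lw (del_nth i \<mu>) (Zl n (\<mu> ! i) u)))"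
    by (simp add: Js_sum)
  also have "\<dots> = (\<Sum>i<length \<mu>. if \<mu> ! i = n \<and> mset \<mu> = mset (n # \<nu>) then Gl \<nu> (Zl n n u) else 0)"
    by (rule sum.cong) (use * in auto)
  also have "\<dots> = (if mset \<mu> = mset (n # \<nu>) then Gl (n # \<nu>) u else 0)"
  proof (cases "mset \<mu> = mset (n # \<nu>)")
    case True
    then have "(\<Sum>i<length \<mu>. if \<mu> ! i = n \<and> mset \<mu> = mset (n # \<nu>) then Gl \<nu> (Zl n n u) else 0) =
        (\<Sum>i<length \<mu>. (if \<mu> ! i = n then 1 else 0) *s Gl \<nu> (Zl n n u))"
      by (intro sum.cong) auto
    also have "\<dots> = of_nat (count (mset \<mu>) n) *s Gl \<nu> (Zl n n u)"
      by (simp only: scale_sum_left[symmetric] sum_count_nth)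
    finally show ?thesis using True by (simp add: Gl_scale)
  qed auto
  finally show ?case .
qed

lemma C_FL:
  assumes "w \<in> C"
  obtains d where "w \<in> FL d"
proof -
  let ?S = "span {Lw \<mu> u |\<mu> u. u \<in> V0}"
  have S: "subspace ?S" by (rule subspace_span)
  have gen: "Lw \<mu> u \<in> ?S" if "u \<in> V0" for \<mu> u using that by (intro span_base) auto
  have FL_S: "v \<in> ?S" if "v \<in> FL d" for v d
    by (rule FL_induct[OF that S]) (rule gen)
  note sub = subspace_add[OF S] subspace_scale[OF S]
  have opgen: "op a (Lw \<mu> u) \<in> ?S" if u: "u \<in> V0" for a \<mu> u
  proof (cases a)
    case (HL p)
    have L: "L p (Lw \<mu> u) \<in> ?S" for p
    proof (induction \<mu> arbitrary: p)
      case Nil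
      show ?case
      proof (cases "p \<ge> 0")
        case True
        then show ?thesis using gen[of "L p u" "[]"] L_V0[OF u] by simp
      next
        case False
        then show ?thesis using gen[OF u, of "[nat (- 1 - p)]"] by simp
      qed
    next
      case (Cons m \<mu>)
      show ?case
      proof (cases "p \<ge> 0")
        case True
        have "L (- 1 - int m) v \<in> ?S" if "v \<in> ?S" for v
        proof -
          have "v \<in> {v. L (- 1 - int m) v \<in> ?S}"
            using that by (rule span_induct_alt)
              (use gen[of _ "m # _"] in \<open>auto simp: op_add op_scale intro!: sub subspace_0[OF S] simp flip: Lw_simps\<close>)
          then show ?thesis by simp
        qed
        then show ?thesis
          using Cons LL[OF Lw_C[OF u], of p "- 1 - int m" \<mu>] gen[OF u, of \<mu>] by (auto intro!: sub)
      next
        case False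
        then show ?thesis using gen[OF u, of "nat (- 1 - p) # m # \<mu>"] by simp
      qed
    qed
    show ?thesis unfolding HL by (rule L)
  next
    case (HI p)
    then show ?thesis using FL_S[OF I_Lw_FL[OF u]] by simp
  qed (use gen[OF u] Lw_C[OF u] in \<open>auto simp: C_C1 C_C2 C_C3 intro: sub subspace_0[OF S]\<close>)
  have "op a w \<in> ?S" if "w \<in> ?S" for a w
  proof -
    have "?S \<subseteq> {v. op a v \<in> ?S}"
      by (rule span_minimal[OF _ subspace_vimage_op[OF S]]) (use opgen in auto)
    then show ?thesis using that by blast
  qed
  moreover have "?S \<subseteq> C" by (rule span_minimal[OF _ C_subspace]) (use Lw_C in auto)
  moreover have "M \<subseteq> ?S" using gen[of _ "[]"] M_V0 by auto
  ultimately have "?S = C" using S by (intro generated) (auto simp: invariant_def)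
  moreover have "\<exists>d. v \<in> FL d" if "v \<in> ?S" for v
    using that
  proof (induction rule: span_induct_alt)
    case base
    show ?case using FL_0 by blast
  next
    case (step c x y)
    from step obtain \<mu> u d where x: "x = Lw \<mu> u" "u \<in> V0" and d: "y \<in> FL d" by blast
    have "x \<in> FL (max d (Suc (length \<mu>)))" "y \<in> FL (max d (Suc (length \<mu>)))"
      using x d Lw_FL FL_mono[of d] by auto
    then show ?case by (blast intro: subspace_add[OF FL_subspace] subspace_scale[OF FL_subspace])
  qed
  ultimately show thesis using assms that by blast
qed

text \<open>The leading part of \<open>w\<close> consists of the longest words; of these, one of maximal index sum is
  singled out by the lowering operators.\<close>

lemma C_lowering:
  assumes w: "w \<in> C" "w \<noteq> 0"
  obtains \<nu> where "Js \<nu> w \<in> V0" "Js \<nu> w \<noteq> 0"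
proof -
  obtain d0 where "w \<in> FL d0" using C_FL[OF w(1)] by blast
  define d where "d = (LEAST d. w \<in> FL d)"
  have d: "w \<in> FL d" "\<And>d'. d' < d \<Longrightarrow> w \<notin> FL d'"
    using LeastI[of "\<lambda>d. w \<in> FL d", OF \<open>w \<in> FL d0\<close>] not_less_Least unfolding d_def by blast+
  then obtain l where l: "d = Suc l" using w FL_0 by (cases d) auto
  let ?A = "{\<mu>. sorted \<mu> \<and> length \<mu> = l}"
  let ?T = "span {Lw \<mu> u |\<mu> u. \<mu> \<in> ?A \<and> u \<in> V0}"
  have "w \<in> {x + y |x y. x \<in> ?T \<and> y \<in> FL l}"
  proof (rule FL_induct[OF d(1) subspace_sums[OF subspace_span FL_subspace]])
    fix \<mu> :: "nat list" and u assume \<mu>: "length \<mu> < d" and u: "u \<in> V0"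
    show "Lw \<mu> u \<in> {x + y |x y. x \<in> ?T \<and> y \<in> FL l}"
    proof (cases "length \<mu> = l")
      case True
      then have "Lw (sort \<mu>) u \<in> ?T" using u by (intro span_base) (auto intro!: exI[of _ "sort \<mu>"])
      moreover have "Lw \<mu> u - Lw (sort \<mu>) u \<in> FL l"
        using subspace_neg[OF FL_subspace Lw_sort[OF u, of \<mu>]] True by simp
      ultimately show ?thesis by (intro CollectI exI[of _ "Lw (sort \<mu>) u"] exI[of _ "Lw \<mu> u - Lw (sort \<mu>) u"]) simp
    next
      case False
      then have "Lw \<mu> u \<in> FL l" using \<mu> u l by (intro Lw_FL) auto
      then show ?thesis using subspace_0[OF subspace_span]
        by (intro CollectI exI[of _ 0] exI[of _ "Lw \<mu> u"]) simp
    qed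
  qed
  then obtain x r where x: "x \<in> ?T" and r: "r \<in> FL l" and wxr: "w = x + r" by blast
  obtain F u where F: "finite F" "F \<subseteq> ?A" "\<And>\<mu>. \<mu> \<in> F \<Longrightarrow> u \<mu> \<in> V0 \<and> u \<mu> \<noteq> 0"
    "x = (\<Sum>\<mu>\<in>F. Lw \<mu> (u \<mu>))"
    by (rule span_family_rep[OF cvs_axioms Lw_add Lw_scale V0_subspace x]; rule that; assumption)
  have "F \<noteq> {}" using F(4) wxr r d(2)[of l] l by auto
  then have "Max (sum_list ` F) \<in> sum_list ` F" using F(1) by (intro Max_in) auto
  then obtain \<nu> where "\<nu> \<in> F" "sum_list \<nu> = Max (sum_list ` F)" by auto
  with F(1) have \<nu>: "\<nu> \<in> F" "\<And>\<mu>. \<mu> \<in> F \<Longrightarrow> sum_list \<mu> \<le> sum_list \<nu>" by auto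
  have "Js \<nu> (Lw \<mu> (u \<mu>)) = (if \<mu> = \<nu> then Gl \<nu> (u \<nu>) else 0)" if \<mu>: "\<mu> \<in> F" for \<mu>
  proof -
    have "mset \<mu> = mset \<nu> \<longleftrightarrow> \<mu> = \<nu>"
      using F(2) \<mu> \<nu>(1) by (metis (no_types, lifting) mem_Collect_eq properties_for_sort subsetD sort_key_id_if_sorted sorted_sort_id)
    moreover have "length \<mu> = length \<nu>" using F(2) \<mu> \<nu>(1) by auto
    ultimately show ?thesis
      using Js_Lw[of "u \<mu>" \<mu> \<nu>] F(3)[OF \<mu>] \<nu>(2)[OF \<mu>] by auto
  qed
  then have "Js \<nu> x = Gl \<nu> (u \<nu>)"
    using F(1) \<nu>(1) unfolding F(4) by (simp add: Js_sum)
  moreover have "Js \<nu> r = 0"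
  proof -
    have "r \<in> {v. Js \<nu> v = 0}"
    proof (rule FL_induct[OF r])
      show "subspace {v. Js \<nu> v = 0}" by (simp add: subspace_def Js_add Js_scale)
      fix \<mu> :: "nat list" and v assume \<mu>: "length \<mu> < l" "v \<in> V0"
      moreover have "length \<nu> = l" using \<nu>(1) F(2) by auto
      ultimately show "Lw \<mu> v \<in> {v. Js \<nu> v = 0}"
        using Js_Lw[of v \<mu> \<nu>] by (auto dest: mset_eq_length)
    qed
    then show ?thesis by simp
  qed
  ultimately have "Js \<nu> w = Gl \<nu> (u \<nu>)" by (simp add: wxr Js_add)
  then show thesis
    using that[of \<nu>] Gl_V0 Gl_inj F(3)[OF \<nu>(1)] by metis
qed

text \<open>A nonzero submodule contains a nonzero vector of \<open>V0\<close>, hence one of \<open>M\<close>, hence all of \<open>M\<close> by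
  simplicity, hence the module that \<open>M\<close> generates.\<close>

theorem simple_C: "simple"
  unfolding simple_def
proof (intro conjI allI impI)
  show "C \<noteq> {0}" using M_nz M_C M_subspace subspace_0 by blast
  fix W assume W: "invariant W"
  then have W_sub: "subspace W" and W_C: "W \<subseteq> C" and W_op: "\<And>a w. w \<in> W \<Longrightarrow> op a w \<in> W"
    by (auto simp: invariant_def)
  show "W = {0} \<or> W = C"
  proof (cases "W = {0}")
    case False
    then obtain w where w: "w \<in> W" "w \<noteq> 0" using subspace_0[OF W_sub] by auto
    have Js_W: "Js \<nu> v \<in> W" if "v \<in> W" for \<nu> v
      using that by (induction \<nu> arbitrary: v) (auto simp: W_op)
    have Xs_W: "Xs \<nu> v \<in> W" if "v \<in> W" for \<nu> v
      using that by (induction \<nu> arbitrary: v) (auto simp: W_op)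
    have "w \<in> C" using w(1) W_C by blast
    then obtain \<nu> where \<nu>: "Js \<nu> w \<in> V0" "Js \<nu> w \<noteq> 0" by (rule C_lowering[OF _ w(2)])
    obtain \<nu>' where \<nu>': "Xs \<nu>' (Js \<nu> w) \<in> M" "Xs \<nu>' (Js \<nu> w) \<noteq> 0"
      by (rule V0_lowering[OF \<nu>])
    have "Xs \<nu>' (Js \<nu> w) \<in> W \<inter> M" using Xs_W Js_W w \<nu>' by blast
    then have "W \<inter> M \<noteq> {0}" using \<nu>'(2) by blast
    then have "W \<inter> M = M"
      by (intro M_simple) (auto simp: subspace_inter W_sub M_subspace W_op M_closed)
    then show ?thesis using generated[OF W] by blast
  qed simp
qed

theorem restricted:
  assumes "v \<in> C"
  obtains N where "\<And>n. n \<ge> N \<Longrightarrow> L n v = 0" "\<And>n. n \<ge> N \<Longrightarrow> I n v = 0"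
proof -
  let ?R = "{v \<in> C. \<exists>N. \<forall>n\<ge>N. L n v = 0 \<and> I n v = 0}"
  have "invariant ?R"
    unfolding invariant_def
  proof (intro conjI ballI allI)
    show "subspace ?R"
      unfolding subspace_def
    proof (intro conjI ballI allI)
      fix u v assume "u \<in> ?R" "v \<in> ?R"
      then obtain N N' where "\<forall>n\<ge>N. L n u = 0 \<and> I n u = 0" "\<forall>n\<ge>N'. L n v = 0 \<and> I n v = 0"
        and "u \<in> C" "v \<in> C" by blast
      then show "u + v \<in> ?R"
        by (auto simp: op_add subspace_add[OF C_subspace] intro!: exI[of _ "max N N'"])
    qed (auto simp: op_scale subspace_0[OF C_subspace] subspace_scale[OF C_subspace])
    fix a v assume "v \<in> ?R"
    then obtain N where N: "\<And>n. n \<ge> N \<Longrightarrow> L n v = 0" "\<And>n. n \<ge> N \<Longrightarrow> I n v = 0" and v: "v \<in> C" by blast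
    have "\<exists>N. \<forall>n\<ge>N. L n (op a v) = 0 \<and> I n (op a v) = 0"
    proof (cases a)
      case (HL p)
      have "L n (L p v) = 0 \<and> I n (L p v) = 0" if "n \<ge> max (max N (N - p)) (1 - p)" for n
        using that by (simp add: LL[OF v, of n p] IL[OF v, of n p] N)
      then show ?thesis unfolding HL by blast
    next
      case (HI p)
      have "L n (I p v) = 0 \<and> I n (I p v) = 0" if "n \<ge> max (max N (N - p)) (1 - p)" for n
        using that by (simp add: LI[OF v, of n p] II[OF v, of n p] N)
      then show ?thesis unfolding HI by blast
    qed (use v N in \<open>auto simp: C_C1 C_C2 C_C3 op_scale intro!: exI[of _ N]\<close>)
    then show "op a v \<in> ?R" using v by (simp add: op_closed)
  qed auto
  moreover have "M \<subseteq> ?R"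
    using M_C M_I M_L by (auto intro!: exI[of _ "int k + int e + 1"])
  ultimately have "?R = C" by (rule generated)
  then show thesis using assms that by blast
qed

end

section \<open>Exponential polynomials\<close>

lemma shift_poly:
  fixes p :: "complex poly"
  shows "degree (pcompose p [:1, 1:]) = degree p" "lead_coeff (pcompose p [:1, 1:]) = lead_coeff p"
proof -
  show d: "degree (pcompose p [:1, 1:]) = degree p" by (simp add: degree_pcompose)
  show "lead_coeff (pcompose p [:1, 1:]) = lead_coeff p"
    using lead_coeff_comp[of "[:1, 1:]" p] by simp
qed

lemma degree_shift_diff:
  fixes p :: "complex poly"
  assumes "p \<noteq> 0 \<Longrightarrow> degree p < Suc d"
  defines "q \<equiv> pcompose p [:1, 1:] - p"
  shows "q \<noteq> 0 \<Longrightarrow> degree q < d"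
proof -
  assume q: "q \<noteq> 0"
  then have "p \<noteq> 0" by (auto simp: q_def)
  have "degree q \<le> degree p" unfolding q_def
    by (rule order_trans[OF degree_diff_le_max]) (simp add: shift_poly)
  moreover have "coeff q (degree p) = 0"
    using shift_poly[of p] by (simp add: q_def)
  ultimately have "degree q < degree p"
    using q by (metis le_neq_implies_less leading_coeff_0_iff)
  then show ?thesis using assms(1) \<open>p \<noteq> 0\<close> by linarith
qed

lemma poly_eq_0_if_eventually:
  fixes p :: "complex poly"
  assumes "\<And>n. n \<ge> N \<Longrightarrow> poly p (of_nat n) = 0"
  shows "p = 0"
proof (rule ccontr)
  assume "p \<noteq> 0"
  then have "finite {x. poly p x = 0}" by (rule poly_roots_finite)
  moreover have "of_nat ` {N..} \<subseteq> {x. poly p x = 0}" using assms by auto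
  moreover have "infinite (of_nat ` {N..} :: complex set)"
    using infinite_Ici by (subst finite_image_iff) (auto intro: inj_onI)
  ultimately show False using finite_subset by blast
qed

text \<open>Passing from \<open>s n\<close> to \<open>s (n + 1) - lam a * s n\<close> lowers the degree of the polynomial attached to
  \<open>a\<close> and acts injectively on the others, whose leading coefficients are multiplied by
  \<open>lam i - lam a\<close>.\<close>

lemma exp_poly_zero:
  fixes lam :: "'i \<Rightarrow> complex" and P :: "'i \<Rightarrow> complex poly"
  assumes "finite A" "inj_on lam A" "\<And>i. i \<in> A \<Longrightarrow> lam i \<noteq> 0"
    and "\<And>n. n \<ge> N \<Longrightarrow> (\<Sum>i\<in>A. lam i ^ n * poly (P i) (of_nat n)) = 0"
    and "i \<in> A"
  shows "P i = 0"
  using assms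
proof (induction A arbitrary: P i rule: finite_induct)
  case empty
  then show ?case by simp
next
  case (insert a A)
  have "\<forall>i\<in>insert a A. P i = 0"
    if "P a \<noteq> 0 \<Longrightarrow> degree (P a) < d"
      "\<And>n. n \<ge> N \<Longrightarrow> (\<Sum>i\<in>insert a A. lam i ^ n * poly (P i) (of_nat n)) = 0" for d P
    using that
  proof (induction d arbitrary: P)
    case 0
    then have "P a = 0" by auto
    then have "(\<Sum>i\<in>A. lam i ^ n * poly (P i) (of_nat n)) = 0" if "n \<ge> N" for n
      using 0(2)[OF that] insert.hyps by simp
    then show ?case using insert.IH[of P] insert.prems \<open>P a = 0\<close> by auto
  next
    case (Suc d)
    define Q where "Q i = Polynomial.smult (lam i) (pcompose (P i) [:1, 1:]) - Polynomial.smult (lam a) (P i)" for i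
    have "(\<Sum>i\<in>insert a A. lam i ^ n * poly (Q i) (of_nat n)) = 0" if n: "n \<ge> N" for n
    proof -
      have "(\<Sum>i\<in>insert a A. lam i ^ n * poly (Q i) (of_nat n)) =
          (\<Sum>i\<in>insert a A. lam i ^ Suc n * poly (P i) (of_nat (Suc n)))
          - lam a * (\<Sum>i\<in>insert a A. lam i ^ n * poly (P i) (of_nat n))"
        unfolding sum_distrib_left sum_subtractf[symmetric]
        by (intro sum.cong) (auto simp: Q_def poly_pcompose algebra_simps)
      then show ?thesis using Suc.prems(2)[of n] Suc.prems(2)[of "Suc n"] n by simp
    qed
    moreover have "degree (Q a) < d" if "Q a \<noteq> 0"
    proof -
      have "Q a = Polynomial.smult (lam a) (pcompose (P a) [:1, 1:] - P a)"
        by (simp add: Q_def smult_diff_right)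
      then show ?thesis using that degree_shift_diff[of "P a" d] Suc.prems(1) by auto
    qed
    ultimately have Q: "\<forall>i\<in>insert a A. Q i = 0" using Suc.IH[of Q] by blast
    have A: "P i = 0" if i: "i \<in> A" for i
    proof -
      have "lam i \<noteq> lam a" using insert.hyps insert.prems(1) i by (auto simp: inj_on_def)
      have "Polynomial.smult (lam i) (pcompose (P i) [:1, 1:]) = Polynomial.smult (lam a) (P i)"
        using Q i by (auto simp: Q_def)
      then have "coeff (Polynomial.smult (lam i) (pcompose (P i) [:1, 1:])) (degree (P i)) =
          coeff (Polynomial.smult (lam a) (P i)) (degree (P i))" by simp
      then have "lam i * lead_coeff (P i) = lam a * lead_coeff (P i)"
        using shift_poly[of "P i"] by simp
      then show ?thesis using \<open>lam i \<noteq> lam a\<close> by simp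
    qed
    moreover have "P a = 0"
    proof (rule poly_eq_0_if_eventually)
      fix n assume "n \<ge> N"
      then have "lam a ^ n * poly (P a) (of_nat n) = 0"
        using Suc.prems(2)[of n] A insert.hyps by simp
      then show "poly (P a) (of_nat n) = 0" using insert.prems(2)[of a] by simp
    qed
    ultimately show ?case by blast
  qed
  from this[of P "Suc (degree (P a))"] show ?case using insert.prems by blast
qed

lemma cvs_times: "cvs ((*) :: complex \<Rightarrow> complex \<Rightarrow> complex)"
  by unfold_locales (simp_all add: algebra_simps)

lemma (in cvs) separating_functional:
  assumes W: "subspace W" and x: "x \<notin> W"
  obtains f :: "'e \<Rightarrow> complex" where "Vector_Spaces.linear (*s) (*) f" "\<And>w. w \<in> W \<Longrightarrow> f w = 0" "f x \<noteq> 0"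
proof -
  obtain \<pi> where \<pi>: "Vector_Spaces.linear (*s) (*s) \<pi>" "\<And>x. x \<in> W \<Longrightarrow> \<pi> x = 0" "\<And>x. x - \<pi> x \<in> W"
    using projection_along[OF W] by blast
  interpret cmul: cvs "(*) :: complex \<Rightarrow> complex \<Rightarrow> complex" by (rule cvs_times)
  interpret vector_space_pair "(*s)" "(*) :: complex \<Rightarrow> complex \<Rightarrow> complex" ..
  have "\<pi> x \<noteq> 0" using \<pi>(3)[of x] x by auto
  then have "independent {\<pi> x}" by simp
  then obtain g where g: "Vector_Spaces.linear (*s) (*) g" "g (\<pi> x) = (1::complex)"
    using linear_independent_extend[of "{\<pi> x}" "\<lambda>_. 1"] by auto
  have "Vector_Spaces.linear (*s) (*) (g \<circ> \<pi>)" by (rule Vector_Spaces.linear_compose[OF \<pi>(1) g(1)])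
  then show thesis
    using that[of "g \<circ> \<pi>"] \<pi>(2) g(2) linear_0[OF g(1)] by auto
qed

text \<open>The functions \<open>n \<mapsto> lam i ^ n * n ^ j\<close> are linearly independent on every final segment;
  a functional vanishing on \<open>W\<close> turns this into a statement about vector coefficients.\<close>

lemma (in cvs) exp_poly_coeffs:
  fixes lam :: "'i \<Rightarrow> complex" and G :: "'i \<Rightarrow> nat \<Rightarrow> 'e"
  assumes W: "subspace W" and A: "finite A" "inj_on lam A" "\<And>i. i \<in> A \<Longrightarrow> lam i \<noteq> 0"
    and s: "\<And>n. n \<ge> N \<Longrightarrow> (\<Sum>i\<in>A. lam i ^ n *s (\<Sum>j\<le>d i. of_nat n ^ j *s G i j)) \<in> W"
    and i: "i \<in> A" "j \<le> d i"
  shows "G i j \<in> W"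
proof (rule ccontr)
  assume "G i j \<notin> W"
  then obtain f :: "'e \<Rightarrow> complex" where f: "Vector_Spaces.linear (*s) (*) f"
    "\<And>w. w \<in> W \<Longrightarrow> f w = 0" "f (G i j) \<noteq> 0"
    using separating_functional[OF W] by blast
  interpret f: Vector_Spaces.linear "(*s)" "(*)" f by (rule f(1))
  define P where "P i = (\<Sum>j\<le>d i. monom (f (G i j)) j)" for i
  have "(\<Sum>i\<in>A. lam i ^ n * poly (P i) (of_nat n)) = 0" if "n \<ge> N" for n
    using f(2)[OF s[OF that]]
    by (simp add: P_def f.sum f.scale poly_sum poly_monom mult.commute)
  from exp_poly_zero[OF A this i(1)] have "P i = 0" by simp
  moreover have "coeff (P i) j = f (G i j)"
    using i(2) by (simp add: P_def coeff_sum)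
  ultimately show False using f(3) by simp
qed

section \<open>Tensor products with the polynomial modules\<close>

definition fscale :: "(complex \<Rightarrow> 'e \<Rightarrow> 'e) \<Rightarrow> complex \<Rightarrow> ('z \<Rightarrow> 'e) \<Rightarrow> 'z \<Rightarrow> 'e" where
  "fscale s c f = (\<lambda>z. s c (f z))"

lemma fscale_apply [simp]: "fscale s c f z = s c (f z)"
  by (simp add: fscale_def)

lemma sum_fun_apply [simp]: "(\<Sum>i\<in>A. f i) z = (\<Sum>i\<in>A. f i z)"
  by (induction A rule: infinite_finite_induct) simp_all

text \<open>A vector of \<open>\<Omega>\<^sub>1 \<otimes> \<dots> \<otimes> \<Omega>\<^sub>m \<otimes> C\<close> is regarded as a polynomial function of
  \<open>z = (z 1, \<dots>, z m)\<close> with values in \<open>C\<close>, so that the substitution \<open>\<partial> \<mapsto> \<partial> - k\<close> in a factor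
  becomes a translation of one variable.\<close>

locale hv_tensor = hv_rep scale C op
  for scale :: "complex \<Rightarrow> 'e::ab_group_add \<Rightarrow> 'e" (infixr "*s" 75) and C op +
  fixes S :: "nat set" and lam al be :: "nat \<Rightarrow> complex"
  assumes finite_S: "finite S" and lam_nz: "i \<in> S \<Longrightarrow> lam i \<noteq> 0"
begin

sublocale F: cvs "fscale scale :: complex \<Rightarrow> ((nat \<Rightarrow> complex) \<Rightarrow> 'e) \<Rightarrow> (nat \<Rightarrow> complex) \<Rightarrow> 'e"
  by unfold_locales (simp_all add: fun_eq_iff scale_right_distrib scale_left_distrib)

lemma F_lcomb_apply: "lcomb (fscale scale) g p z = lcomb (*s) (\<lambda>x. g x z) p"
  by (simp add: lcomb_def)

text \<open>The action on the \<open>i\<close>-th polynomial factor; the Leibniz rule for the whole tensor product is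
  \<open>tact\<close> below.\<close>

fun dop :: "nat \<Rightarrow> hv_index \<Rightarrow> ((nat \<Rightarrow> complex) \<Rightarrow> 'e) \<Rightarrow> (nat \<Rightarrow> complex) \<Rightarrow> 'e" where
  "dop i (HL n) f = (\<lambda>z. (lam i powi n * (z i + of_int n * al i)) *s f (z(i := z i - of_int n)))"
| "dop i (HI n) f = (\<lambda>z. (lam i powi n * be i) *s f (z(i := z i - of_int n)))"
| "dop i _ f = 0"

definition tact :: "hv_index \<Rightarrow> ((nat \<Rightarrow> complex) \<Rightarrow> 'e) \<Rightarrow> (nat \<Rightarrow> complex) \<Rightarrow> 'e" where
  "tact a f = (\<lambda>z. (\<Sum>i\<in>S. dop i a f z) + op a (f z))"

definition pf :: "nat set \<Rightarrow> (nat \<Rightarrow> complex poly) \<Rightarrow> 'e \<Rightarrow> (nat \<Rightarrow> complex) \<Rightarrow> 'e" where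
  "pf P q c = (\<lambda>z. (\<Prod>i\<in>P. poly (q i) (z i)) *s c)"

definition TP :: "nat set \<Rightarrow> ((nat \<Rightarrow> complex) \<Rightarrow> 'e) set" where
  "TP P = F.span {pf P q c |q c. c \<in> C}"

lemma dop_add: "dop i a (f + g) = dop i a f + dop i a g"
  and dop_scale: "dop i a (fscale scale c f) = fscale scale c (dop i a f)"
  by (cases a; simp add: fun_eq_iff scale_right_distrib mult.commute)+

lemma dop_zero [simp]: "dop i a 0 = 0"
  using dop_add[of i a 0 0] by simp

lemma dop_sum: "dop i a (\<Sum>j\<in>A. f j) = (\<Sum>j\<in>A. dop i a (f j))"
  by (induction A rule: infinite_finite_induct)
    (simp_all only: sum.infinite sum.empty sum.insert dop_zero dop_add simp_thms)

lemma dop_op: "dop i a (\<lambda>z. op b (f z)) = (\<lambda>z. op b (dop i a f z))"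
  by (cases a) (simp_all add: fun_eq_iff op_scale)

lemma dop_form: "\<exists>w s. \<forall>f. dop i a f = (\<lambda>z. w (z i) *s f (z(i := s (z i))))"
proof (cases a)
  case (HL n)
  show ?thesis unfolding HL
    by (rule exI[of _ "\<lambda>x. lam i powi n * (x + of_int n * al i)"], rule exI[of _ "\<lambda>x. x - of_int n"]) simp
next
  case (HI n)
  show ?thesis unfolding HI
    by (rule exI[of _ "\<lambda>x. lam i powi n * be i"], rule exI[of _ "\<lambda>x. x - of_int n"]) simp
qed (auto simp: fun_eq_iff intro!: exI[of _ "\<lambda>_. 0"])

lemma dop_commute:
  assumes "i \<noteq> j"
  shows "dop i a (dop j b f) = dop j b (dop i a f)"
proof -
  obtain w s w' s' where "\<And>f. dop i a f = (\<lambda>z. w (z i) *s f (z(i := s (z i))))"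
    "\<And>f. dop j b f = (\<lambda>z. w' (z j) *s f (z(j := s' (z j))))"
    using dop_form[of i a] dop_form[of j b] by blast
  then show ?thesis using assms by (simp add: fun_upd_twist[OF assms] mult.commute)
qed

text \<open>Different factors commute, so that the bracket relations of the tensor product reduce to those
  of a single polynomial factor and those of \<open>C\<close>.\<close>

lemma dop_bracket:
  assumes "lam i \<noteq> 0"
  shows "dop i a (dop i b f) - dop i b (dop i a f) = lcomb (fscale scale) (\<lambda>d. dop i d f) (hv_bracket_basis a b)"
proof -
  have pw: "lam i powi (m + n) = lam i powi m * lam i powi n" for m n
    using assms by (rule power_int_add[OF disjI1])
  let ?z = "\<lambda>z k. z(i := z i - of_int k)"
  have d: "z i - of_int m - of_int n = z i - of_int (m + n)" for z :: "nat \<Rightarrow> complex" and m n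
    by simp
  have up: "(?z z m)(i := (?z z m) i - of_int n) = ?z z (m + n)" for z :: "nat \<Rightarrow> complex" and m n
    by (simp add: diff_diff_eq)
  have LL: "dop i (HL m) (dop i (HL n) f) z = ((lam i powi m * (z i + of_int m * al i)) *
      (lam i powi n * (z i - of_int m + of_int n * al i))) *s f (?z z (m + n))" for m n z
    unfolding dop.simps up by simp
  have LI: "dop i (HL m) (dop i (HI n) f) z = ((lam i powi m * (z i + of_int m * al i)) *
      (lam i powi n * be i)) *s f (?z z (m + n))" for m n z
    unfolding dop.simps up by simp
  have IL: "dop i (HI n) (dop i (HL m) f) z = ((lam i powi n * be i) *
      (lam i powi m * (z i - of_int n + of_int m * al i))) *s f (?z z (n + m))" for m n z
    unfolding dop.simps up by simp
  have II: "dop i (HI n) (dop i (HI m) f) z = ((lam i powi n * be i) *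
      (lam i powi m * be i)) *s f (?z z (n + m))" for m n z
    unfolding dop.simps up by simp
  have LLc: "dop i (HL m) (dop i (HL n) f) - dop i (HL n) (dop i (HL m) f) =
      fscale scale (of_int (n - m)) (dop i (HL (m + n)) f)" for m n
  proof
    fix z
    have "(lam i powi m * (z i + of_int m * al i)) * (lam i powi n * (z i - of_int m + of_int n * al i))
        - (lam i powi n * (z i + of_int n * al i)) * (lam i powi m * (z i - of_int n + of_int m * al i))
        = of_int (n - m) * (lam i powi (m + n) * (z i + of_int (m + n) * al i))"
      by (simp add: pw algebra_simps)
    then show "(dop i (HL m) (dop i (HL n) f) - dop i (HL n) (dop i (HL m) f)) z =
        fscale scale (of_int (n - m)) (dop i (HL (m + n)) f) z"
      unfolding minus_apply LL add.commute[of n m] scale_left_diff_distrib[symmetric]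
      by (simp only: dop.simps fscale_apply scale_scale)
  qed
  have LIc: "dop i (HL m) (dop i (HI n) f) - dop i (HI n) (dop i (HL m) f) =
      fscale scale (of_int n) (dop i (HI (m + n)) f)" for m n
  proof
    fix z
    have "(lam i powi m * (z i + of_int m * al i)) * (lam i powi n * be i)
        - (lam i powi n * be i) * (lam i powi m * (z i - of_int n + of_int m * al i))
        = of_int n * (lam i powi (m + n) * be i)"
      by (simp add: pw algebra_simps)
    then show "(dop i (HL m) (dop i (HI n) f) - dop i (HI n) (dop i (HL m) f)) z =
        fscale scale (of_int n) (dop i (HI (m + n)) f) z"
      unfolding minus_apply LI IL add.commute[of n m] scale_left_diff_distrib[symmetric]
      by (simp only: dop.simps fscale_apply scale_scale)
  qed
  have IIc: "dop i (HI m) (dop i (HI n) f) - dop i (HI n) (dop i (HI m) f) = 0" for m n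
    by (rule ext) (unfold minus_apply II, simp add: mult.commute add.commute)
  have c: "dop i HC1 f = 0" "dop i HC2 f = 0" "dop i HC3 f = 0" by simp_all
  show ?thesis
  proof (cases a; cases b)
    fix m n assume ab: "a = HL m" "b = HL n"
    show ?thesis unfolding ab LLc by (simp add: F.lcomb_add F.lcomb_scale c del: dop.simps)
  next
    fix m n assume ab: "a = HL m" "b = HI n"
    show ?thesis unfolding ab LIc by (simp add: F.lcomb_add F.lcomb_scale c del: dop.simps)
  next
    fix m n assume ab: "a = HI n" "b = HL m"
    have "dop i (HI n) (dop i (HL m) f) - dop i (HL m) (dop i (HI n) f) =
        - fscale scale (of_int n) (dop i (HI (m + n)) f)"
      unfolding LIc[symmetric] by simp
    then show ?thesis unfolding ab
      by (simp add: F.lcomb_add F.lcomb_scale F.lcomb_minus F.lcomb_diff c del: dop.simps)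
  next
    fix m n assume ab: "a = HI m" "b = HI n"
    show ?thesis unfolding ab IIc by (simp add: F.lcomb_scale c del: dop.simps)
  qed simp_all
qed

lemma tact_add: "tact a (f + g) = tact a f + tact a g"
  and tact_scale: "tact a (fscale scale c f) = fscale scale c (tact a f)"
  by (simp_all add: tact_def fun_eq_iff dop_add dop_scale op_add op_scale sum.distrib
      scale_right_distrib scale_sum_right add_ac)

lemma pf_scale: "fscale scale c (pf P q v) = pf P q (c *s v)"
  by (simp add: pf_def fun_eq_iff scale_left_commute)

lemma dop_pf:
  assumes "i \<in> S"
  shows "dop i a (pf S q c) = pf S (q(i := omega_basis (lam i) (al i) (be i) a (q i))) c"
proof
  fix z
  define R where "R = (\<Prod>j\<in>S - {i}. poly (q j) (z j))"
  have 1: "pf S (q(i := p)) c z = (poly p (z i) * R) *s c" for p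
    using finite_S assms unfolding pf_def R_def
    by (subst prod.remove[of _ i]) (auto intro!: arg_cong2[where f = scale] prod.cong)
  have 2: "pf S q c (z(i := w)) = (poly (q i) w * R) *s c" for w
    using finite_S assms unfolding pf_def R_def
    by (subst prod.remove[of _ i]) (auto intro!: arg_cong2[where f = scale] prod.cong)
  show "dop i a (pf S q c) z = pf S (q(i := omega_basis (lam i) (al i) (be i) a (q i))) c z"
  proof (cases a)
    case (HL n)
    show ?thesis unfolding HL dop.simps 1 2 omega_basis.simps scale_scale
      by (rule arg_cong2[where f = scale]) (simp_all add: poly_pcompose algebra_simps)
  next
    case (HI n)
    show ?thesis unfolding HI dop.simps 1 2 omega_basis.simps scale_scale
      by (rule arg_cong2[where f = scale]) (simp_all add: poly_pcompose mult_ac)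
  qed (simp_all add: 1)
qed

lemma TP_subspace: "F.subspace (TP P)" by (simp add: TP_def)

lemma pf_TP: "c \<in> C \<Longrightarrow> pf P q c \<in> TP P" unfolding TP_def by (rule F.span_base) auto

lemma TP_induct:
  assumes "f \<in> TP P" and "F.subspace W" and "\<And>q c. c \<in> C \<Longrightarrow> pf P q c \<in> W"
  shows "f \<in> W"
  using F.span_minimal[of "{pf P q c |q c. c \<in> C}" W] assms unfolding TP_def by blast

lemma TP_C: "f \<in> TP P \<Longrightarrow> f z \<in> C"
proof -
  assume "f \<in> TP P"
  then have "f \<in> {f. f z \<in> C}"
    by (rule TP_induct)
      (auto simp: F.subspace_def pf_def subspace_0[OF C_subspace] subspace_add[OF C_subspace]
        subspace_scale[OF C_subspace])
  then show ?thesis by simp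
qed

lemma tact_pf: "tact a (pf S q c) =
    (\<Sum>i\<in>S. pf S (q(i := omega_basis (lam i) (al i) (be i) a (q i))) c) + pf S q (op a c)"
  by (simp add: tact_def fun_eq_iff dop_pf) (simp add: pf_def op_scale)

lemma tact_TP: "f \<in> TP S \<Longrightarrow> tact a f \<in> TP S"
proof -
  assume f: "f \<in> TP S"
  have "f \<in> {f. tact a f \<in> TP S}"
  proof (rule TP_induct[OF f])
    show "F.subspace {f. tact a f \<in> TP S}"
      using TP_subspace[of S] by (auto simp: F.subspace_def tact_add tact_scale) (simp add: tact_def zero_fun_def[symmetric])
    show "pf S q c \<in> {f. tact a f \<in> TP S}" if "c \<in> C" for q c
      using that
      by (auto simp: tact_pf op_closed intro!: F.subspace_add[OF TP_subspace] F.subspace_sum[OF TP_subspace] pf_TP)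
  qed
  then show ?thesis by simp
qed

sublocale T: hv_rep "fscale scale :: complex \<Rightarrow> ((nat \<Rightarrow> complex) \<Rightarrow> 'e) \<Rightarrow> (nat \<Rightarrow> complex) \<Rightarrow> 'e" "TP S" tact
proof unfold_locales
  show "F.subspace (TP S)" by (rule TP_subspace)
  show "v \<in> TP S \<Longrightarrow> tact a v \<in> TP S" for a v by (rule tact_TP)
  show "tact a (u + v) = tact a u + tact a v" for a u v by (rule tact_add)
  show "tact a (fscale scale c v) = fscale scale c (tact a v)" for a c v by (rule tact_scale)
  show "tact a (tact b f) - tact b (tact a f) = lcomb (fscale scale) (\<lambda>d. tact d f) (hv_bracket_basis a b)"
    if f: "f \<in> TP S" for a b f
  proof
    fix z
    have t: "tact b f = (\<Sum>j\<in>S. dop j b f) + (\<lambda>z. op b (f z))" for b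
      by (simp add: tact_def fun_eq_iff)
    have 1: "tact a (tact b f) z = (\<Sum>i\<in>S. \<Sum>j\<in>S. dop i a (dop j b f) z) + (\<Sum>i\<in>S. op b (dop i a f z))
        + (\<Sum>j\<in>S. op a (dop j b f z)) + op a (op b (f z))" for a b
    proof -
      have "tact a g z = (\<Sum>i\<in>S. dop i a g z) + op a (g z)" for g by (simp add: tact_def)
      then show ?thesis
        unfolding t[of b] by (simp add: dop_add dop_sum dop_op op_add op_sum sum.distrib add.assoc)
    qed
    have 2: "(\<Sum>i\<in>S. \<Sum>j\<in>S. dop i a (dop j b f) z) - (\<Sum>i\<in>S. \<Sum>j\<in>S. dop i b (dop j a f) z) =
        (\<Sum>i\<in>S. lcomb (*s) (\<lambda>d. dop i d f z) (hv_bracket_basis a b))"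
    proof -
      have "(\<Sum>i\<in>S. \<Sum>j\<in>S. dop i b (dop j a f) z) = (\<Sum>i\<in>S. \<Sum>j\<in>S. dop j b (dop i a f) z)"
        by (rule sum.swap)
      then have "(\<Sum>i\<in>S. \<Sum>j\<in>S. dop i a (dop j b f) z) - (\<Sum>i\<in>S. \<Sum>j\<in>S. dop i b (dop j a f) z) =
          (\<Sum>i\<in>S. \<Sum>j\<in>S. dop i a (dop j b f) z - dop j b (dop i a f) z)"
        by (simp add: sum_subtractf)
      also have "\<dots> = (\<Sum>i\<in>S. \<Sum>j\<in>S. if j = i then lcomb (*s) (\<lambda>d. dop i d f z) (hv_bracket_basis a b) else 0)"
      proof (intro sum.cong refl)
        fix i j assume "i \<in> S" "j \<in> S"
        show "dop i a (dop j b f) z - dop j b (dop i a f) z =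
            (if j = i then lcomb (*s) (\<lambda>d. dop i d f z) (hv_bracket_basis a b) else 0)"
          using fun_cong[OF dop_bracket[OF lam_nz[OF \<open>i \<in> S\<close>], of a b f], of z] dop_commute[of i j a b f]
          by (simp add: F_lcomb_apply)
      qed
      finally show ?thesis using finite_S by simp
    qed
    have 3: "op a (op b (f z)) - op b (op a (f z)) = lcomb (*s) (\<lambda>d. op d (f z)) (hv_bracket_basis a b)"
      using TP_C[OF f] by (rule op_bracket)
    have 4: "lcomb (fscale scale) (\<lambda>d. tact d f) (hv_bracket_basis a b) z =
        (\<Sum>i\<in>S. lcomb (*s) (\<lambda>d. dop i d f z) (hv_bracket_basis a b)) + lcomb (*s) (\<lambda>d. op d (f z)) (hv_bracket_basis a b)"
      unfolding F_lcomb_apply by (simp add: tact_def lcomb_def scale_right_distrib sum.distrib scale_sum_right) (rule sum.swap)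
    show "(tact a (tact b f) - tact b (tact a f)) z = lcomb (fscale scale) (\<lambda>d. tact d f) (hv_bracket_basis a b) z"
      unfolding 4 2[symmetric] 3[symmetric] using 1[of a b] 1[of b a] by simp
  qed
qed

end

context hv_tensor
begin

subsection \<open>Irreducibility for distinct parameters\<close>

lemma TP_split:
  assumes "i \<notin> P" "finite P" "f \<in> TP (insert i P)"
  obtains r h where "\<And>j. h j \<in> TP P" "f = (\<lambda>z. \<Sum>j\<le>r. z i ^ j *s h j z)"
proof -
  let ?Q = "\<lambda>f r h. (\<forall>j. h j \<in> TP P) \<and> (\<forall>j>r. h j = 0) \<and> f = (\<lambda>z. \<Sum>j\<le>r. z i ^ j *s h j z)"
  have 0: "0 \<in> TP P" by (rule F.subspace_0[OF TP_subspace])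
  have "f \<in> {f. \<exists>r h. ?Q f r h}"
  proof (rule TP_induct[OF assms(3)])
    show "F.subspace {f. \<exists>r h. ?Q f r h}"
      unfolding F.subspace_def
    proof (intro conjI ballI allI)
      show "0 \<in> {f. \<exists>r h. ?Q f r h}"
        using 0 by (intro CollectI exI[of _ 0] exI[of _ "\<lambda>_. 0"]) (simp add: fun_eq_iff)
    next
      fix f g assume "f \<in> {f. \<exists>r h. ?Q f r h}" "g \<in> {f. \<exists>r h. ?Q f r h}"
      then obtain r h r' h' where f: "?Q f r h" and g: "?Q g r' h'" by blast
      have hz: "r < j \<Longrightarrow> h j z = 0" "r' < j \<Longrightarrow> h' j z = 0" for j z using f g by auto
      have pad: "(\<Sum>j\<le>r. z i ^ j *s h j z) = (\<Sum>j\<le>max r r'. z i ^ j *s h j z)"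
        "(\<Sum>j\<le>r'. z i ^ j *s h' j z) = (\<Sum>j\<le>max r r'. z i ^ j *s h' j z)" for z
        by (intro sum.mono_neutral_left; simp add: hz not_le)+
      have "?Q (f + g) (max r r') (\<lambda>j. h j + h' j)"
        using f g F.subspace_add[OF TP_subspace]
        by (auto simp: fun_eq_iff pad scale_right_distrib sum.distrib)
      then show "f + g \<in> {f. \<exists>r h. ?Q f r h}" by (intro CollectI exI)
    next
      fix c f assume "f \<in> {f. \<exists>r h. ?Q f r h}"
      then obtain r h where f: "?Q f r h" by blast
      have "?Q (fscale scale c f) r (\<lambda>j. fscale scale c (h j))"
        using f F.subspace_scale[OF TP_subspace]
        by (auto simp: fun_eq_iff scale_sum_right mult.commute)
      then show "fscale scale c f \<in> {f. \<exists>r h. ?Q f r h}" by (intro CollectI exI)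
    qed
  next
    fix q c assume c: "c \<in> C"
    let ?h = "\<lambda>j. fscale scale (coeff (q i) j) (pf P q c)"
    have "?h j = 0" if "j > degree (q i)" for j
      using that by (simp add: fun_eq_iff coeff_eq_0)
    moreover have "pf (insert i P) q c = (\<lambda>z. \<Sum>j\<le>degree (q i). z i ^ j *s ?h j z)"
      using assms by (simp add: fun_eq_iff pf_def poly_altdef sum_distrib_right scale_sum_left mult_ac)
    moreover have "?h j \<in> TP P" for j
      by (rule F.subspace_scale[OF TP_subspace pf_TP[OF c]])
    ultimately have "?Q (pf (insert i P) q c) (degree (q i)) ?h" by blast
    then show "pf (insert i P) q c \<in> {f. \<exists>r h. ?Q f r h}" by (intro CollectI exI)
  qed
  then show thesis using that by blast
qed

lemma TP_mono: "P \<subseteq> Q \<Longrightarrow> finite Q \<Longrightarrow> f \<in> TP P \<Longrightarrow> f \<in> TP Q"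
proof (rule TP_induct[OF _ TP_subspace])
  fix q :: "nat \<Rightarrow> complex poly" and c assume PQ: "P \<subseteq> Q" "finite Q" and c: "c \<in> C"
  have "(\<Prod>i\<in>Q. poly (if i \<in> P then q i else 1) (z i)) = (\<Prod>i\<in>P. poly (q i) (z i))" for z
    using PQ by (subst prod.mono_neutral_right[of Q P]) auto
  then have "pf P q c = pf Q (\<lambda>i. if i \<in> P then q i else 1) c" by (simp add: pf_def)
  then show "pf P q c \<in> TP Q" using pf_TP[OF c] by simp
qed

lemma TP_indep: "f \<in> TP P \<Longrightarrow> i \<notin> P \<Longrightarrow> f (z(i := t)) = f z"
proof -
  assume f: "f \<in> TP P" and i: "i \<notin> P"
  have "f \<in> {f. f (z(i := t)) = f z}"
  proof (rule TP_induct[OF f])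
    show "F.subspace {f. f (z(i := t)) = f z}" by (simp add: F.subspace_def)
    fix q c
    have "(\<Prod>j\<in>P. poly (q j) ((z(i := t)) j)) = (\<Prod>j\<in>P. poly (q j) (z j))"
      using i by (intro prod.cong) auto
    then show "pf P q c \<in> {f. f (z(i := t)) = f z}" by (simp add: pf_def)
  qed
  then show ?thesis by simp
qed

definition restricted_rep :: bool where
  "restricted_rep \<longleftrightarrow> (\<forall>v\<in>C. \<exists>N. \<forall>n\<ge>N. op (HL n) v = 0 \<and> op (HI n) v = 0)"

lemma TP_restricted:
  assumes restricted_rep and f: "f \<in> TP P"
  obtains N where "\<And>n z. n \<ge> N \<Longrightarrow> op (HL n) (f z) = 0" "\<And>n z. n \<ge> N \<Longrightarrow> op (HI n) (f z) = 0"
proof -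
  let ?R = "{f :: (nat \<Rightarrow> complex) \<Rightarrow> 'e. \<exists>N. \<forall>n\<ge>N. \<forall>z. op (HL n) (f z) = 0 \<and> op (HI n) (f z) = 0}"
  have "f \<in> ?R"
  proof (rule TP_induct[OF f])
    show "F.subspace ?R"
      unfolding F.subspace_def
    proof (intro conjI ballI allI)
      fix f g assume "f \<in> ?R" "g \<in> ?R"
      then obtain N N' where "\<forall>n\<ge>N. \<forall>z. op (HL n) (f z) = 0 \<and> op (HI n) (f z) = 0"
        "\<forall>n\<ge>N'. \<forall>z. op (HL n) (g z) = 0 \<and> op (HI n) (g z) = 0" by blast
      then show "f + g \<in> ?R" by (auto simp: op_add intro!: exI[of _ "max N N'"])
    qed (auto simp: op_scale)
    fix q c assume "c \<in> C"
    then obtain N where "\<forall>n\<ge>N. op (HL n) c = 0 \<and> op (HI n) c = 0"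
      using assms(1) by (auto simp: restricted_rep_def)
    then show "pf P q c \<in> ?R" by (auto simp: pf_def op_scale)
  qed
  then show thesis using that by blast
qed

text \<open>Expansion of \<open>(u + n v) f(z i - n)\<close> in powers of \<open>n\<close>, for \<open>f\<close> of degree at most \<open>r\<close> in
  \<open>z i\<close> with coefficients \<open>h\<close>.\<close>

definition expand :: "nat \<Rightarrow> nat \<Rightarrow> (nat \<Rightarrow> (nat \<Rightarrow> complex) \<Rightarrow> 'e) \<Rightarrow>
    ((nat \<Rightarrow> complex) \<Rightarrow> complex) \<Rightarrow> complex \<Rightarrow> nat \<Rightarrow> (nat \<Rightarrow> complex) \<Rightarrow> 'e" where
  "expand i r h u v t = (\<lambda>z. \<Sum>j\<le>r. coeff ([:u z, v:] * [:z i, -1:] ^ j) t *s h j z)"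

lemma expand_sum:
  assumes "\<And>j z t. h j (z(i := t)) = h j z" and f: "f = (\<lambda>z. \<Sum>j\<le>r. z i ^ j *s h j z)"
  shows "(u z + of_nat n * v) *s f (z(i := z i - of_nat n)) =
    (\<Sum>t\<le>Suc r. of_nat n ^ t *s expand i r h u v t z)"
proof -
  have 1: "(\<Sum>t\<le>Suc r. of_nat n ^ t * coeff ([:u z, v:] * [:z i, -1:] ^ j) t) =
      (u z + of_nat n * v) * (z i - of_nat n) ^ j" if "j \<le> r" for j
  proof -
    define p where "p = [:u z, v:] * [:z i, -1:] ^ j"
    have "degree p \<le> Suc r" unfolding p_def
      using degree_mult_le[of "[:u z, v:]" "[:z i, -1:] ^ j"] degree_power_le[of "[:z i, -1:]" j] that
      by (auto split: if_splits)
    then have "poly p (of_nat n) = (\<Sum>t\<le>Suc r. coeff p t * of_nat n ^ t)"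
      unfolding poly_altdef by (intro sum.mono_neutral_left) (auto simp: coeff_eq_0)
    moreover have "poly p (of_nat n) = (u z + of_nat n * v) * (z i - of_nat n) ^ j"
      by (simp add: p_def poly_power algebra_simps)
    ultimately show ?thesis by (simp only: p_def mult.commute)
  qed
  have "(u z + of_nat n * v) *s f (z(i := z i - of_nat n)) =
      (\<Sum>j\<le>r. ((u z + of_nat n * v) * (z i - of_nat n) ^ j) *s h j z)"
    by (simp add: f assms(1) scale_sum_right)
  also have "\<dots> = (\<Sum>j\<le>r. \<Sum>t\<le>Suc r. (of_nat n ^ t * coeff ([:u z, v:] * [:z i, -1:] ^ j) t) *s h j z)"
    by (intro sum.cong refl) (simp only: 1[symmetric] scale_sum_left atMost_iff)
  also have "\<dots> = (\<Sum>t\<le>Suc r. of_nat n ^ t *s expand i r h u v t z)"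
    unfolding expand_def scale_sum_right scale_scale by (rule sum.swap)
  finally show ?thesis .
qed

lemma expand_0: "f = (\<lambda>z. \<Sum>j\<le>r. z i ^ j *s h j z) \<Longrightarrow> expand i r h u v 0 = (\<lambda>z. u z *s f z)"
  by (simp add: fun_eq_iff expand_def coeff_0_power coeff_mult_0 scale_sum_right)

lemma coeff_linear_mult: "coeff ([:u, v:] * p) (Suc r) = u * coeff p (Suc r) + v * coeff p r" for p :: "complex poly"
  by simp

lemma expand_top: "expand i r h u v (Suc r) = fscale scale ((-1) ^ r * v) (h r)"
proof
  fix z
  have "coeff ([:u z, v:] * [:z i, -1:] ^ j) (Suc r) = (if j = r then (-1) ^ r * v else 0)" if "j \<le> r" for j
  proof -
    have d: "degree ([:z i, -1:] ^ j) = j" by (rule degree_linear_power_neg)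
    then have "coeff ([:z i, -1:] ^ j) (Suc r) = 0" using that by (intro coeff_eq_0) simp
    moreover have "coeff ([:z i, -1:] ^ j) r = 0" if "j \<noteq> r" using d that \<open>j \<le> r\<close> by (intro coeff_eq_0) simp
    ultimately show ?thesis by (auto simp: coeff_linear_mult)
  qed
  then have "expand i r h u v (Suc r) z = (\<Sum>j\<le>r. (if j = r then (-1) ^ r * v else 0) *s h j z)"
    unfolding expand_def by (intro sum.cong) auto
  also have "\<dots> = (\<Sum>j\<le>r. if j = r then ((-1) ^ r * v) *s h r z else 0)" by (rule sum.cong) auto
  finally show "expand i r h u v (Suc r) z = fscale scale ((-1) ^ r * v) (h r) z" by simp
qed

lemma expand_const: "expand i r h (\<lambda>_. u) 0 r = fscale scale ((-1) ^ r * u) (h r)"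
proof
  fix z
  have "coeff ([:u, 0:] * [:z i, -1:] ^ j) r = (if j = r then (-1) ^ r * u else 0)" if "j \<le> r" for j
  proof -
    have d: "degree ([:z i, -1:] ^ j) = j" by (rule degree_linear_power_neg)
    have "coeff ([:z i, -1:] ^ j) r = 0" if "j \<noteq> r" using d that \<open>j \<le> r\<close> by (intro coeff_eq_0) simp
    then show ?thesis by auto
  qed
  then have "expand i r h (\<lambda>_. u) 0 r z = (\<Sum>j\<le>r. (if j = r then (-1) ^ r * u else 0) *s h j z)"
    unfolding expand_def by (intro sum.cong) auto
  also have "\<dots> = (\<Sum>j\<le>r. if j = r then ((-1) ^ r * u) *s h r z else 0)" by (rule sum.cong) auto
  finally show "expand i r h (\<lambda>_. u) 0 r z = fscale scale ((-1) ^ r * u) (h r) z" by simp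
qed

text \<open>For large \<open>n\<close> the operators \<open>L n\<close>, \<open>I n\<close> act through the polynomial factors alone, as
  exponential polynomials in \<open>n\<close> whose coefficients therefore preserve every submodule: the
  constant ones multiply by a variable, the top ones extract a leading coefficient.\<close>

lemma coefficients_in_submodule:
  assumes res: restricted_rep and inj: "inj_on lam S" and W: "T.invariant W" and f: "f \<in> W"
    and i: "i \<in> S" and h: "\<And>j. h j \<in> TP (S - {i})" "f = (\<lambda>z. \<Sum>j\<le>r. z i ^ j *s h j z)"
  shows "(\<lambda>z. z i *s f z) \<in> W" "al i \<noteq> 0 \<or> be i \<noteq> 0 \<Longrightarrow> h r \<in> W"
proof -
  have W_sub: "F.subspace W" and W_T: "W \<subseteq> TP S" and W_op: "\<And>a w. w \<in> W \<Longrightarrow> tact a w \<in> W"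
    using W by (auto simp: T.invariant_def)
  have "\<exists>rh. (\<forall>j. snd rh j \<in> TP (S - {l})) \<and> f = (\<lambda>z. \<Sum>j\<le>fst rh. z l ^ j *s snd rh j z)" if "l \<in> S" for l
  proof -
    have "f \<in> TP (insert l (S - {l}))" using f W_T that by (auto simp: insert_absorb)
    then obtain r h where "\<And>j. h j \<in> TP (S - {l})" "f = (\<lambda>z. \<Sum>j\<le>r. z l ^ j *s h j z)"
      using TP_split[of l "S - {l}" f] finite_S by blast
    then show ?thesis by (intro exI[of _ "(r, h)"]) simp
  qed
  then have "\<forall>l\<in>S. \<exists>rh. (\<forall>j. snd rh j \<in> TP (S - {l})) \<and> f = (\<lambda>z. \<Sum>j\<le>fst rh. z l ^ j *s snd rh j z)"
    by blast
  from bchoice[OF this] obtain rh0 where rh0: "\<And>l. l \<in> S \<Longrightarrow> (\<forall>j. snd (rh0 l) j \<in> TP (S - {l})) \<and>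
      f = (\<lambda>z. \<Sum>j\<le>fst (rh0 l). z l ^ j *s snd (rh0 l) j z)" by blast
  define rr where "rr = (\<lambda>l. fst ((rh0(i := (r, h))) l))"
  define hh where "hh = (\<lambda>l. snd ((rh0(i := (r, h))) l))"
  have ri: "rr i = r" "hh i = h" by (simp_all add: rr_def hh_def)
  have hh: "hh l j \<in> TP (S - {l})" and fl: "f = (\<lambda>z. \<Sum>j\<le>rr l. z l ^ j *s hh l j z)" if "l \<in> S" for l j
    using rh0[OF that] h by (auto simp: rr_def hh_def)
  have ind: "hh l j (z(l := t)) = hh l j z" if "l \<in> S" for l j z t
    using TP_indep[OF hh[OF that], of l] by simp
  obtain N0 where N0: "\<And>n z. n \<ge> N0 \<Longrightarrow> op (HL n) (f z) = 0" "\<And>n z. n \<ge> N0 \<Longrightarrow> op (HI n) (f z) = 0"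
    using TP_restricted[OF res, of f S] f W_T by blast
  define N where "N = nat N0"
  have N: "int n \<ge> N0" if "n \<ge> N" for n using that by (simp add: N_def)
  have L: "(\<Sum>l\<in>S. fscale scale (lam l ^ n) (\<Sum>t\<le>Suc (rr l). fscale scale (of_nat n ^ t)
      (expand l (rr l) (hh l) (\<lambda>z. z l) (al l) t))) = tact (HL (int n)) f" if "n \<ge> N" for n
  proof
    fix z
    show "(\<Sum>l\<in>S. fscale scale (lam l ^ n) (\<Sum>t\<le>Suc (rr l). fscale scale (of_nat n ^ t)
      (expand l (rr l) (hh l) (\<lambda>z. z l) (al l) t))) z = tact (HL (int n)) f z"
      unfolding sum_fun_apply fscale_apply tact_def N0(1)[OF N[OF that]] add_0_right
    proof (intro sum.cong refl)
      fix l assume l: "l \<in> S"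
      show "lam l ^ n *s (\<Sum>t\<le>Suc (rr l). of_nat n ^ t *s expand l (rr l) (hh l) (\<lambda>z. z l) (al l) t z) =
          dop l (HL (int n)) f z"
        unfolding expand_sum[OF ind[OF l] fl[OF l], where u = "\<lambda>z. z l", symmetric]
        by simp
    qed
  qed
  have I: "(\<Sum>l\<in>S. fscale scale (lam l ^ n) (\<Sum>t\<le>Suc (rr l). fscale scale (of_nat n ^ t)
      (expand l (rr l) (hh l) (\<lambda>z. be l) 0 t))) = tact (HI (int n)) f" if "n \<ge> N" for n
  proof
    fix z
    show "(\<Sum>l\<in>S. fscale scale (lam l ^ n) (\<Sum>t\<le>Suc (rr l). fscale scale (of_nat n ^ t)
      (expand l (rr l) (hh l) (\<lambda>z. be l) 0 t))) z = tact (HI (int n)) f z"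
      unfolding sum_fun_apply fscale_apply tact_def N0(2)[OF N[OF that]] add_0_right
    proof (intro sum.cong refl)
      fix l assume l: "l \<in> S"
      show "lam l ^ n *s (\<Sum>t\<le>Suc (rr l). of_nat n ^ t *s expand l (rr l) (hh l) (\<lambda>z. be l) 0 t z) =
          dop l (HI (int n)) f z"
        unfolding expand_sum[OF ind[OF l] fl[OF l], where u = "\<lambda>z. be l", symmetric]
        by simp
    qed
  qed
  have Lc: "expand i (rr i) (hh i) (\<lambda>z. z i) (al i) t \<in> W" if "t \<le> Suc (rr i)" for t
    by (rule F.exp_poly_coeffs[where N = N and lam = lam and
          G = "\<lambda>l t. expand l (rr l) (hh l) (\<lambda>z. z l) (al l) t" and d = "\<lambda>l. Suc (rr l)",
          OF W_sub finite_S inj lam_nz _ i that])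
      (simp_all only: L W_op[OF f])
  have Ic: "expand i (rr i) (hh i) (\<lambda>z. be i) 0 t \<in> W" if "t \<le> Suc (rr i)" for t
    by (rule F.exp_poly_coeffs[where N = N and lam = lam and
          G = "\<lambda>l t. expand l (rr l) (hh l) (\<lambda>z. be l) 0 t" and d = "\<lambda>l. Suc (rr l)",
          OF W_sub finite_S inj lam_nz _ i that])
      (simp_all only: I W_op[OF f])
  show "(\<lambda>z. z i *s f z) \<in> W"
    using Lc[of 0] expand_0[OF fl[OF i], of "\<lambda>z. z i" "al i"] by simp
  assume ab: "al i \<noteq> 0 \<or> be i \<noteq> 0"
  have cancel: "w \<in> W" if "fscale scale c w \<in> W" "c \<noteq> 0" for c w
    using F.subspace_scale[OF W_sub that(1), of "inverse c"] that(2) by (simp add: F.scale_scale)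
  show "h r \<in> W"
  proof (cases "al i = 0")
    case True
    then have "(-1) ^ r * be i \<noteq> 0" using ab by simp
    moreover have "expand i (rr i) (hh i) (\<lambda>z. be i) 0 r = fscale scale ((-1) ^ r * be i) (h r)"
      unfolding ri by (rule expand_const)
    ultimately show ?thesis using Ic[of r] ri(1) by (metis cancel le_SucI order_refl)
  next
    case False
    then have "(-1) ^ r * al i \<noteq> 0" by simp
    moreover have "expand i (rr i) (hh i) (\<lambda>z. z i) (al i) (Suc r) = fscale scale ((-1) ^ r * al i) (h r)"
      unfolding ri by (rule expand_top)
    ultimately show ?thesis using Lc[of "Suc r"] ri(1) by (metis cancel order_refl)
  qed
qed

text \<open>Leading coefficients remove the variables from a nonzero vector of a submodule \<open>W\<close>, which leaves
  a constant \<open>c \<noteq> 0\<close>; multiplication by the variables then puts all products of polynomials with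
  \<open>c\<close> into \<open>W\<close>. The constants with this property form a submodule of \<open>C\<close>.\<close>

theorem tensor_simple:
  assumes sim: simple and res: restricted_rep and inj: "inj_on lam S"
    and ab: "\<And>i. i \<in> S \<Longrightarrow> al i \<noteq> 0 \<or> be i \<noteq> 0"
  shows "T.simple"
  unfolding T.simple_def
proof (intro conjI allI impI)
  have C_nz: "C \<noteq> {0}" using sim by (simp add: simple_def)
  then obtain c where c: "c \<in> C" "c \<noteq> 0" using subspace_0[OF C_subspace] by blast
  have "pf S (\<lambda>_. 1) c \<in> TP S" by (rule pf_TP[OF c(1)])
  moreover have "pf S (\<lambda>_. 1) c \<noteq> 0" using c(2) by (auto simp: pf_def fun_eq_iff)
  ultimately show "TP S \<noteq> {0}" by blast
  fix W assume W: "T.invariant W"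
  then have W_sub: "F.subspace W" and W_T: "W \<subseteq> TP S" and W_op: "\<And>a w. w \<in> W \<Longrightarrow> tact a w \<in> W"
    by (auto simp: T.invariant_def)
  show "W = {0} \<or> W = TP S"
  proof (cases "W = {0}")
    case False
    then obtain f where f: "f \<in> W" "f \<noteq> 0" using F.subspace_0[OF W_sub] by auto
    have mult_var: "(\<lambda>z. z i *s f z) \<in> W" if f: "f \<in> W" and i: "i \<in> S" for f i
    proof -
      have "f \<in> TP (insert i (S - {i}))" using f W_T i by (auto simp: insert_absorb)
      then obtain r h where h: "\<And>j. h j \<in> TP (S - {i})" "f = (\<lambda>z. \<Sum>j\<le>r. z i ^ j *s h j z)"
        using TP_split[of i "S - {i}" f] finite_S by blast
      show ?thesis by (rule coefficients_in_submodule(1)[OF res inj W f i h])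
    qed
    have elim: "\<exists>c\<in>C. c \<noteq> 0 \<and> (\<lambda>z. c) \<in> W" if "finite P" "P \<subseteq> S" "f \<in> W" "f \<in> TP P" "f \<noteq> 0" for P f
      using that
    proof (induction P arbitrary: f rule: finite_induct)
      case empty
      have "f \<in> {f. \<exists>c\<in>C. f = (\<lambda>z. c)}"
      proof (rule TP_induct[OF empty(3)])
        show "F.subspace {f. \<exists>c\<in>C. f = (\<lambda>z. c)}"
          using C_subspace unfolding F.subspace_def subspace_def
          by (auto simp: fun_eq_iff)
      qed (auto simp: pf_def)
      then obtain c where "c \<in> C" "f = (\<lambda>z. c)" by blast
      moreover from this have "c \<noteq> 0" using empty(4) by (auto simp: zero_fun_def)
      ultimately show ?case using empty(2) by blast
    next
      case (insert i P)
      obtain r h where h: "\<And>j. h j \<in> TP P" "f = (\<lambda>z. \<Sum>j\<le>r. z i ^ j *s h j z)"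
        using TP_split[OF insert(2,1) insert(6)] by blast
      have "\<exists>j\<le>r. h j \<noteq> 0"
      proof (rule ccontr)
        assume "\<not> (\<exists>j\<le>r. h j \<noteq> 0)"
        then have "f = 0" unfolding h(2) by (auto simp: fun_eq_iff)
        then show False using insert by simp
      qed
      define r' where "r' = Max {j. j \<le> r \<and> h j \<noteq> 0}"
      have fin: "finite {j. j \<le> r \<and> h j \<noteq> 0}" by simp
      have ne: "{j. j \<le> r \<and> h j \<noteq> 0} \<noteq> {}" using \<open>\<exists>j\<le>r. h j \<noteq> 0\<close> by blast
      have r': "r' \<le> r" "h r' \<noteq> 0" using Max_in[OF fin ne] by (auto simp: r'_def)
      have "h j = 0" if "j \<le> r" "j > r'" for j
      proof (rule ccontr)
        assume "h j \<noteq> 0"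
        then have "j \<le> r'" unfolding r'_def using that(1) by (intro Max_ge[OF fin]) simp
        then show False using that(2) by simp
      qed
      then have "f = (\<lambda>z. \<Sum>j\<le>r'. z i ^ j *s h j z)"
        unfolding h(2) using r'(1) by (intro ext sum.mono_neutral_right) (auto simp: not_le)
      moreover have "h j \<in> TP (S - {i})" for j
        using h(1)[of j] insert finite_S by (intro TP_mono[of P "S - {i}"]) auto
      ultimately have "h r' \<in> W"
        using insert.prems ab by (intro coefficients_in_submodule(2)[OF res inj W, of f i h r']) auto
      then show ?case using insert.IH[of "h r'"] insert.prems h(1) r'(2) by blast
    qed
    obtain c where c: "c \<in> C" "c \<noteq> 0" "(\<lambda>z. c) \<in> W"
      using elim[OF finite_S order_refl f(1) _ f(2)] f(1) W_T by blast
    have mult_poly: "(\<lambda>z. poly p (z i) *s f z) \<in> W" if f: "f \<in> W" and i: "i \<in> S" for p f i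
    proof (induction p)
      case 0
      show ?case using F.subspace_0[OF W_sub] by (simp add: zero_fun_def)
    next
      case (pCons a p)
      have "(\<lambda>z. poly (pCons a p) (z i) *s f z) =
          fscale scale a f + (\<lambda>z. z i *s (poly p (z i) *s f z))"
        by (simp add: fun_eq_iff scale_left_distrib)
      then show ?case
        using F.subspace_add[OF W_sub F.subspace_scale[OF W_sub f] mult_var[OF pCons.IH i]] by simp
    qed
    have pf_W: "pf P q c \<in> W" if "finite P" "P \<subseteq> S" for P q
      using that
    proof (induction P rule: finite_induct)
      case empty
      then show ?case using c(3) by (simp add: pf_def)
    next
      case (insert i P)
      then have "(\<lambda>z. poly (q i) (z i) *s pf P q c z) \<in> W" by (intro mult_poly) auto
      moreover have "(\<lambda>z. poly (q i) (z i) *s pf P q c z) = pf (insert i P) q c"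
        using insert by (simp add: pf_def fun_eq_iff)
      ultimately show ?case by simp
    qed
    define C0 where "C0 = {c \<in> C. \<forall>q. pf S q c \<in> W}"
    have "invariant C0"
      unfolding invariant_def
    proof (intro conjI ballI allI)
      show "subspace C0"
      proof (rule subspaceI)
        have "pf S q 0 = 0" for q by (simp add: pf_def fun_eq_iff)
        then show "0 \<in> C0"
          using subspace_0[OF C_subspace] F.subspace_0[OF W_sub] by (simp add: C0_def)
        have "pf S q (x + y) = pf S q x + pf S q y" for q x y
          by (simp add: pf_def fun_eq_iff scale_right_distrib)
        then show "x + y \<in> C0" if "x \<in> C0" "y \<in> C0" for x y
          using that subspace_add[OF C_subspace] F.subspace_add[OF W_sub] by (simp add: C0_def)
        show "a *s x \<in> C0" if "x \<in> C0" for a x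
          using that subspace_scale[OF C_subspace] F.subspace_scale[OF W_sub]
          by (simp add: C0_def pf_scale[symmetric])
      qed
      show "C0 \<subseteq> C" by (auto simp: C0_def)
      fix a x assume x: "x \<in> C0"
      have "pf S q (op a x) \<in> W" for q
      proof -
        have "pf S q (op a x) = tact a (pf S q x) -
            (\<Sum>i\<in>S. pf S (q(i := omega_basis (lam i) (al i) (be i) a (q i))) x)"
          by (simp add: tact_pf)
        also have "\<dots> \<in> W"
          using x by (intro F.subspace_diff[OF W_sub] F.subspace_sum[OF W_sub] W_op) (auto simp: C0_def)
        finally show ?thesis .
      qed
      then show "op a x \<in> C0" using x by (simp add: C0_def op_closed)
    qed
    moreover have "C0 \<noteq> {0}"
    proof -
      have "c \<in> C0" using c(1) pf_W[OF finite_S order_refl] by (simp add: C0_def)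
      then show ?thesis using c(2) by blast
    qed
    ultimately have "C0 = C" using sim by (auto simp: simple_def)
    then have "pf S q v \<in> W" if "v \<in> C" for q v using that by (auto simp: C0_def)
    then have "TP S \<subseteq> W" using TP_induct[OF _ W_sub] by blast
    then show ?thesis using W_T by blast
  qed simp
qed

subsection \<open>Reducibility for coinciding parameters\<close>

text \<open>If \<open>lam i = lam j\<close>, the functions depending on \<open>z i\<close> and \<open>z j\<close> only through \<open>z i + z j\<close>
  form a submodule. Invariance is checked in terms of translations of \<open>z i\<close> and \<open>z j\<close>.\<close>

theorem tensor_not_simple:
  assumes C_nz: "C \<noteq> {0}" and ij: "i \<in> S" "j \<in> S" "i \<noteq> j" "lam i = lam j"
  shows "\<not> T.simple"
proof
  assume sim: "T.simple"
  define W where "W = {f \<in> TP S. \<forall>(t::int) z. f (z(i := z i - of_int t)) = f (z(j := z j - of_int t))}"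
  obtain c where c: "c \<in> C" "c \<noteq> 0" using subspace_0[OF C_subspace] C_nz by blast
  have W1: "f (z(j := z j - of_int t)) = f (z(i := z i - of_int t))" if "f \<in> W" for f t z
    using that by (simp add: W_def)
  have swap: "f (z(i := z i - of_int s, j := z j - of_int t)) = f (z(i := z i - of_int (s + t)))"
    if f: "f \<in> W" for f s t z
  proof -
    let ?z = "z(i := z i - of_int s)"
    have "f (?z(j := ?z j - of_int t)) = f (?z(i := ?z i - of_int t))"
      by (rule W1[OF f])
    moreover have "?z(j := ?z j - of_int t) = z(i := z i - of_int s, j := z j - of_int t)"
      using ij(3) by simp
    moreover have "?z(i := ?z i - of_int t) = z(i := z i - of_int (s + t))"
      by (simp add: diff_diff_eq)
    ultimately show ?thesis by simp
  qed
  have "T.invariant W"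
    unfolding T.invariant_def
  proof (intro conjI ballI allI)
    show "F.subspace W"
      by (rule F.subspaceI) (auto simp: W_def F.subspace_0[OF TP_subspace] F.subspace_add[OF TP_subspace]
          F.subspace_scale[OF TP_subspace])
    show "W \<subseteq> TP S" by (auto simp: W_def)
    fix a f assume f: "f \<in> W"
    have "tact a f (z(i := z i - of_int t)) = tact a f (z(j := z j - of_int t))" for t z
    proof -
      let ?x = "z(i := z i - of_int t)" and ?y = "z(j := z j - of_int t)"
      have split: "(\<Sum>l\<in>S. g l) = g i + g j + (\<Sum>l\<in>S - {i, j}. g l)" for g :: "nat \<Rightarrow> 'e"
      proof -
        have "S = insert i (insert j (S - {i, j}))" using ij by auto
        then have "sum g S = sum g (insert i (insert j (S - {i, j})))" by simp
        then show ?thesis using ij finite_S by (simp add: add.assoc)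
      qed
      have rest: "dop l a f ?x = dop l a f ?y" if l: "l \<in> S - {i, j}" for l
      proof -
        have lij: "l \<noteq> i" "l \<noteq> j" using l by auto
        have "f (?x(l := w)) = f (?y(l := w))" for w
        proof -
          let ?u = "z(l := w)"
          have "f (?u(i := ?u i - of_int t)) = f (?u(j := ?u j - of_int t))" using W1[OF f, of ?u t] by simp
          then show ?thesis using lij by (simp add: fun_upd_twist)
        qed
        then show ?thesis using lij by (cases a) auto
      qed
      have fxy: "f ?x = f ?y" using W1[OF f, of z t] by simp
      have main: "dop i a f ?x + dop j a f ?x = dop i a f ?y + dop j a f ?y"
      proof -
        have a1: "f (?x(i := ?x i - of_int n)) = f (z(i := z i - of_int (t + n)))" for n
          by (simp add: diff_diff_eq)
        have a2: "f (?x(j := ?x j - of_int n)) = f (z(i := z i - of_int (t + n)))" for n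
          using swap[OF f, of z t n] ij(3) by simp
        have a3: "f (?y(i := ?y i - of_int n)) = f (z(i := z i - of_int (t + n)))" for n
          using swap[OF f, of z n t] ij(3) by (simp add: fun_upd_twist add.commute)
        have a4: "f (?y(j := ?y j - of_int n)) = f (z(i := z i - of_int (t + n)))" for n
          using W1[OF f, of z "t + n"] by (simp add: diff_diff_eq)
        have "?x j = z j" "?y i = z i" using ij(3) by auto
        then show ?thesis
        proof (cases a)
          case (HL n)
          show ?thesis
            unfolding HL dop.simps a1 a2 a3 a4 scale_left_distrib[symmetric]
            using ij(3,4) by (intro arg_cong2[where f = scale] refl) (simp add: algebra_simps)
        next
          case (HI n)
          show ?thesis unfolding HI dop.simps a1 a2 a3 a4 ..
        qed simp_all
      qed
      show ?thesis
        unfolding tact_def split[of "\<lambda>l. dop l a f ?x"] split[of "\<lambda>l. dop l a f ?y"] main fxy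
        using rest by simp
    qed
    then show "tact a f \<in> W" using f by (auto simp: W_def intro: tact_TP)
  qed
  then have cases: "W = {0} \<or> W = TP S" using sim by (simp add: T.simple_def)
  have "pf S (\<lambda>_. 1) c \<in> W" using pf_TP[OF c(1), of S "\<lambda>_. 1"] by (simp add: W_def pf_def)
  moreover have "pf S (\<lambda>_. 1) c \<noteq> 0" using c(2) by (auto simp: pf_def fun_eq_iff)
  ultimately have "W = TP S" using cases by blast
  let ?q = "(\<lambda>_. 1)(i := [:0, 1:])"
  have ev: "pf S ?q c z = z i *s c" for z
    using finite_S ij(1) unfolding pf_def by (subst prod.remove[of _ i]) auto
  have "pf S ?q c \<in> W" using \<open>W = TP S\<close> pf_TP[OF c(1)] by simp
  then have "pf S ?q c ((\<lambda>_. 0)(i := 0 - of_int 1)) = pf S ?q c ((\<lambda>_. 0)(j := 0 - of_int 1))"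
    using W1[of "pf S ?q c" "\<lambda>_. 0" 1] by simp
  then show False using c(2) ij(3) by (simp add: ev)
qed

end

section \<open>Abstract modules inside free vector spaces\<close>

text \<open>Evaluation of formal combinations maps the free space on the carrier onto \<open>V\<close>, and a complement
  of its kernel is a copy of \<open>V\<close>.\<close>

lemma record_embedding:
  fixes V :: "(complex, 'v, 'z) module_scheme"
  assumes V: "module complex_ring V"
  obtains \<iota> :: "'v \<Rightarrow> 'v \<Rightarrow>\<^sub>0 complex" where
    "\<And>v w. \<lbrakk>v \<in> carrier V; w \<in> carrier V\<rbrakk> \<Longrightarrow> \<iota> (v \<oplus>\<^bsub>V\<^esub> w) = \<iota> v + \<iota> w"
    "\<And>c v. v \<in> carrier V \<Longrightarrow> \<iota> (c \<odot>\<^bsub>V\<^esub> v) = pm_scale c (\<iota> v)"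
    "\<And>v. \<lbrakk>v \<in> carrier V; \<iota> v = 0\<rbrakk> \<Longrightarrow> v = \<zero>\<^bsub>V\<^esub>"
proof -
  interpret V: module complex_ring V by (rule V)
  define ev where "ev p = (\<Oplus>\<^bsub>V\<^esub>x\<in>Poly_Mapping.keys p. Poly_Mapping.lookup p x \<odot>\<^bsub>V\<^esub> x)"
    for p :: "'v \<Rightarrow>\<^sub>0 complex"
  let ?F = "{p :: 'v \<Rightarrow>\<^sub>0 complex. Poly_Mapping.keys p \<subseteq> carrier V}"
  have smult0: "0 \<odot>\<^bsub>V\<^esub> x = \<zero>\<^bsub>V\<^esub>" if "x \<in> carrier V" for x
    using V.smult_l_null[OF that] by simp
  have ev_sup: "ev p = (\<Oplus>\<^bsub>V\<^esub>x\<in>A. Poly_Mapping.lookup p x \<odot>\<^bsub>V\<^esub> x)"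
    if "finite A" "Poly_Mapping.keys p \<subseteq> A" "A \<subseteq> carrier V" for p A
    unfolding ev_def
    by (rule V.add.finprod_mono_neutral_cong_left) (use that in \<open>auto simp: in_keys_iff smult0 subset_iff\<close>)
  have ev_add: "ev (p + q) = ev p \<oplus>\<^bsub>V\<^esub> ev q" if "p \<in> ?F" "q \<in> ?F" for p q
  proof -
    let ?A = "Poly_Mapping.keys p \<union> Poly_Mapping.keys q"
    have "ev r = (\<Oplus>\<^bsub>V\<^esub>x\<in>?A. Poly_Mapping.lookup r x \<odot>\<^bsub>V\<^esub> x)" if "r \<in> {p, q, p + q}" for r
      by (rule ev_sup) (use that keys_add[of p q] \<open>p \<in> ?F\<close> \<open>q \<in> ?F\<close> in auto)
    moreover have "(\<Oplus>\<^bsub>V\<^esub>x\<in>?A. Poly_Mapping.lookup (p + q) x \<odot>\<^bsub>V\<^esub> x) =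
        (\<Oplus>\<^bsub>V\<^esub>x\<in>?A. Poly_Mapping.lookup p x \<odot>\<^bsub>V\<^esub> x \<oplus>\<^bsub>V\<^esub> Poly_Mapping.lookup q x \<odot>\<^bsub>V\<^esub> x)"
      using that V.smult_l_distr by (intro V.finsum_cong') (auto simp: lookup_add subset_iff)
    moreover have "\<dots> = (\<Oplus>\<^bsub>V\<^esub>x\<in>?A. Poly_Mapping.lookup p x \<odot>\<^bsub>V\<^esub> x) \<oplus>\<^bsub>V\<^esub> (\<Oplus>\<^bsub>V\<^esub>x\<in>?A. Poly_Mapping.lookup q x \<odot>\<^bsub>V\<^esub> x)"
      using that by (intro V.finsum_addf) auto
    ultimately show ?thesis by simp
  qed
  have ev_scale: "ev (pm_scale c p) = c \<odot>\<^bsub>V\<^esub> ev p" if "p \<in> ?F" for c p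
  proof -
    have "ev (pm_scale c p) = (\<Oplus>\<^bsub>V\<^esub>x\<in>Poly_Mapping.keys p. Poly_Mapping.lookup (pm_scale c p) x \<odot>\<^bsub>V\<^esub> x)"
      by (rule ev_sup) (use that in \<open>auto simp: in_keys_iff\<close>)
    also have "\<dots> = (\<Oplus>\<^bsub>V\<^esub>x\<in>Poly_Mapping.keys p. c \<odot>\<^bsub>V\<^esub> (Poly_Mapping.lookup p x \<odot>\<^bsub>V\<^esub> x))"
      using that V.smult_assoc1 by (intro V.finsum_cong') (auto simp: subset_iff)
    also have "\<dots> = c \<odot>\<^bsub>V\<^esub> ev p"
      unfolding ev_def using that by (subst V.finsum_smult_ldistr) auto
    finally show ?thesis .
  qed
  have ev_single: "ev (pm_basis v) = v" if "v \<in> carrier V" for v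
    using that V.smult_one by (simp add: ev_def)
  define R where "R = {p \<in> ?F. ev p = \<zero>\<^bsub>V\<^esub>}"
  have "pm.subspace R"
    using subspace_free[of "carrier V"] V.smult_r_null
    by (auto simp: R_def pm.subspace_def ev_add ev_scale) (simp add: ev_def)
  then obtain \<pi> where \<pi>: "Vector_Spaces.linear pm_scale pm_scale \<pi>" "\<And>x. x \<in> R \<Longrightarrow> \<pi> x = 0"
    "\<And>x. x - \<pi> x \<in> R"
    using pm.projection_along by blast
  interpret \<pi>: Vector_Spaces.linear pm_scale pm_scale \<pi> by (rule \<pi>(1))
  note FS = pm.subspace_add[OF subspace_free[of "carrier V"]] pm.subspace_diff[OF subspace_free[of "carrier V"]]
    pm.subspace_scale[OF subspace_free[of "carrier V"]]
  have ev_diff: "ev (p - q) = \<zero>\<^bsub>V\<^esub>" if pq: "p \<in> ?F" "q \<in> ?F" and eq: "ev p = ev q" for p q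
  proof -
    have "ev (p - q) \<oplus>\<^bsub>V\<^esub> ev q = ev q"
      using ev_add[OF FS(2)[OF pq] pq(2)] eq by simp
    moreover have "ev (p - q) \<in> carrier V" "ev q \<in> carrier V"
      using FS(2)[OF pq] pq(2) unfolding ev_def by (auto intro!: V.finsum_closed)
    ultimately show ?thesis by (metis V.add.r_cancel_one)
  qed
  show thesis
  proof (rule that[of "\<lambda>v. \<pi> (pm_basis v)"])
    fix v w assume v: "v \<in> carrier V" "w \<in> carrier V"
    have F: "pm_basis (v \<oplus>\<^bsub>V\<^esub> w) \<in> ?F" "pm_basis v \<in> ?F" "pm_basis w \<in> ?F" using v by auto
    have "pm_basis (v \<oplus>\<^bsub>V\<^esub> w) - (pm_basis v + pm_basis w) \<in> R"
      unfolding R_def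
      by (intro CollectI conjI ev_diff FS(2)[OF F(1) FS(1)[OF F(2,3)], simplified] F FS(1))
        (use v F in \<open>simp_all add: ev_add ev_single\<close>)
    then have "\<pi> (pm_basis (v \<oplus>\<^bsub>V\<^esub> w) - (pm_basis v + pm_basis w)) = 0" by (rule \<pi>(2))
    then show "\<pi> (pm_basis (v \<oplus>\<^bsub>V\<^esub> w)) = \<pi> (pm_basis v) + \<pi> (pm_basis w)"
      by (simp add: \<pi>.diff \<pi>.add)
  next
    fix c v assume v: "v \<in> carrier V"
    have F: "pm_basis (c \<odot>\<^bsub>V\<^esub> v) \<in> ?F" "pm_basis v \<in> ?F" using v by auto
    have "pm_basis (c \<odot>\<^bsub>V\<^esub> v) - pm_scale c (pm_basis v) \<in> R"
      unfolding R_def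
      by (intro CollectI conjI ev_diff FS(2)[OF F(1) FS(3)[OF F(2)], simplified] F FS(3))
        (use v F in \<open>simp_all add: ev_scale ev_single\<close>)
    then have "\<pi> (pm_basis (c \<odot>\<^bsub>V\<^esub> v) - pm_scale c (pm_basis v)) = 0" by (rule \<pi>(2))
    then show "\<pi> (pm_basis (c \<odot>\<^bsub>V\<^esub> v)) = pm_scale c (\<pi> (pm_basis v))"
      by (simp add: \<pi>.diff \<pi>.scale)
  next
    fix v assume v: "v \<in> carrier V" "\<pi> (pm_basis v) = 0"
    then have "pm_basis v \<in> R" using \<pi>(3)[of "pm_basis v"] by simp
    then show "v = \<zero>\<^bsub>V\<^esub>" using ev_single v by (simp add: R_def)
  qed
qed

section \<open>Coinduced modules\<close>

text \<open>An induced module could vanish a priori. A coinduced module can be written down explicitly and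
  receives a map from the induced one that is injective on the generators. It consists of functions
  on words in the subalgebra, stored with the last letter first. An element acts by being appended
  to the word: a letter of the subalgebra stays there, and a letter outside is commuted to the front
  of the word, where it vanishes. Words with other letters carry no information, but admitting them
  saves side conditions.\<close>

fun (in cvs) coact :: "nat \<Rightarrow> hv_index list \<Rightarrow> hv_index \<Rightarrow> (hv_index list \<Rightarrow> 'e) \<Rightarrow> 'e" where
  "coact e [] y \<phi> = (if nonneg_part e y then \<phi> [y] else 0)"
| "coact e (z # r) y \<phi> = (if nonneg_part e y then \<phi> (y # z # r)
     else coact e r y (\<lambda>s. \<phi> (z # s)) + lcomb (*s) (\<lambda>b. coact e r b \<phi>) (hv_bracket_basis z y))"

lemma keys_bracket_nonneg:
  "nonneg_part e x \<Longrightarrow> nonneg_part e y \<Longrightarrow> b \<in> Poly_Mapping.keys (hv_bracket_basis x y) \<Longrightarrow> nonneg_part e b"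
  and keys_bracket_neg:
  "\<not> nonneg_part e x \<Longrightarrow> \<not> nonneg_part e y \<Longrightarrow> b \<in> Poly_Mapping.keys (hv_bracket_basis x y) \<Longrightarrow> \<not> nonneg_part e b"
  by (cases x; cases y; cases b; auto simp: in_keys_iff lookup_add lookup_minus lookup_single when_def split: if_splits)+

context cvs
begin

interpretation F: cvs "fscale scale :: complex \<Rightarrow> (hv_index list \<Rightarrow> 'e) \<Rightarrow> hv_index list \<Rightarrow> 'e"
  by unfold_locales (simp_all add: fun_eq_iff scale_right_distrib scale_left_distrib)

definition cop :: "nat \<Rightarrow> hv_index \<Rightarrow> (hv_index list \<Rightarrow> 'e) \<Rightarrow> hv_index list \<Rightarrow> 'e" where
  "cop e y \<phi> = (\<lambda>r. coact e r y \<phi>)"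

definition sh :: "hv_index \<Rightarrow> (hv_index list \<Rightarrow> 'e) \<Rightarrow> hv_index list \<Rightarrow> 'e" where
  "sh z \<phi> = (\<lambda>r. \<phi> (z # r))"

abbreviation cext :: "nat \<Rightarrow> hv_elem \<Rightarrow> (hv_index list \<Rightarrow> 'e) \<Rightarrow> hv_index list \<Rightarrow> 'e" where
  "cext e x \<phi> \<equiv> lcomb (fscale scale) (\<lambda>b. cop e b \<phi>) x"

text \<open>These functions are the linear maps on words that descend to the enveloping algebra of the
  subalgebra; the order of \<open>z\<close>, \<open>z'\<close> in the bracket is reversed because words are stored backwards.\<close>

definition coherent :: "nat \<Rightarrow> (hv_index list \<Rightarrow> 'e) \<Rightarrow> bool" where
  "coherent e \<phi> \<longleftrightarrow> (\<forall>r s z z'. nonneg_part e z \<longrightarrow> nonneg_part e z' \<longrightarrow>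
     \<phi> (r @ z # z' # s) - \<phi> (r @ z' # z # s) = lcomb (*s) (\<lambda>b. \<phi> (r @ b # s)) (hv_bracket_basis z' z))"

lemma lcomb_fun_apply: "lcomb (fscale scale) g p z = lcomb (*s) (\<lambda>x. g x z) p"
  by (simp add: lcomb_def)

lemma cop_nonneg: "nonneg_part e y \<Longrightarrow> cop e y \<phi> = sh y \<phi>"
proof
  fix r assume "nonneg_part e y"
  then show "cop e y \<phi> r = sh y \<phi> r" by (cases r) (simp_all add: cop_def sh_def)
qed

lemma cop_Nil: "\<not> nonneg_part e y \<Longrightarrow> cop e y \<phi> [] = 0"
  by (simp add: cop_def)

lemma cop_Cons: "\<not> nonneg_part e y \<Longrightarrow> cop e y \<phi> (z # r) = cop e y (sh z \<phi>) r + cext e (hv_bracket_basis z y) \<phi> r"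
  by (simp add: cop_def sh_def lcomb_fun_apply)

lemma sh_cop: "\<not> nonneg_part e y \<Longrightarrow> sh z (cop e y \<phi>) = cop e y (sh z \<phi>) + cext e (hv_bracket_basis z y) \<phi>"
  by (simp add: fun_eq_iff sh_def[of z "cop e y \<phi>"] cop_Cons)

lemma coact_add: "coact e r y (\<phi> + \<psi>) = coact e r y \<phi> + coact e r y \<psi>"
proof (induction r arbitrary: y \<phi> \<psi>)
  case (Cons z r)
  have 1: "(\<phi> + \<psi>) (u # v) = \<phi> (u # v) + \<psi> (u # v)" for u v by simp
  have 2: "(\<lambda>s. \<phi> (z # s) + \<psi> (z # s)) = (\<lambda>s. \<phi> (z # s)) + (\<lambda>s. \<psi> (z # s))" by (simp add: fun_eq_iff)
  show ?case by (simp add: 1 2 Cons.IH lcomb_add_fun del: plus_fun_apply)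
qed simp

lemma coact_scale: "coact e r y (fscale scale c \<phi>) = c *s coact e r y \<phi>"
proof (induction r arbitrary: y \<phi>)
  case (Cons z r)
  have 1: "fscale scale c \<phi> (u # v) = c *s \<phi> (u # v)" for u v by simp
  have 2: "(\<lambda>s. c *s \<phi> (z # s)) = fscale scale c (\<lambda>s. \<phi> (z # s))" by (simp add: fun_eq_iff)
  show ?case by (simp add: 1 2 Cons.IH lcomb_scale_fun scale_right_distrib del: fscale_apply)
qed simp

lemma cop_add: "cop e y (\<phi> + \<psi>) = cop e y \<phi> + cop e y \<psi>"
  and cop_scale: "cop e y (fscale scale c \<phi>) = fscale scale c (cop e y \<phi>)"
  by (simp_all add: cop_def fun_eq_iff coact_add coact_scale)

lemma cop_zero [simp]: "cop e y 0 = 0" using cop_add[of e y 0 0] by simp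

lemma cop_minus: "cop e y (- \<phi>) = - cop e y \<phi>"
  by (metis add_eq_0_iff cop_add cop_zero ab_left_minus)

lemma cop_diff: "cop e y (\<phi> - \<psi>) = cop e y \<phi> - cop e y \<psi>"
  by (metis diff_conv_add_uminus cop_add cop_minus)

lemma cop_lcomb: "cop e y (lcomb (fscale scale) f p) = lcomb (fscale scale) (\<lambda>x. cop e y (f x)) p"
  by (rule F.additive_lcomb) (rule cop_add cop_scale)+

lemma coherent_sh: "coherent e \<phi> \<Longrightarrow> coherent e (sh z \<phi>)"
  unfolding coherent_def sh_def append_Cons[symmetric] by blast

lemma cop_commute_exact:
  assumes "nonneg_part e z" "\<not> nonneg_part e y"
  shows "cop e z (cop e y \<phi>) = cop e y (cop e z \<phi>) + cext e (hv_bracket_basis z y) \<phi>"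
  using assms by (simp add: cop_nonneg sh_cop)

text \<open>If one of the two letters belongs to the subalgebra, the relation is part of the definition of the
  action or of coherence. For two letters outside, removing the first letter \<open>z\<close> of the stored word
  reduces the relation to shorter words, and the terms in which \<open>z\<close> is bracketed with the letters
  match by the Jacobi identity.\<close>

lemma cop_bracket_at:
  "coherent e \<phi> \<Longrightarrow> (cop e x (cop e y \<phi>) - cop e y (cop e x \<phi>)) r = cext e (hv_bracket_basis x y) \<phi> r"
proof -
  have *: "(cop e x (cop e y \<phi>) - cop e y (cop e x \<phi>)) r = cext e (hv_bracket_basis x y) \<phi> r"
    if \<phi>: "coherent e \<phi>" and xy: "nonneg_part e x \<or> nonneg_part e y" for x y \<phi> r
  proof (cases "nonneg_part e x \<and> nonneg_part e y")
    case True
    have "(cop e x (cop e y \<phi>) - cop e y (cop e x \<phi>)) r = \<phi> ([] @ y # x # r) - \<phi> ([] @ x # y # r)"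
      using True by (simp add: cop_nonneg sh_def)
    also have "\<dots> = lcomb (*s) (\<lambda>b. \<phi> ([] @ b # r)) (hv_bracket_basis x y)"
      using \<phi> True unfolding coherent_def by blast
    also have "\<dots> = cext e (hv_bracket_basis x y) \<phi> r"
      unfolding lcomb_fun_apply
      by (rule lcomb_cong) (use True in \<open>auto dest: keys_bracket_nonneg simp: cop_nonneg sh_def\<close>)
    finally show ?thesis .
  next
    case False
    then consider "nonneg_part e x" "\<not> nonneg_part e y" | "\<not> nonneg_part e x" "nonneg_part e y"
      using xy by blast
    then show ?thesis
    proof cases
      case 1
      show ?thesis unfolding cop_commute_exact[OF 1] by simp
    next
      case 2
      show ?thesis unfolding cop_commute_exact[OF 2(2,1)] hv_bracket_basis_antisym[of x y] by (simp add: F.lcomb_minus)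
    qed
  qed
  show "coherent e \<phi> \<Longrightarrow> (cop e x (cop e y \<phi>) - cop e y (cop e x \<phi>)) r = cext e (hv_bracket_basis x y) \<phi> r"
  proof (induction r arbitrary: x y \<phi>)
    case Nil
    show ?case
    proof (cases "nonneg_part e x \<or> nonneg_part e y")
      case True
      then show ?thesis by (rule *[OF Nil])
    next
      case False
      have "cext e (hv_bracket_basis x y) \<phi> [] = lcomb (*s) (\<lambda>b. 0) (hv_bracket_basis x y)"
        unfolding lcomb_fun_apply
        by (rule lcomb_cong) (use False keys_bracket_neg[of e x y] in \<open>auto simp: cop_Nil\<close>)
      also have "\<dots> = 0" by simp
      also have "0 = (cop e x (cop e y \<phi>) - cop e y (cop e x \<phi>)) []" using False by (simp add: cop_Nil)
      finally show ?thesis ..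
    qed
  next
    case (Cons z r)
    show ?case
    proof (cases "nonneg_part e x \<or> nonneg_part e y")
      case True
      then show ?thesis by (rule *[OF Cons.prems])
    next
      case False
      note IH = Cons.IH[OF Cons.prems] and IHz = Cons.IH[OF coherent_sh[OF Cons.prems, of z]]
      have step: "cop e x (cop e y \<phi>) (z # r) = cop e x (cop e y (sh z \<phi>)) r
          + cop e x (cext e (hv_bracket_basis z y) \<phi>) r + cext e (hv_bracket_basis z x) (cop e y \<phi>) r"
        if "\<not> nonneg_part e x" "\<not> nonneg_part e y" for x y
        using that by (simp add: cop_Cons[of e x] sh_cop cop_add)
      have comm: "cop e x (cext e p \<phi>) r - cext e p (cop e x \<phi>) r = cext e (bracket hv (pm_basis x) p) \<phi> r" for x p
      proof -
        have "cop e x (cext e p \<phi>) r - cext e p (cop e x \<phi>) r =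
            lcomb (*s) (\<lambda>b. (cop e x (cop e b \<phi>) - cop e b (cop e x \<phi>)) r) p"
          by (simp add: cop_lcomb lcomb_fun_apply lcomb_diff_fun)
        also have "\<dots> = cext e (bracket hv (pm_basis x) p) \<phi> r"
          by (simp only: IH) (simp add: lcomb_fun_apply bracket_hv lcomb_lcomb del: fscale_apply)
        finally show ?thesis .
      qed
      have "cop e d \<phi> (z # r) = cop e d (sh z \<phi>) r + cext e (hv_bracket_basis z d) \<phi> r"
        if "d \<in> Poly_Mapping.keys (hv_bracket_basis x y)" for d
        using False keys_bracket_neg[of e x y d] that by (intro cop_Cons) auto
      then have "cext e (hv_bracket_basis x y) \<phi> (z # r) = lcomb (*s) (\<lambda>d. cop e d (sh z \<phi>) r
          + cext e (hv_bracket_basis z d) \<phi> r) (hv_bracket_basis x y)"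
        unfolding lcomb_fun_apply by (intro lcomb_cong) (simp add: lcomb_fun_apply)
      also have "\<dots> = cext e (hv_bracket_basis x y) (sh z \<phi>) r + cext e (bracket hv (pm_basis z) (hv_bracket_basis x y)) \<phi> r"
        by (simp add: lcomb_add_fun lcomb_fun_apply bracket_hv lcomb_lcomb)
      finally have rhs: "cext e (hv_bracket_basis x y) \<phi> (z # r) =
          cext e (hv_bracket_basis x y) (sh z \<phi>) r + cext e (bracket hv (pm_basis z) (hv_bracket_basis x y)) \<phi> r" .
      have "bracket hv (pm_basis z) (hv_bracket_basis x y) =
          bracket hv (pm_basis x) (hv_bracket_basis z y) - bracket hv (pm_basis y) (hv_bracket_basis z x)"
      proof -
        have neg: "bracket hv u (- w) = - bracket hv u w" for u w
          by (simp add: bracket_hv pm.lcomb_minus) (simp add: lcomb_def sum_negf)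
        show ?thesis
          using hv_jacobi_basis[of x y z]
          by (simp add: hv_bracket_basis_antisym[of z y] neg algebra_simps eq_neg_iff_add_eq_0)
      qed
      then have "cext e (bracket hv (pm_basis z) (hv_bracket_basis x y)) \<phi> r =
          cext e (bracket hv (pm_basis x) (hv_bracket_basis z y)) \<phi> r - cext e (bracket hv (pm_basis y) (hv_bracket_basis z x)) \<phi> r"
        by (simp add: F.lcomb_diff)
      then show ?thesis
        unfolding rhs comm[symmetric] IHz[symmetric] using False by (simp add: step)
    qed
  qed
qed

lemma cop_bracket: "coherent e \<phi> \<Longrightarrow>
    cop e x (cop e y \<phi>) - cop e y (cop e x \<phi>) = cext e (hv_bracket_basis x y) \<phi>"
  by (rule ext) (rule cop_bracket_at)

lemma cop_cext_bracket: "coherent e \<phi> \<Longrightarrow>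
    cop e x (cext e p \<phi>) - cext e p (cop e x \<phi>) = cext e (bracket hv (pm_basis x) p) \<phi>"
proof -
  assume \<phi>: "coherent e \<phi>"
  have "cop e x (cext e p \<phi>) - cext e p (cop e x \<phi>) =
      lcomb (fscale scale) (\<lambda>b. cop e x (cop e b \<phi>) - cop e b (cop e x \<phi>)) p"
    by (simp add: cop_lcomb F.lcomb_diff_fun)
  also have "\<dots> = cext e (bracket hv (pm_basis x) p) \<phi>"
    by (simp only: cop_bracket[OF \<phi>]) (simp add: bracket_hv F.lcomb_lcomb)
  finally show ?thesis .
qed

text \<open>At the beginning of the word, coherence of \<open>cop e y \<phi>\<close> says that three operators satisfy a
  bracket relation; commuting \<open>y\<close> past the other two turns this into the relation for \<open>\<phi>\<close> and the
  Jacobi identity.\<close>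

lemma coherent_cop:
  assumes "coherent e \<phi>"
  shows "coherent e (cop e y \<phi>)"
proof -
  have "cop e y \<phi> (r @ z # z' # s) - cop e y \<phi> (r @ z' # z # s) =
      lcomb (*s) (\<lambda>b. cop e y \<phi> (r @ b # s)) (hv_bracket_basis z' z)"
    if "coherent e \<phi>" "nonneg_part e z" "nonneg_part e z'" for r s z z' y \<phi>
    using that(1)
  proof (induction r arbitrary: y \<phi>)
    case (Cons t r)
    show ?case
    proof (cases "nonneg_part e y")
      case True
      then show ?thesis
        using coherent_sh[OF Cons.prems, of y] that(2,3)
        unfolding cop_nonneg[OF True] coherent_def by blast
    next
      case False
      have "cop e y \<phi> ((t # r) @ z # z' # s) - cop e y \<phi> ((t # r) @ z' # z # s) =
          (cop e y (sh t \<phi>) (r @ z # z' # s) - cop e y (sh t \<phi>) (r @ z' # z # s)) +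
          lcomb (*s) (\<lambda>b. cop e b \<phi> (r @ z # z' # s) - cop e b \<phi> (r @ z' # z # s)) (hv_bracket_basis t y)"
        using False by (simp add: cop_Cons lcomb_fun_apply lcomb_diff_fun)
      also have "\<dots> = lcomb (*s) (\<lambda>b. cop e y \<phi> ((t # r) @ b # s)) (hv_bracket_basis z' z)"
        unfolding Cons.IH[OF Cons.prems] Cons.IH[OF coherent_sh[OF Cons.prems]]
        using False by (simp add: cop_Cons lcomb_fun_apply lcomb_add_fun lcomb_swap[of _ _ "hv_bracket_basis t y"])
      finally show ?thesis .
    qed
  next
    case Nil
    show ?case
    proof (cases "nonneg_part e y")
      case True
      then show ?thesis
        using coherent_sh[OF Nil, of y] that(2,3)
        unfolding cop_nonneg[OF True] coherent_def by blast
    next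
      case False
      have 1: "cop e z' (cop e z (cop e y \<phi>)) = cop e y (cop e z' (cop e z \<phi>))
          + cext e (hv_bracket_basis z' y) (cop e z \<phi>) + cext e (hv_bracket_basis z y) (cop e z' \<phi>)
          + cext e (bracket hv (pm_basis z') (hv_bracket_basis z y)) \<phi>"
        if z: "nonneg_part e z" "nonneg_part e z'" for z z'
        using cop_cext_bracket[OF Nil, of z' "hv_bracket_basis z y"]
        by (simp add: cop_commute_exact[OF z(1) False] cop_commute_exact[OF z(2) False] cop_add algebra_simps)
      have 2: "cext e (hv_bracket_basis z' z) (cop e y \<phi>) = cop e y (cext e (hv_bracket_basis z' z) \<phi>)
          - cext e (bracket hv (pm_basis y) (hv_bracket_basis z' z)) \<phi>"
        using cop_cext_bracket[OF Nil, of y "hv_bracket_basis z' z"] by (simp add: algebra_simps)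
      have neg: "bracket hv u (- w) = - bracket hv u w" for u w
        by (simp add: bracket_hv pm.lcomb_minus) (simp add: lcomb_def sum_negf)
      have J: "bracket hv (pm_basis z') (hv_bracket_basis z y) - bracket hv (pm_basis z) (hv_bracket_basis z' y) =
          - bracket hv (pm_basis y) (hv_bracket_basis z' z)"
        using hv_jacobi_basis[of z' z y]
        by (simp add: hv_bracket_basis_antisym[of z' y] neg eq_neg_iff_add_eq_0)
      have "cop e z' (cop e z (cop e y \<phi>)) - cop e z (cop e z' (cop e y \<phi>)) =
          cop e y (cop e z' (cop e z \<phi>) - cop e z (cop e z' \<phi>))
          + cext e (bracket hv (pm_basis z') (hv_bracket_basis z y) - bracket hv (pm_basis z) (hv_bracket_basis z' y)) \<phi>"
        unfolding 1[OF that(2,3)] 1[OF that(3,2)] by (simp add: cop_diff F.lcomb_diff)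
      also have "\<dots> = cext e (hv_bracket_basis z' z) (cop e y \<phi>)"
        unfolding cop_bracket[OF Nil] J 2 by (simp add: F.lcomb_minus)
      finally have "(cop e z' (cop e z (cop e y \<phi>)) - cop e z (cop e z' (cop e y \<phi>))) s =
          cext e (hv_bracket_basis z' z) (cop e y \<phi>) s" by simp
      moreover have "cext e (hv_bracket_basis z' z) (cop e y \<phi>) s =
          lcomb (*s) (\<lambda>b. cop e y \<phi> (b # s)) (hv_bracket_basis z' z)"
        unfolding lcomb_fun_apply
        by (rule lcomb_cong) (use keys_bracket_nonneg[OF that(3,2)] in \<open>auto simp: cop_nonneg sh_def\<close>)
      ultimately show ?thesis using that(2,3) by (simp add: cop_nonneg sh_def)
    qed
  qed
  then show ?thesis using assms by (simp add: coherent_def)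
qed

lemma coinduced_rep: "hv_rep (fscale scale) {\<phi>. coherent e \<phi>} (cop e)"
proof (unfold_locales, goal_cases)
  case 1
  show ?case
    by (rule F.subspaceI)
      (simp_all add: coherent_def lcomb_add_fun lcomb_scale_fun scale_right_diff_distrib[symmetric] add_diff_add)
qed (simp_all add: coherent_cop cop_add cop_scale cop_bracket)

end

section \<open>The universal enveloping algebra\<close>

definition free_mult :: "('g list \<Rightarrow>\<^sub>0 complex) \<Rightarrow> ('g list \<Rightarrow>\<^sub>0 complex) \<Rightarrow> ('g list \<Rightarrow>\<^sub>0 complex)" where
  "free_mult p q = lcomb pm_scale (\<lambda>a. lcomb pm_scale (\<lambda>b. pm_basis (a @ b)) q) p"

lemma free_alg_sel [simp]:
  "carrier (free_alg g) = {p. Poly_Mapping.keys p \<subseteq> lists (carrier g)}" "\<zero>\<^bsub>free_alg g\<^esub> = 0"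
  "\<one>\<^bsub>free_alg g\<^esub> = pm_basis []" "p \<oplus>\<^bsub>free_alg g\<^esub> q = p + q" "p \<otimes>\<^bsub>free_alg g\<^esub> q = free_mult p q"
  "c \<odot>\<^bsub>free_alg g\<^esub> p = pm_scale c p"
  by (simp_all add: free_alg_def free_space_def free_mult_def lin_ext_lcomb)

lemma free_mult_basis [simp]: "free_mult (pm_basis a) (pm_basis b) = pm_basis (a @ b)"
  by (simp add: free_mult_def)

lemma free_mult_lcomb_left: "free_mult (lcomb pm_scale f p) q = lcomb pm_scale (\<lambda>x. free_mult (f x) q) p"
  by (simp add: free_mult_def pm.lcomb_lcomb)

lemma free_mult_add: "free_mult (p + p') q = free_mult p q + free_mult p' q" "free_mult p (q + q') = free_mult p q + free_mult p q'"
  by (simp_all add: free_mult_def pm.lcomb_add pm.lcomb_add_fun)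

lemma free_mult_scale: "free_mult (pm_scale c p) q = pm_scale c (free_mult p q)" "free_mult p (pm_scale c q) = pm_scale c (free_mult p q)"
  by (simp_all add: free_mult_def pm.lcomb_scale pm.lcomb_scale_fun)

lemma free_mult_diff: "free_mult (p - p') q = free_mult p q - free_mult p' q" "free_mult p (q - q') = free_mult p q - free_mult p q'"
  by (simp_all add: free_mult_def pm.lcomb_diff pm.lcomb_diff_fun)

lemma free_mult_Nil [simp]: "free_mult (pm_basis []) q = q" "free_mult p (pm_basis []) = p"
  by (simp_all add: free_mult_def lcomb_basis)

lemma free_mult_assoc: "free_mult (free_mult p q) r = free_mult p (free_mult q r)"
proof -
  have "free_mult (free_mult p q) r = lcomb pm_scale (\<lambda>a. lcomb pm_scale (\<lambda>b. lcomb pm_scale (\<lambda>c. pm_basis (a @ b @ c)) r) q) p"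
    by (simp add: free_mult_def pm.lcomb_lcomb)
  also have "\<dots> = free_mult p (free_mult q r)"
    by (simp add: free_mult_def pm.lcomb_lcomb)
  finally show ?thesis .
qed

lemma ring_free_alg_hv: "ring (free_alg hv)"
proof (rule ringI)
  show "abelian_group (free_alg hv)"
    by (rule abelian_groupI) (auto simp: add_ac lists_UNIV intro: exI[of _ "- _"] left_minus)
  show "Group.monoid (free_alg hv)"
    by (rule monoidI) (auto simp: lists_UNIV free_mult_assoc)
qed (auto simp: free_mult_add)

abbreviation "UI \<equiv> uea_ideal hv"

lemma UI_ideal: "ideal UI (free_alg hv)"
  unfolding uea_ideal_def
  by (rule ring.genideal_ideal[OF ring_free_alg_hv]) (simp add: lists_UNIV)

lemma UI_rels: "uea_rels hv \<subseteq> UI"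
  unfolding uea_ideal_def
  by (rule ring.genideal_self[OF ring_free_alg_hv]) (simp add: lists_UNIV)

lemma UI_fm: "p \<in> UI \<Longrightarrow> free_mult q p \<in> UI" "p \<in> UI \<Longrightarrow> free_mult p q \<in> UI"
  using ideal.I_l_closed[OF UI_ideal, of p q] ideal.I_r_closed[OF UI_ideal, of p q]
  by (simp_all add: lists_UNIV)

lemma UI_subspace: "pm.subspace UI"
proof (rule pm.subspaceI)
  show "0 \<in> UI" using additive_subgroup.zero_closed[OF ideal.axioms(1)[OF UI_ideal]] by simp
  show "x + y \<in> UI" if "x \<in> UI" "y \<in> UI" for x y using additive_subgroup.a_closed[OF ideal.axioms(1)[OF UI_ideal] that] by simp
  show "pm_scale c x \<in> UI" if "x \<in> UI" for c x
    using UI_fm(1)[OF that, of "pm_scale c (pm_basis [])"] by (simp add: free_mult_scale)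
qed

interpretation U: free_quotient "free_alg hv" UI
  by unfold_locales (use UI_subspace in \<open>simp_all add: lists_UNIV pm.subspace_UNIV\<close>)

lemma uea_class_cls: "uea_class hv p = U.cls p"
  by (simp add: uea_class_def)

lemma uea_carrier: "carrier (uea hv) = range (uea_class hv)"
  using U.quotient_carrier by (simp add: uea_def uea_class_cls[abs_def] lists_UNIV)

lemma uea_add: "uea_class hv p \<oplus>\<^bsub>uea hv\<^esub> uea_class hv q = uea_class hv (p + q)"
  using U.quotient_add by (simp add: uea_def uea_class_cls)

lemma uea_smult: "c \<odot>\<^bsub>uea hv\<^esub> uea_class hv p = uea_class hv (pm_scale c p)"
  using U.quotient_smult by (simp add: uea_def uea_class_cls)

lemma uea_mult: "uea_class hv p \<otimes>\<^bsub>uea hv\<^esub> uea_class hv q = uea_class hv (free_mult p q)"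
  using ideal.rcoset_mult_add[OF UI_ideal, of p q]
  by (simp add: uea_def quotient_module_def ring.defs FactRing_def uea_class_cls lists_UNIV)

lemma uea_class_eq: "uea_class hv p = uea_class hv q \<longleftrightarrow> p - q \<in> UI"
  by (simp add: uea_class_cls U.cls_eq_iff)

text \<open>In the enveloping algebra a letter is a linear function of the Lie algebra element.\<close>

lemma letter_linear: "pm_basis [x] - lcomb pm_scale (\<lambda>a. pm_basis [pm_basis a]) x \<in> UI"
proof -
  have add: "pm_basis [y + z] - (pm_basis [y] + pm_basis [z]) \<in> UI" for y z
  proof -
    have "pm_basis [y \<oplus>\<^bsub>hv\<^esub> z] - pm_basis [y] - pm_basis [z] \<in> uea_rels hv"
      unfolding uea_rels_def hv_sel by blast
    then show ?thesis using UI_rels by (auto simp: diff_diff_eq)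
  qed
  have scale: "pm_basis [pm_scale c y] - pm_scale c (pm_basis [y]) \<in> UI" for c y
  proof -
    have "pm_basis [c \<odot>\<^bsub>hv\<^esub> y] - pm_scale c (pm_basis [y]) \<in> uea_rels hv"
      unfolding uea_rels_def hv_sel by blast
    then show ?thesis using UI_rels by auto
  qed
  define D :: "hv_elem \<Rightarrow> hv_elem list \<Rightarrow>\<^sub>0 complex" where "D y = pm_basis [y] - lcomb pm_scale (\<lambda>a. pm_basis [pm_basis a]) y" for y
  have D_add: "D (y + z) - (D y + D z) \<in> UI" for y z
    using add[of y z] by (simp add: D_def pm.lcomb_add algebra_simps)
  have D_scale: "D (pm_scale c y) - pm_scale c (D y) \<in> UI" for c y
    using scale[of c y] by (simp add: D_def pm.lcomb_scale pm.scale_right_diff_distrib)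
  have D0: "D 0 \<in> UI" using D_scale[of 0 0] by simp
  have D_plus: "D (y + z) \<in> UI" if "D y \<in> UI" "D z \<in> UI" for y z
    using pm.subspace_add[OF UI_subspace D_add[of y z] pm.subspace_add[OF UI_subspace that]] by simp
  have D_sc: "D (pm_scale c y) \<in> UI" if "D y \<in> UI" for c y
    using pm.subspace_add[OF UI_subspace D_scale[of c y] pm.subspace_scale[OF UI_subspace that, of c]] by simp
  have "D (\<Sum>a\<in>A. pm_scale (Poly_Mapping.lookup x a) (pm_basis a)) \<in> UI" for A
    by (induction A rule: infinite_finite_induct)
      (auto intro!: D_plus D_sc simp: D0, simp_all add: D_def pm.subspace_0[OF UI_subspace])
  then have "D (lcomb pm_scale pm_basis x) \<in> UI" by (simp add: lcomb_def)
  then show ?thesis by (simp add: lcomb_basis D_def)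
qed

context hv_rep
begin

definition wact :: "hv_elem list \<Rightarrow> 'e \<Rightarrow> 'e" where "wact w v = foldr ext w v"

definition pact :: "(hv_elem list \<Rightarrow>\<^sub>0 complex) \<Rightarrow> 'e \<Rightarrow> 'e" where
  "pact p v = lcomb (*s) (\<lambda>w. wact w v) p"

lemma wact_simps [simp]: "wact [] v = v" "wact (x # w) v = ext x (wact w v)" "wact (w @ w') v = wact w (wact w' v)"
  by (simp_all add: wact_def)

lemma wact_add: "wact w (u + v) = wact w u + wact w v" and wact_scale: "wact w (c *s v) = c *s wact w v"
  by (induction w) (simp_all add: ext_add_right ext_scale_right)

lemma wact_lcomb: "wact w (lcomb (*s) f p) = lcomb (*s) (\<lambda>x. wact w (f x)) p"
  by (rule additive_lcomb) (rule wact_add wact_scale)+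

lemma wact_C: "v \<in> C \<Longrightarrow> wact w v \<in> C"
  by (induction w) (auto intro: ext_closed[OF C_subspace] op_closed)

lemma pact_basis [simp]: "pact (pm_basis w) v = wact w v" by (simp add: pact_def)

lemma pact_fm: "pact (free_mult p q) v = pact p (pact q v)"
  by (simp add: pact_def free_mult_def lcomb_lcomb wact_lcomb)

lemma pact_add: "pact (p + q) v = pact p v + pact q v" "pact p (u + v) = pact p u + pact p v"
  and pact_scale: "pact (pm_scale c p) v = c *s pact p v" "pact p (c *s v) = c *s pact p v"
  and pact_diff: "pact (p - q) v = pact p v - pact q v"
  by (simp_all add: pact_def lcomb_add lcomb_scale lcomb_diff wact_add wact_scale lcomb_add_fun lcomb_scale_fun)

lemma pact_zero [simp]: "pact p 0 = 0"
  using pact_scale(2)[of p 0 0] by simp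

lemma pact_C: "v \<in> C \<Longrightarrow> pact p v \<in> C"
  unfolding pact_def by (intro lcomb_in_subspace[OF C_subspace] wact_C)

text \<open>The elements of the free algebra that annihilate a representation form an ideal containing the
  defining relations.\<close>

lemma pact_ideal:
  assumes "p \<in> UI" "v \<in> C"
  shows "pact p v = 0"
proof -
  let ?K = "{p. \<forall>v\<in>C. pact p v = 0}"
  have "ideal ?K (free_alg hv)"
  proof (rule idealI[OF ring_free_alg_hv])
    show "subgroup ?K (add_monoid (free_alg hv))"
    proof (rule group.subgroupI)
      interpret ring "free_alg hv" by (rule ring_free_alg_hv)
      show "group (add_monoid (free_alg hv))" by (rule add.group_axioms)
      have inv: "inv\<^bsub>add_monoid (free_alg hv)\<^esub> p = - p" for p
        by (rule add.inv_equality[unfolded a_inv_def]) (simp_all add: lists_UNIV)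
      show "inv\<^bsub>add_monoid (free_alg hv)\<^esub> p \<in> ?K" if "p \<in> ?K" for p
        unfolding inv using that by (simp add: pact_def lcomb_minus)
    qed (auto simp: lists_UNIV pact_add pact_def[of 0] intro: exI[of _ 0])
  qed (auto simp: pact_fm lists_UNIV pact_C) 
  moreover have "uea_rels hv \<subseteq> ?K"
    by (auto simp: uea_rels_def pact_diff pact_scale ext_add_left ext_scale_left ext_bracket)
  ultimately have "UI \<subseteq> ?K"
    unfolding uea_ideal_def by (rule ring.genideal_minimal[OF ring_free_alg_hv])
  then show ?thesis using assms by blast
qed

end

section \<open>Induced modules\<close>

definition left_mult :: "hv_elem \<Rightarrow> (((hv_elem list \<Rightarrow>\<^sub>0 complex) set \<times> 'v) \<Rightarrow>\<^sub>0 complex)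
    \<Rightarrow> (((hv_elem list \<Rightarrow>\<^sub>0 complex) set \<times> 'v) \<Rightarrow>\<^sub>0 complex)" where
  "left_mult x = lin_ext (\<lambda>(u, v). pm_basis (uea_class hv (pm_basis [x]) \<otimes>\<^bsub>uea hv\<^esub> u, v))"

locale hv_sub_module =
  fixes e :: nat and M :: "(hv_elem, 'v) lie_module"
  assumes M: "lie_module (hv_sub e) M"
begin

abbreviation "h \<equiv> hv_sub e"

lemma h_sel [simp]: "x \<oplus>\<^bsub>h\<^esub> y = x + y" "c \<odot>\<^bsub>h\<^esub> x = pm_scale c x" "bracket h x y = bracket hv x y"
  by (simp_all add: hv_sub_def hv_def module.defs free_space_def lie_algebra.defs)

lemma h_carrier: "carrier h = {x. \<forall>a\<in>Poly_Mapping.keys x. nonneg_part e a}"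
proof -
  have "a \<in> {HL m | m. m \<ge> 0} \<union> {HI (m - int e) | m. m \<ge> 0} \<union> {HC1, HC2, HC3} \<longleftrightarrow> nonneg_part e a" for a
  proof (cases a)
    case (HI n)
    have "\<exists>m. n = m - int e \<and> 0 \<le> m" if "- int e \<le> n"
      by (rule exI[of _ "n + int e"]) (use that in simp)
    then show ?thesis unfolding HI by auto
  qed auto
  then have "{HL m | m. m \<ge> 0} \<union> {HI (m - int e) | m. m \<ge> 0} \<union> {HC1, HC2, HC3} = {a. nonneg_part e a}"
    by blast
  moreover have "carrier h = {x. Poly_Mapping.keys x \<subseteq>
      {HL m | m. m \<ge> 0} \<union> {HI (m - int e) | m. m \<ge> 0} \<union> {HC1, HC2, HC3}}"
    by (simp add: hv_sub_def)
  ultimately show ?thesis by (simp only:) auto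
qed

lemma h_basis: "nonneg_part e a \<Longrightarrow> pm_basis a \<in> carrier h"
  by (simp add: h_carrier)

sublocale M: lie_module h M by (rule M)

definition emb :: "'v \<Rightarrow> 'v \<Rightarrow>\<^sub>0 complex" where
  "emb = (SOME \<iota>. (\<forall>v\<in>carrier M. \<forall>w\<in>carrier M. \<iota> (v \<oplus>\<^bsub>M\<^esub> w) = \<iota> v + \<iota> w) \<and>
    (\<forall>c. \<forall>v\<in>carrier M. \<iota> (c \<odot>\<^bsub>M\<^esub> v) = pm_scale c (\<iota> v)) \<and>
    (\<forall>v\<in>carrier M. \<iota> v = 0 \<longrightarrow> v = \<zero>\<^bsub>M\<^esub>))"

lemma emb:
  assumes "v \<in> carrier M"
  shows "w \<in> carrier M \<Longrightarrow> emb (v \<oplus>\<^bsub>M\<^esub> w) = emb v + emb w"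
    "emb (c \<odot>\<^bsub>M\<^esub> v) = pm_scale c (emb v)" "emb v = 0 \<Longrightarrow> v = \<zero>\<^bsub>M\<^esub>"
proof -
  have "\<exists>\<iota> :: 'v \<Rightarrow> 'v \<Rightarrow>\<^sub>0 complex. (\<forall>v\<in>carrier M. \<forall>w\<in>carrier M. \<iota> (v \<oplus>\<^bsub>M\<^esub> w) = \<iota> v + \<iota> w) \<and>
    (\<forall>c. \<forall>v\<in>carrier M. \<iota> (c \<odot>\<^bsub>M\<^esub> v) = pm_scale c (\<iota> v)) \<and>
    (\<forall>v\<in>carrier M. \<iota> v = 0 \<longrightarrow> v = \<zero>\<^bsub>M\<^esub>)"
    using record_embedding[OF M.V.module_axioms] by metis
  from someI_ex[OF this] assms
  show "w \<in> carrier M \<Longrightarrow> emb (v \<oplus>\<^bsub>M\<^esub> w) = emb v + emb w"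
    "emb (c \<odot>\<^bsub>M\<^esub> v) = pm_scale c (emb v)" "emb v = 0 \<Longrightarrow> v = \<zero>\<^bsub>M\<^esub>"
    unfolding emb_def[symmetric] by blast+
qed

lemma linear_finsum:
  fixes f :: "'v \<Rightarrow> 'a::ab_group_add"
  assumes add: "\<And>v w. v \<in> carrier M \<Longrightarrow> w \<in> carrier M \<Longrightarrow> f (v \<oplus>\<^bsub>M\<^esub> w) = f v + f w"
    and "finite A" "\<And>x. x \<in> A \<Longrightarrow> g x \<in> carrier M"
  shows "f (\<Oplus>\<^bsub>M\<^esub>x\<in>A. g x) = (\<Sum>x\<in>A. f (g x))"
  using assms(2,3)
proof (induction A rule: finite_induct)
  case empty
  have "f \<zero>\<^bsub>M\<^esub> = f \<zero>\<^bsub>M\<^esub> + f \<zero>\<^bsub>M\<^esub>" using add[of "\<zero>\<^bsub>M\<^esub>" "\<zero>\<^bsub>M\<^esub>"] by simp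
  then show ?case by simp
next
  case (insert x A)
  then show ?case by (simp add: add Pi_def)
qed

lemma wact_carrier: "v \<in> carrier M \<Longrightarrow> w \<in> lists (carrier h) \<Longrightarrow> foldr (act M) w v \<in> carrier M"
  by (induction w) (auto intro: M.act_closed)

lemma linear_free_alg_act:
  fixes f :: "'v \<Rightarrow> 'a::ab_group_add"
  assumes add: "\<And>v w. v \<in> carrier M \<Longrightarrow> w \<in> carrier M \<Longrightarrow> f (v \<oplus>\<^bsub>M\<^esub> w) = f v + f w"
    and scale: "\<And>c v. v \<in> carrier M \<Longrightarrow> f (c \<odot>\<^bsub>M\<^esub> v) = s c (f v)"
    and v: "v \<in> carrier M" and p: "p \<in> carrier (free_alg h)"
  shows "f (free_alg_act M p v) = lcomb s (\<lambda>w. f (foldr (act M) w v)) p"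
proof -
  have w: "foldr (act M) w v \<in> carrier M" if "w \<in> Poly_Mapping.keys p" for w
    using p v that by (intro wact_carrier) auto
  have "f (free_alg_act M p v) = (\<Sum>w\<in>Poly_Mapping.keys p. f (Poly_Mapping.lookup p w \<odot>\<^bsub>M\<^esub> foldr (act M) w v))"
    unfolding free_alg_act_def by (rule linear_finsum[OF add]) (use w in auto)
  then show ?thesis using w by (simp add: lcomb_def scale)
qed

lemma act_expand:
  fixes f :: "'v \<Rightarrow> 'a::ab_group_add"
  assumes s: "cvs s" and add: "\<And>v w. v \<in> carrier M \<Longrightarrow> w \<in> carrier M \<Longrightarrow> f (v \<oplus>\<^bsub>M\<^esub> w) = f v + f w"
    and scale: "\<And>c v. v \<in> carrier M \<Longrightarrow> f (c \<odot>\<^bsub>M\<^esub> v) = s c (f v)"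
    and v: "v \<in> carrier M" and x: "x \<in> carrier h"
  shows "f (act M x v) = lcomb s (\<lambda>a. f (act M (pm_basis a) v)) x"
proof -
  interpret s: cvs s by (rule s)
  have h0: "0 \<in> carrier h" by (simp add: h_carrier)
  have A0: "f (act M 0 v) = 0"
    using M.act_smult_left[OF h0 v, of 0] scale[OF M.act_closed[OF h0 v], of 0] by simp
  have "(\<Sum>a\<in>A. pm_scale (Poly_Mapping.lookup x a) (pm_basis a)) \<in> carrier h \<and>
     f (act M (\<Sum>a\<in>A. pm_scale (Poly_Mapping.lookup x a) (pm_basis a)) v) =
     (\<Sum>a\<in>A. s (Poly_Mapping.lookup x a) (f (act M (pm_basis a) v)))"
    if "finite A" "A \<subseteq> Poly_Mapping.keys x" for A
    using that
  proof (induction A rule: finite_induct)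
    case empty
    then show ?case by (simp add: A0 h0)
  next
    case (insert a A)
    let ?c = "Poly_Mapping.lookup x a" and ?S = "\<Sum>a\<in>A. pm_scale (Poly_Mapping.lookup x a) (pm_basis a)"
    have a: "pm_basis a \<in> carrier h" using insert x by (simp add: h_carrier)
    have ca: "pm_scale ?c (pm_basis a) \<in> carrier h"
      using M.g.smult_closed[OF _ a, of ?c] by simp
    have S: "?S \<in> carrier h" using insert by blast
    have "act M (pm_scale ?c (pm_basis a)) v = ?c \<odot>\<^bsub>M\<^esub> act M (pm_basis a) v"
      using M.act_smult_left[OF a v, of ?c] by simp
    moreover have "act M (pm_scale ?c (pm_basis a) + ?S) v = act M (pm_scale ?c (pm_basis a)) v \<oplus>\<^bsub>M\<^esub> act M ?S v"
      using M.act_add_left[OF ca S v] by simp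
    moreover have "pm_scale ?c (pm_basis a) + ?S \<in> carrier h"
      using M.g.a_closed[OF ca S] by simp
    ultimately show ?case
      using insert M.act_closed[OF a v] M.act_closed[OF ca v] M.act_closed[OF S v]
      by (simp add: add scale)
  qed
  from this[of "Poly_Mapping.keys x"]
  have "f (act M (lcomb pm_scale pm_basis x) v) = lcomb s (\<lambda>a. f (act M (pm_basis a) v)) x"
    by (simp add: lcomb_def)
  then show ?thesis by (simp add: lcomb_basis)
qed

subsection \<open>The induced module does not vanish\<close>

text \<open>The value of the function attached to \<open>v\<close> at a word is the result of applying the word to \<open>v\<close>. This
  embeds \<open>M\<close> into the coinduced module; letters outside the subalgebra get the dummy action zero.\<close>

definition opM :: "hv_index \<Rightarrow> 'v \<Rightarrow> 'v" where
  "opM a v = (if nonneg_part e a then act M (pm_basis a) v else \<zero>\<^bsub>M\<^esub>)"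

definition cofun :: "'v \<Rightarrow> hv_index list \<Rightarrow> 'v \<Rightarrow>\<^sub>0 complex" where
  "cofun v r = emb (fold opM r v)"

lemma opM_closed: "v \<in> carrier M \<Longrightarrow> opM a v \<in> carrier M"
  by (simp add: opM_def M.act_closed h_basis)

lemma opM_add: "v \<in> carrier M \<Longrightarrow> w \<in> carrier M \<Longrightarrow> opM a (v \<oplus>\<^bsub>M\<^esub> w) = opM a v \<oplus>\<^bsub>M\<^esub> opM a w"
  and opM_smult: "v \<in> carrier M \<Longrightarrow> opM a (c \<odot>\<^bsub>M\<^esub> v) = c \<odot>\<^bsub>M\<^esub> opM a v"
  by (simp_all add: opM_def M.act_add_right M.act_smult_right h_basis M.V.smult_r_null)

lemma fold_opM_closed: "v \<in> carrier M \<Longrightarrow> fold opM r v \<in> carrier M"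
  by (induction r arbitrary: v) (simp_all add: opM_closed)

lemma fold_opM_add: "v \<in> carrier M \<Longrightarrow> w \<in> carrier M \<Longrightarrow> fold opM r (v \<oplus>\<^bsub>M\<^esub> w) = fold opM r v \<oplus>\<^bsub>M\<^esub> fold opM r w"
  by (induction r arbitrary: v w) (simp_all add: opM_add opM_closed)

lemma fold_opM_smult: "v \<in> carrier M \<Longrightarrow> fold opM r (c \<odot>\<^bsub>M\<^esub> v) = c \<odot>\<^bsub>M\<^esub> fold opM r v"
  by (induction r arbitrary: v) (simp_all add: opM_smult opM_closed)

lemma cofun_add: "v \<in> carrier M \<Longrightarrow> w \<in> carrier M \<Longrightarrow> cofun (v \<oplus>\<^bsub>M\<^esub> w) = cofun v + cofun w"
  by (rule ext) (simp add: cofun_def fold_opM_add fold_opM_closed emb)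

lemma cofun_smult: "v \<in> carrier M \<Longrightarrow> cofun (c \<odot>\<^bsub>M\<^esub> v) = fscale pm_scale c (cofun v)"
  by (rule ext) (simp add: cofun_def fold_opM_smult fold_opM_closed emb)

lemma cofun_coherent: "v \<in> carrier M \<Longrightarrow> pm.coherent e (cofun v)"
  unfolding pm.coherent_def
proof (intro allI impI)
  fix r s z z' assume v: "v \<in> carrier M" and z: "nonneg_part e z" "nonneg_part e z'"
  let ?w = "fold opM r v" and ?f = "\<lambda>u. emb (fold opM s u)"
  have w: "?w \<in> carrier M" by (rule fold_opM_closed[OF v])
  note c = M.act_closed[OF h_basis]
  have f: "?f (u \<oplus>\<^bsub>M\<^esub> u') = ?f u + ?f u'" "?f (c \<odot>\<^bsub>M\<^esub> u) = pm_scale c (?f u)"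
    if "u \<in> carrier M" "u' \<in> carrier M" for u u' c
    using that by (simp_all add: fold_opM_add fold_opM_smult fold_opM_closed emb)
  have fd: "?f (u \<ominus>\<^bsub>M\<^esub> u') = ?f u - ?f u'" if u: "u \<in> carrier M" "u' \<in> carrier M" for u u'
  proof -
    have "(u \<ominus>\<^bsub>M\<^esub> u') \<oplus>\<^bsub>M\<^esub> u' = u"
      using u by (simp add: M.V.minus_eq M.V.add.m_assoc M.V.l_neg)
    then show ?thesis using f(1)[of "u \<ominus>\<^bsub>M\<^esub> u'" u'] u by (simp add: algebra_simps)
  qed
  have br: "hv_bracket_basis z' z \<in> carrier h"
    using keys_bracket_nonneg[OF z(2,1)] by (simp add: h_carrier)
  have "cofun v (r @ z # z' # s) - cofun v (r @ z' # z # s) =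
      ?f (act M (pm_basis z') (act M (pm_basis z) ?w)) - ?f (act M (pm_basis z) (act M (pm_basis z') ?w))"
    using z by (simp add: cofun_def opM_def)
  also have "\<dots> = ?f (act M (hv_bracket_basis z' z) ?w)"
    using M.act_bracket[OF h_basis[OF z(2)] h_basis[OF z(1)] w] fd c z w by simp
  also have "\<dots> = lcomb pm_scale (\<lambda>a. ?f (act M (pm_basis a) ?w)) (hv_bracket_basis z' z)"
    by (rule act_expand[OF _ f(1) f(2) w br]) (auto intro: pm.cvs_axioms)
  also have "\<dots> = lcomb pm_scale (\<lambda>b. cofun v (r @ b # s)) (hv_bracket_basis z' z)"
    by (rule pm.lcomb_cong) (use keys_bracket_nonneg[OF z(2,1)] in \<open>auto simp: cofun_def opM_def\<close>)
  finally show "cofun v (r @ z # z' # s) - cofun v (r @ z' # z # s) =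
      lcomb pm_scale (\<lambda>b. cofun v (r @ b # s)) (hv_bracket_basis z' z)" .
qed

interpretation co: hv_rep "fscale pm_scale :: complex \<Rightarrow> (hv_index list \<Rightarrow> 'v \<Rightarrow>\<^sub>0 complex) \<Rightarrow> hv_index list \<Rightarrow> 'v \<Rightarrow>\<^sub>0 complex"
  "{\<phi>. pm.coherent e \<phi>}" "pm.cop e"
  by (rule pm.coinduced_rep)

lemma cop_cofun: "nonneg_part e a \<Longrightarrow> pm.cop e a (cofun v) = cofun (act M (pm_basis a) v)"
  by (simp add: pm.cop_nonneg pm.sh_def cofun_def opM_def fun_eq_iff)

lemma ext_cofun: "v \<in> carrier M \<Longrightarrow> x \<in> carrier h \<Longrightarrow> co.ext x (cofun v) = cofun (act M x v)"
proof -
  assume v: "v \<in> carrier M" and x: "x \<in> carrier h"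
  have "cofun (act M x v) = lcomb (fscale pm_scale) (\<lambda>a. cofun (act M (pm_basis a) v)) x"
    by (rule act_expand[OF co.cvs_axioms cofun_add cofun_smult v x])
  also have "\<dots> = co.ext x (cofun v)"
    unfolding co.ext_def by (rule co.lcomb_cong) (use x in \<open>auto simp: cop_cofun h_carrier\<close>)
  finally show ?thesis ..
qed

lemma wact_cofun: "v \<in> carrier M \<Longrightarrow> w \<in> lists (carrier h) \<Longrightarrow> co.wact w (cofun v) = cofun (foldr (act M) w v)"
  by (induction w) (auto simp: ext_cofun wact_carrier)

lemma pact_cofun:
  assumes v: "v \<in> carrier M" and p: "p \<in> carrier (free_alg h)"
  shows "co.pact p (cofun v) = cofun (free_alg_act M p v)"
proof -
  have "cofun (free_alg_act M p v) = lcomb (fscale pm_scale) (\<lambda>w. cofun (foldr (act M) w v)) p"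
    by (rule linear_free_alg_act[OF cofun_add cofun_smult v p])
  also have "\<dots> = co.pact p (cofun v)"
    unfolding co.pact_def
  proof (rule co.lcomb_cong)
    fix w assume "w \<in> Poly_Mapping.keys p"
    then have "w \<in> lists (carrier h)" using p by auto
    then show "cofun (foldr (act M) w v) = co.wact w (cofun v)" using v by (simp only: wact_cofun)
  qed
  finally show ?thesis ..
qed

abbreviation "NI \<equiv> pm.span (induced_rels hv h M)"
abbreviation "X \<equiv> carrier (uea hv) \<times> carrier M"

lemma free_alg_act_closed:
  assumes "v \<in> carrier M" "p \<in> carrier (free_alg h)"
  shows "free_alg_act M p v \<in> carrier M"
proof -
  have "foldr (act M) w v \<in> carrier M" if "w \<in> Poly_Mapping.keys p" for w
    using assms that by (intro wact_carrier) auto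
  then show ?thesis unfolding free_alg_act_def by (intro M.V.finsum_closed) auto
qed

lemma induced_rels_cases:
  assumes "r \<in> induced_rels hv h M"
  obtains (add_left) p q v where "v \<in> carrier M"
      "r = pm_basis (uea_class hv (p + q), v) - pm_basis (uea_class hv p, v) - pm_basis (uea_class hv q, v)"
  | (add_right) p v w where "v \<in> carrier M" "w \<in> carrier M"
      "r = pm_basis (uea_class hv p, v \<oplus>\<^bsub>M\<^esub> w) - pm_basis (uea_class hv p, v) - pm_basis (uea_class hv p, w)"
  | (smult_left) c p v where "v \<in> carrier M"
      "r = pm_basis (uea_class hv (pm_scale c p), v) - pm_scale c (pm_basis (uea_class hv p, v))"
  | (smult_right) c p v where "v \<in> carrier M"
      "r = pm_basis (uea_class hv p, c \<odot>\<^bsub>M\<^esub> v) - pm_scale c (pm_basis (uea_class hv p, v))"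
  | (balanced) p q v where "v \<in> carrier M" "q \<in> carrier (free_alg h)"
      "r = pm_basis (uea_class hv (free_mult p q), v) - pm_basis (uea_class hv p, free_alg_act M q v)"
  using assms unfolding induced_rels_def tensor_rels_def uea_carrier
  by (auto simp: uea_add uea_smult uea_mult simp del: free_alg_sel)

lemma induced_rels_mem:
  "v \<in> carrier M \<Longrightarrow> pm_basis (uea_class hv (p + q), v) - pm_basis (uea_class hv p, v) - pm_basis (uea_class hv q, v) \<in> induced_rels hv h M"
  "v \<in> carrier M \<Longrightarrow> w \<in> carrier M \<Longrightarrow> pm_basis (uea_class hv p, v \<oplus>\<^bsub>M\<^esub> w) - pm_basis (uea_class hv p, v) - pm_basis (uea_class hv p, w) \<in> induced_rels hv h M"
  "v \<in> carrier M \<Longrightarrow> pm_basis (uea_class hv (pm_scale c p), v) - pm_scale c (pm_basis (uea_class hv p, v)) \<in> induced_rels hv h M"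
  "v \<in> carrier M \<Longrightarrow> pm_basis (uea_class hv p, c \<odot>\<^bsub>M\<^esub> v) - pm_scale c (pm_basis (uea_class hv p, v)) \<in> induced_rels hv h M"
  "v \<in> carrier M \<Longrightarrow> q' \<in> carrier (free_alg h) \<Longrightarrow> pm_basis (uea_class hv (free_mult p q'), v) - pm_basis (uea_class hv p, free_alg_act M q' v) \<in> induced_rels hv h M"
  unfolding induced_rels_def tensor_rels_def uea_carrier
  by (simp_all only: uea_add[symmetric] uea_smult[symmetric] uea_mult[symmetric]) blast+

text \<open>Letting \<open>u\<close> act on the function attached to \<open>v\<close> and evaluating at the empty word is balanced and
  bilinear in \<open>(u, v)\<close>, and sends \<open>1 \<otimes> v\<close> to the image of \<open>v\<close> under an embedding of \<open>M\<close>.\<close>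

lemma generator_nonzero:
  assumes v: "v \<in> carrier M" and N: "pm_basis (uea_class hv (pm_basis []), v) \<in> NI"
  shows "v = \<zero>\<^bsub>M\<^esub>"
proof -
  define rep where "rep u = (SOME p. uea_class hv p = u)" for u
  have rep: "co.pact (rep (uea_class hv p)) (cofun v) = co.pact p (cofun v)" if "v \<in> carrier M" for p v
  proof -
    have "uea_class hv (rep (uea_class hv p)) = uea_class hv p"
      unfolding rep_def by (rule someI_ex) blast
    then have "rep (uea_class hv p) - p \<in> UI" by (simp add: uea_class_eq)
    then have "co.pact (rep (uea_class hv p) - p) (cofun v) = 0"
      using cofun_coherent[OF that] by (intro co.pact_ideal) auto
    then show ?thesis by (simp only: co.pact_diff) simp
  qed
  define \<chi> where "\<chi> = lcomb pm_scale (\<lambda>(u, v). co.pact (rep u) (cofun v) [])"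
  have lin: "\<chi> (p + q) = \<chi> p + \<chi> q" "\<chi> (pm_scale c p) = pm_scale c (\<chi> p)" "\<chi> (p - q) = \<chi> p - \<chi> q" for p q c
    by (simp_all add: \<chi>_def pm.lcomb_add pm.lcomb_scale pm.lcomb_diff)
  have \<chi>: "\<chi> (pm_basis (uea_class hv p, v)) = co.pact p (cofun v) []" if "v \<in> carrier M" for p v
    using rep[OF that, of p] by (simp add: \<chi>_def)
  have 1: "\<chi> r = 0" if "r \<in> induced_rels hv h M" for r
    using that
  proof (cases rule: induced_rels_cases)
    case (add_left p q v)
    then show ?thesis by (simp add: lin \<chi> co.pact_add)
  next
    case (add_right p v w)
    have "co.pact p (cofun (v \<oplus>\<^bsub>M\<^esub> w)) = co.pact p (cofun v) + co.pact p (cofun w)"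
      by (simp only: cofun_add[OF add_right(1,2)] co.pact_add)
    then show ?thesis using add_right by (simp add: lin \<chi>)
  next
    case (smult_left c p v)
    then show ?thesis by (simp add: lin \<chi> co.pact_scale)
  next
    case (smult_right c p v)
    have "co.pact p (cofun (c \<odot>\<^bsub>M\<^esub> v)) = fscale pm_scale c (co.pact p (cofun v))"
      by (simp only: cofun_smult[OF smult_right(1)] co.pact_scale)
    then show ?thesis using smult_right by (simp add: lin \<chi>)
  next
    case (balanced p q v)
    then show ?thesis
      by (simp add: lin \<chi> co.pact_fm pact_cofun free_alg_act_closed del: free_alg_sel)
  qed
  have "pm.subspace {r. \<chi> r = 0}"
    by (rule pm.subspaceI) (auto simp: lin \<chi>_def[THEN fun_cong, of 0, unfolded pm.lcomb_zero])
  then have "NI \<subseteq> {r. \<chi> r = 0}" by (intro pm.span_minimal) (auto simp: 1)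
  then have "\<chi> (pm_basis (uea_class hv (pm_basis []), v)) = 0" using N by blast
  then have "emb v = 0" using v by (simp add: \<chi> cofun_def)
  then show ?thesis using emb(3)[OF v] by blast
qed

end

context hv_sub_module
begin

subsection \<open>The induced module as a subspace\<close>

text \<open>A projection along the relations identifies the induced module with the subspace \<open>IC\<close>; in this
  model \<open>gen p v\<close> is the tensor of the class of \<open>p\<close> with \<open>v\<close>.\<close>

definition proj :: "(((hv_elem list \<Rightarrow>\<^sub>0 complex) set \<times> 'v) \<Rightarrow>\<^sub>0 complex) \<Rightarrow>
    (((hv_elem list \<Rightarrow>\<^sub>0 complex) set \<times> 'v) \<Rightarrow>\<^sub>0 complex)" where
  "proj = (SOME \<pi>. Vector_Spaces.linear pm_scale pm_scale \<pi> \<and> (\<forall>x\<in>NI. \<pi> x = 0) \<and> (\<forall>x. x - \<pi> x \<in> NI))"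

lemma proj: "Vector_Spaces.linear pm_scale pm_scale proj" "x \<in> NI \<Longrightarrow> proj x = 0" "x - proj x \<in> NI"
proof -
  have "\<exists>\<pi>. Vector_Spaces.linear pm_scale pm_scale \<pi> \<and> (\<forall>x\<in>NI. \<pi> x = 0) \<and> (\<forall>x. x - \<pi> x \<in> NI)"
    by (rule pm.projection_along[of NI]) (auto intro: pm.subspace_span)
  from someI_ex[OF this, folded proj_def]
  show "Vector_Spaces.linear pm_scale pm_scale proj" "x \<in> NI \<Longrightarrow> proj x = 0" "x - proj x \<in> NI"
    by blast+
qed

interpretation proj: Vector_Spaces.linear pm_scale pm_scale proj by (rule proj(1))

lemma proj_eq: "p - q \<in> NI \<Longrightarrow> proj p = proj q"
  using proj(2)[of "p - q"] by (simp add: proj.diff)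

lemma proj_0_iff: "proj p = 0 \<longleftrightarrow> p \<in> NI"
  using proj(2)[of p] proj(3)[of p] by auto

definition gen :: "(hv_elem list \<Rightarrow>\<^sub>0 complex) \<Rightarrow> 'v \<Rightarrow> (((hv_elem list \<Rightarrow>\<^sub>0 complex) set \<times> 'v) \<Rightarrow>\<^sub>0 complex)" where
  "gen p v = proj (pm_basis (uea_class hv p, v))"

definition iop :: "hv_index \<Rightarrow> (((hv_elem list \<Rightarrow>\<^sub>0 complex) set \<times> 'v) \<Rightarrow>\<^sub>0 complex) \<Rightarrow>
    (((hv_elem list \<Rightarrow>\<^sub>0 complex) set \<times> 'v) \<Rightarrow>\<^sub>0 complex)" where
  "iop a q = proj (left_mult (pm_basis a) q)"

definition IC :: "(((hv_elem list \<Rightarrow>\<^sub>0 complex) set \<times> 'v) \<Rightarrow>\<^sub>0 complex) set" where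
  "IC = proj ` {p. Poly_Mapping.keys p \<subseteq> X}"

lemma gen_add_left: "v \<in> carrier M \<Longrightarrow> gen (p + q) v = gen p v + gen q v"
  and gen_scale_left: "v \<in> carrier M \<Longrightarrow> gen (pm_scale c p) v = pm_scale c (gen p v)"
  and gen_add_right: "v \<in> carrier M \<Longrightarrow> w \<in> carrier M \<Longrightarrow> gen p (v \<oplus>\<^bsub>M\<^esub> w) = gen p v + gen p w"
  and gen_scale_right: "v \<in> carrier M \<Longrightarrow> gen p (c \<odot>\<^bsub>M\<^esub> v) = pm_scale c (gen p v)"
  and gen_balanced: "v \<in> carrier M \<Longrightarrow> q \<in> carrier (free_alg h) \<Longrightarrow> gen (free_mult p q) v = gen p (free_alg_act M q v)"
  using induced_rels_mem[THEN pm.span_base, THEN proj(2)]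
  by (simp_all add: gen_def proj.diff proj.scale eq_diff_eq del: free_alg_sel) (simp_all add: algebra_simps)

lemma gen_ideal: "p - q \<in> UI \<Longrightarrow> gen p v = gen q v"
  by (simp add: gen_def uea_class_eq[THEN iffD2])

lemma gen_lcomb: "v \<in> carrier M \<Longrightarrow> gen (lcomb pm_scale f p) v = lcomb pm_scale (\<lambda>x. gen (f x) v) p"
proof -
  assume v: "v \<in> carrier M"
  have "Vector_Spaces.linear pm_scale pm_scale (\<lambda>p. gen p v)"
    by unfold_locales (simp_all add: gen_add_left[OF v] gen_scale_left[OF v])
  then show ?thesis by (rule linear_lcomb_comp) unfold_locales
qed

lemma left_mult_linear: "Vector_Spaces.linear pm_scale pm_scale (left_mult x)"
  unfolding left_mult_def lin_ext_lcomb by (rule pm.linear_lcomb)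

interpretation lm: Vector_Spaces.linear pm_scale pm_scale "left_mult x" for x
  by (rule left_mult_linear)

lemma left_mult_basis [simp]:
  "left_mult x (pm_basis (uea_class hv p, v)) = pm_basis (uea_class hv (free_mult (pm_basis [x]) p), v)"
  by (simp add: left_mult_def lin_ext_lcomb uea_mult)

lemma left_mult_NI: "n \<in> NI \<Longrightarrow> left_mult x n \<in> NI"
proof -
  have "left_mult x r \<in> induced_rels hv h M" if "r \<in> induced_rels hv h M" for r
    using that
  proof (cases rule: induced_rels_cases)
    case (balanced p q v)
    then show ?thesis
      using induced_rels_mem(5)[of v q "free_mult (pm_basis [x]) p"]
      by (simp add: lm.diff free_mult_assoc del: free_alg_sel)
  qed (use induced_rels_mem in \<open>simp_all add: lm.diff lm.scale free_mult_add free_mult_scale\<close>)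
  then have "NI \<subseteq> {n. left_mult x n \<in> NI}"
    by (intro pm.span_minimal) (auto intro: pm.span_base simp: pm.subspace_def lm.add lm.scale pm.span_add pm.span_scale pm.span_zero)
  then show "n \<in> NI \<Longrightarrow> left_mult x n \<in> NI" by blast
qed

lemma proj_left_mult: "proj (left_mult x (proj p)) = proj (left_mult x p)"
proof (rule proj_eq)
  have "left_mult x (p - proj p) \<in> NI" by (rule left_mult_NI[OF proj(3)])
  then show "left_mult x (proj p) - left_mult x p \<in> NI"
    using pm.span_neg by (fastforce simp: lm.diff)
qed

lemma iop_gen: "iop a (gen p v) = gen (free_mult (pm_basis [pm_basis a]) p) v"
  by (simp add: iop_def gen_def proj_left_mult)

lemma NI_X: "NI \<subseteq> {p. Poly_Mapping.keys p \<subseteq> X}"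
proof (rule pm.span_minimal[OF _ subspace_free])
  note D = pm.subspace_diff[OF subspace_free] and S = pm.subspace_scale[OF subspace_free]
  have b: "pm_basis (uea_class hv p, v) \<in> {p. Poly_Mapping.keys p \<subseteq> X}" if "v \<in> carrier M" for p v
    using that by (simp add: uea_carrier)
  show "induced_rels hv h M \<subseteq> {p. Poly_Mapping.keys p \<subseteq> X}"
  proof
    fix r assume "r \<in> induced_rels hv h M"
    then show "r \<in> {p. Poly_Mapping.keys p \<subseteq> X}"
    proof (cases rule: induced_rels_cases)
      case (balanced p q v)
      then show ?thesis unfolding balanced(3) by (intro D b free_alg_act_closed)
    qed (use b in \<open>simp only:; intro D S b; (assumption | simp)\<close>)+
  qed
qed

lemma IC_span: "IC = pm.span {gen p v |p v. v \<in> carrier M}"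
proof -
  have "IC = pm.span (proj ` pm_basis ` X)"
    unfolding IC_def free_span by (simp add: proj.span_image)
  also have "proj ` pm_basis ` X = {gen p v |p v. v \<in> carrier M}"
    by (auto simp: gen_def uea_carrier image_iff)
  finally show ?thesis .
qed

lemma IC_subspace: "pm.subspace IC" by (simp add: IC_span)

lemma gen_IC: "v \<in> carrier M \<Longrightarrow> gen p v \<in> IC"
  unfolding IC_span by (rule pm.span_base) blast

lemma IC_induct:
  assumes "x \<in> IC" "pm.subspace W" "\<And>p v. v \<in> carrier M \<Longrightarrow> gen p v \<in> W"
  shows "x \<in> W"
  using pm.span_minimal[of "{gen p v |p v. v \<in> carrier M}" W] assms unfolding IC_span by blast

lemma iop_add: "iop a (x + y) = iop a x + iop a y" and iop_scale: "iop a (pm_scale c x) = pm_scale c (iop a x)"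
  by (simp_all add: iop_def lm.add lm.scale proj.add proj.scale)

sublocale ind: hv_rep pm_scale IC iop
proof unfold_locales
  show "pm.subspace IC" by (rule IC_subspace)
  show "iop a x \<in> IC" if x: "x \<in> IC" for a x
  proof -
    have "x \<in> {x. iop a x \<in> IC}"
      by (rule IC_induct[OF x])
        (use IC_subspace in \<open>auto simp: pm.subspace_def iop_add iop_scale iop_gen gen_IC iop_scale[of a 0 0, simplified]\<close>)
    then show ?thesis by simp
  qed
  show "iop a (x + y) = iop a x + iop a y" for a x y by (rule iop_add)
  show "iop a (pm_scale c x) = pm_scale c (iop a x)" for a c x by (rule iop_scale)
  show "iop a (iop b x) - iop b (iop a x) = lcomb pm_scale (\<lambda>d. iop d x) (hv_bracket_basis a b)"
    if x: "x \<in> IC" for a b x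
  proof -
    have "x \<in> {x. iop a (iop b x) - iop b (iop a x) = lcomb pm_scale (\<lambda>d. iop d x) (hv_bracket_basis a b)}"
    proof (rule IC_induct[OF x])
      show "pm.subspace {x. iop a (iop b x) - iop b (iop a x) = lcomb pm_scale (\<lambda>d. iop d x) (hv_bracket_basis a b)}"
        by (rule pm.subspaceI)
          (simp_all add: iop_add iop_scale pm.lcomb_add_fun pm.lcomb_scale_fun pm.scale_right_diff_distrib[symmetric]
            add_diff_add iop_scale[of _ 0 0, simplified])
      fix p v assume v: "v \<in> carrier M"
      let ?a = "pm_basis [pm_basis a, pm_basis b]" and ?b = "pm_basis [pm_basis b, pm_basis a]"
      let ?c = "pm_basis [hv_bracket_basis a b]"
      have "?a - ?b - ?c \<in> uea_rels hv"
        unfolding uea_rels_def hv_sel by (rule UnI2, rule CollectI, rule exI[of _ "pm_basis a"], rule exI[of _ "pm_basis b"]) simp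
      then have 1: "?a - ?b - ?c \<in> UI" using UI_rels by blast
      have "iop a (iop b (gen p v)) - iop b (iop a (gen p v)) = gen (free_mult (?a - ?b) p) v"
        using gen_add_left[OF v, of "free_mult (?a - ?b) p" "free_mult ?b p"]
        by (simp add: iop_gen free_mult_assoc[symmetric] free_mult_diff)
      also have "\<dots> = gen (free_mult ?c p) v"
        by (rule gen_ideal) (use UI_fm(2)[OF 1, of p] in \<open>simp add: free_mult_diff\<close>)
      also have "\<dots> = gen (free_mult (lcomb pm_scale (\<lambda>d. pm_basis [pm_basis d]) (hv_bracket_basis a b)) p) v"
        by (rule gen_ideal) (use UI_fm(2)[OF letter_linear] in \<open>simp add: free_mult_diff\<close>)
      also have "\<dots> = lcomb pm_scale (\<lambda>d. iop d (gen p v)) (hv_bracket_basis a b)"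
        by (simp add: free_mult_lcomb_left gen_lcomb[OF v] iop_gen)
      finally show "gen p v \<in> {x. iop a (iop b x) - iop b (iop a x) = lcomb pm_scale (\<lambda>d. iop d x) (hv_bracket_basis a b)}"
        by simp
    qed
    then show ?thesis by simp
  qed
qed

lemma ext_gen: "v \<in> carrier M \<Longrightarrow> ind.ext x (gen p v) = gen (free_mult (pm_basis [x]) p) v"
proof -
  assume v: "v \<in> carrier M"
  have "ind.ext x (gen p v) = gen (free_mult (lcomb pm_scale (\<lambda>d. pm_basis [pm_basis d]) x) p) v"
    by (simp add: ind.ext_def free_mult_lcomb_left gen_lcomb[OF v] iop_gen)
  also have "\<dots> = gen (free_mult (pm_basis [x]) p) v"
    by (rule gen_ideal[symmetric]) (use UI_fm(2)[OF letter_linear] in \<open>simp add: free_mult_diff\<close>)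
  finally show ?thesis .
qed

lemma ext_proj: "Poly_Mapping.keys p \<subseteq> X \<Longrightarrow> proj (left_mult x p) = ind.ext x (proj p)"
proof -
  assume "Poly_Mapping.keys p \<subseteq> X"
  then have "p \<in> pm.span (pm_basis ` X)" by (rule pm_in_span_basis)
  moreover have "pm.span (pm_basis ` X) \<subseteq> {p. proj (left_mult x p) = ind.ext x (proj p)}"
  proof (rule pm.span_minimal)
    show "pm.subspace {p. proj (left_mult x p) = ind.ext x (proj p)}"
      by (rule pm.subspaceI)
        (simp_all add: lm.add lm.scale lm.zero proj.zero proj.add proj.scale ind.ext_add_right ind.ext_scale_right
          ind.ext_scale_right[of x 0 0, simplified])
    show "pm_basis ` X \<subseteq> {p. proj (left_mult x p) = ind.ext x (proj p)}"
      by (auto simp: uea_carrier) (metis gen_def ext_gen)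
  qed
  ultimately show ?thesis by blast
qed

sublocale ind: quotient_transport pm_scale IC iop X NI left_mult proj
proof (rule quotient_transport.intro[OF ind.hv_rep_axioms], rule quotient_transport_axioms.intro)
  show "Vector_Spaces.linear pm_scale pm_scale proj" by (rule proj(1))
  show "Poly_Mapping.keys (left_mult g p) \<subseteq> X" if "Poly_Mapping.keys p \<subseteq> X" for g p
    unfolding left_mult_def lin_ext_lcomb
    by (rule lcomb_free) (use that in \<open>auto simp: uea_carrier uea_mult\<close>)
qed (simp_all add: NI_X proj_0_iff IC_def lm.add ext_proj)

lemma induced_module_eq: "induced_module hv h M = ind.T"
  by (simp add: induced_module_def Let_def left_mult_def[abs_def])

subsection \<open>Verification of the hypotheses for the induced module\<close>

abbreviation "\<iota> \<equiv> gen (pm_basis [])"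

lemma \<iota>_act: "v \<in> carrier M \<Longrightarrow> nonneg_part e a \<Longrightarrow> iop a (\<iota> v) = \<iota> (act M (pm_basis a) v)"
proof -
  assume v: "v \<in> carrier M" and a: "nonneg_part e a"
  have "pm_basis [pm_basis a] \<in> carrier (free_alg h)" using h_basis[OF a] by simp
  from gen_balanced[OF v this, of "pm_basis []"]
  have "iop a (\<iota> v) = \<iota> (free_alg_act M (pm_basis [pm_basis a]) v)" by (simp add: iop_gen)
  moreover have "free_alg_act M (pm_basis [pm_basis a]) v = act M (pm_basis a) v"
    using M.act_closed[OF h_basis[OF a] v] M.V.smult_one by (simp add: free_alg_act_def)
  ultimately show ?thesis by simp
qed

lemma \<iota>_zero: "\<iota> \<zero>\<^bsub>M\<^esub> = 0"
  using gen_add_right[of "\<zero>\<^bsub>M\<^esub>" "\<zero>\<^bsub>M\<^esub>" "pm_basis []"] by simp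

lemma \<iota>_inj: "v \<in> carrier M \<Longrightarrow> \<iota> v = 0 \<Longrightarrow> v = \<zero>\<^bsub>M\<^esub>"
  using generator_nonzero[of v] by (simp add: gen_def proj_0_iff)

lemma \<iota>_subspace: "pm.subspace (\<iota> ` carrier M)"
proof (rule pm.subspaceI)
  show "0 \<in> \<iota> ` carrier M" by (rule image_eqI[of _ _ "\<zero>\<^bsub>M\<^esub>"]) (simp_all add: \<iota>_zero)
  show "x + y \<in> \<iota> ` carrier M" if xy: "x \<in> \<iota> ` carrier M" "y \<in> \<iota> ` carrier M" for x y
  proof -
    from xy obtain v w where "v \<in> carrier M" "w \<in> carrier M" "x = \<iota> v" "y = \<iota> w" by blast
    then show ?thesis by (intro image_eqI[of _ _ "v \<oplus>\<^bsub>M\<^esub> w"]) (simp_all add: gen_add_right)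
  qed
  show "pm_scale c x \<in> \<iota> ` carrier M" if x: "x \<in> \<iota> ` carrier M" for c x
  proof -
    from x obtain v where "v \<in> carrier M" "x = \<iota> v" by blast
    then show ?thesis by (intro image_eqI[of _ _ "c \<odot>\<^bsub>M\<^esub> v"]) (simp_all add: gen_scale_right)
  qed
qed

lemma \<iota>_generates:
  assumes W: "ind.invariant W" and MW: "\<iota> ` carrier M \<subseteq> W"
  shows "W = IC"
proof -
  have Ws: "pm.subspace W" "W \<subseteq> IC" "\<And>a w. w \<in> W \<Longrightarrow> iop a w \<in> W"
    using W by (auto simp: ind.invariant_def)
  have word: "gen (pm_basis w) v \<in> W" if v: "v \<in> carrier M" for w v
  proof (induction w)
    case Nil
    then show ?case using MW v by blast
  next
    case (Cons x w)
    have "gen (pm_basis (x # w)) v = ind.ext x (gen (pm_basis w) v)"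
      by (simp add: ext_gen[OF v])
    then show ?case using Cons Ws by (simp add: ind.ext_closed)
  qed
  have "gen p v \<in> W" if v: "v \<in> carrier M" for p v
    using gen_lcomb[OF v, of pm_basis p] pm.lcomb_in_subspace[OF Ws(1), of p "\<lambda>w. gen (pm_basis w) v"] word[OF v]
    by (simp add: lcomb_basis)
  then have "IC \<subseteq> W" using IC_induct[OF _ Ws(1)] by blast
  then show ?thesis using Ws(2) by blast
qed

lemma \<iota>_simple:
  assumes irr: "irreducible_lie_module h M" and W: "pm.subspace W" "W \<subseteq> \<iota> ` carrier M" "W \<noteq> {0}"
    and inv: "\<And>a w. nonneg_part e a \<Longrightarrow> w \<in> W \<Longrightarrow> iop a w \<in> W"
  shows "W = \<iota> ` carrier M"
proof -
  let ?K = "{v \<in> carrier M. \<iota> v \<in> W}"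
  have neg: "\<iota> (\<ominus>\<^bsub>M\<^esub> v) = - \<iota> v" if "v \<in> carrier M" for v
    using gen_add_right[of "\<ominus>\<^bsub>M\<^esub> v" v "pm_basis []"] that
    by (simp add: M.V.l_neg \<iota>_zero eq_neg_iff_add_eq_0)
  have "submodule ?K complex_ring M"
    by (rule M.V.submoduleI)
      (use W(1) in \<open>auto simp: \<iota>_zero neg gen_add_right gen_scale_right pm.subspace_0 pm.subspace_neg
        pm.subspace_add pm.subspace_scale\<close>)
  moreover have "act M x v \<in> ?K" if x: "x \<in> carrier h" and v: "v \<in> ?K" for x v
  proof -
    have vM: "v \<in> carrier M" using v by blast
    have "\<iota> (act M x v) = lcomb pm_scale (\<lambda>a. \<iota> (act M (pm_basis a) v)) x"
      by (rule act_expand[OF pm.cvs_axioms gen_add_right gen_scale_right vM x])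
    also have "\<dots> \<in> W"
    proof (rule pm.lcomb_in_subspace[OF W(1)])
      fix a assume "a \<in> Poly_Mapping.keys x"
      then have a: "nonneg_part e a" using x by (simp add: h_carrier)
      have "iop a (\<iota> v) \<in> W" using inv[OF a] v by simp
      then show "\<iota> (act M (pm_basis a) v) \<in> W" by (simp only: \<iota>_act[OF vM a])
    qed
    finally show ?thesis using M.act_closed[OF x vM] by simp
  qed
  ultimately have "lie_submodule h ?K M" by (simp add: lie_submodule_def)
  then have "?K = {\<zero>\<^bsub>M\<^esub>} \<or> ?K = carrier M" using irr by (simp add: irreducible_lie_module_def)
  moreover have img: "\<iota> ` ?K = W" using W(2) by blast
  ultimately show ?thesis using W(3) \<iota>_zero by force
qed

lemma induced_hypotheses:
  assumes irr: "irreducible_lie_module h M"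
    and I0: "\<And>v. v \<in> carrier M \<Longrightarrow> act M (hv_I 0) v = c0 \<odot>\<^bsub>M\<^esub> v"
    and C1: "\<And>v. v \<in> carrier M \<Longrightarrow> act M hv_C1 v = c1 \<odot>\<^bsub>M\<^esub> v"
    and C2: "\<And>v. v \<in> carrier M \<Longrightarrow> act M hv_C2 v = c2 \<odot>\<^bsub>M\<^esub> v"
    and C3: "\<And>v. v \<in> carrier M \<Longrightarrow> act M hv_C3 v = 0 \<odot>\<^bsub>M\<^esub> v"
    and inj: "k \<noteq> 0 \<Longrightarrow> inj_on (act M (hv_I (int k))) (carrier M)"
    and nondeg: "k = 0 \<Longrightarrow> \<forall>n::int. n \<noteq> 0 \<longrightarrow> c0 + (of_int n - 1) * c2 \<noteq> 0"
    and In: "\<And>n v. n > int k \<Longrightarrow> v \<in> carrier M \<Longrightarrow> act M (hv_I n) v = \<zero>\<^bsub>M\<^esub>"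
    and Ln: "\<And>n v. n > int k + int e \<Longrightarrow> v \<in> carrier M \<Longrightarrow> act M (hv_L n) v = \<zero>\<^bsub>M\<^esub>"
  shows "hv_induced pm_scale IC iop (\<iota> ` carrier M) e k c0 c1 c2"
proof (rule hv_induced.intro[OF ind.hv_rep_axioms], rule hv_induced_axioms.intro)
  show "pm.subspace (\<iota> ` carrier M)" by (rule \<iota>_subspace)
  show "\<iota> ` carrier M \<subseteq> IC" using gen_IC by blast
  show "\<iota> ` carrier M \<noteq> {0}"
  proof
    assume a: "\<iota> ` carrier M = {0}"
    have "v = \<zero>\<^bsub>M\<^esub>" if "v \<in> carrier M" for v
      using a that by (intro \<iota>_inj) auto
    then have "carrier M = {\<zero>\<^bsub>M\<^esub>}" by auto
    then show False using irr by (simp add: irreducible_lie_module_def)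
  qed
  show "iop a v \<in> \<iota> ` carrier M" if v: "v \<in> \<iota> ` carrier M" and a: "nonneg_part e a" for v a
  proof -
    from v obtain w where w: "w \<in> carrier M" "v = \<iota> w" by blast
    show ?thesis unfolding w(2) \<iota>_act[OF w(1) a] using M.act_closed[OF h_basis[OF a] w(1)] by blast
  qed
  show "W = \<iota> ` carrier M" if "pm.subspace W" "W \<subseteq> \<iota> ` carrier M" "W \<noteq> {0}"
    "\<And>a w. nonneg_part e a \<Longrightarrow> w \<in> W \<Longrightarrow> iop a w \<in> W" for W
    using that by (rule \<iota>_simple[OF irr])
  show "W = IC" if "ind.invariant W" "\<iota> ` carrier M \<subseteq> W" for W
    using that by (rule \<iota>_generates)
  have e: "iop a (\<iota> w) = pm_scale c (\<iota> w)"
    if "\<And>v. v \<in> carrier M \<Longrightarrow> act M (pm_basis a) v = c \<odot>\<^bsub>M\<^esub> v" "nonneg_part e a" "w \<in> carrier M" for a c w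
    using that by (simp add: \<iota>_act gen_scale_right)
  show "iop (HI 0) v = pm_scale c0 v" "iop HC1 v = pm_scale c1 v" "iop HC2 v = pm_scale c2 v" "iop HC3 v = 0"
    if "v \<in> \<iota> ` carrier M" for v
    using that e[OF I0] e[OF C1] e[OF C2] e[OF C3] by auto
  show "v = 0" if k: "k \<noteq> 0" and v: "v \<in> \<iota> ` carrier M" and z: "iop (HI (int k)) v = 0" for v
  proof -
    from v obtain w where w: "w \<in> carrier M" "v = \<iota> w" by blast
    have a: "nonneg_part e (HI (int k))" by simp
    have "act M (hv_I (int k)) w = \<zero>\<^bsub>M\<^esub>"
      using z \<iota>_act[OF w(1) a] M.act_closed[OF h_basis[OF a] w(1)] by (intro \<iota>_inj) (simp_all add: w(2))
    moreover have "act M (hv_I (int k)) \<zero>\<^bsub>M\<^esub> = \<zero>\<^bsub>M\<^esub>"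
      using M.act_smult_right[OF h_basis[OF a] M.V.zero_closed, of 0]
        M.act_closed[OF h_basis[OF a] M.V.zero_closed] M.V.smult_l_null by simp
    ultimately have "w = \<zero>\<^bsub>M\<^esub>"
      using inj_onD[OF inj[OF k], of w "\<zero>\<^bsub>M\<^esub>"] w(1) by simp
    then show ?thesis by (simp add: w(2) \<iota>_zero)
  qed
  show "c0 + (of_int n - 1) * c2 \<noteq> 0" if "k = 0" "n \<noteq> 0" for n using nondeg that by blast
  show "iop (HI n) v = 0" if n: "n > int k" and v: "v \<in> \<iota> ` carrier M" for n v
  proof -
    from v obtain w where w: "w \<in> carrier M" "v = \<iota> w" by blast
    show ?thesis unfolding w(2) using n by (subst \<iota>_act[OF w(1)]) (simp_all add: In[OF n w(1)] \<iota>_zero)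
  qed
  show "iop (HL n) v = 0" if n: "n > int k + int e" and v: "v \<in> \<iota> ` carrier M" for n v
  proof -
    from v obtain w where w: "w \<in> carrier M" "v = \<iota> w" by blast
    show ?thesis unfolding w(2) using n by (subst \<iota>_act[OF w(1)]) (simp_all add: Ln[OF n w(1)] \<iota>_zero)
  qed
qed

end

section \<open>The tensor products as modules of polynomial functions\<close>

text \<open>A polynomial in one variable that vanishes at all natural numbers has zero coefficients, also when
  these are vectors; this eliminates one variable at a time.\<close>

lemma (in cvs) monomials_independent:
  assumes "finite S" "finite G" "G \<subseteq> (\<Pi>\<^sub>E i\<in>S. UNIV)"
    and "\<And>z :: 'i \<Rightarrow> complex. (\<Sum>\<gamma>\<in>G. (\<Prod>i\<in>S. z i ^ \<gamma> i) *s v \<gamma>) = 0" and "\<gamma> \<in> G"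
  shows "v \<gamma> = 0"
  using assms
proof (induction S arbitrary: G v \<gamma> rule: finite_induct)
  case empty
  then have "G = {\<gamma>}" by auto
  then show ?case using empty(3) by simp
next
  case (insert i S)
  let ?G = "\<lambda>j. {\<gamma> \<in> G. \<gamma> i = j}"
  let ?in = "\<lambda>j z. \<Sum>\<gamma>\<in>?G j. (\<Prod>i\<in>S. z i ^ \<gamma> i) *s v \<gamma>"
  define d where "d = Max ((\<lambda>\<gamma>. \<gamma> i) ` G)"
  have le_d: "\<gamma> i \<le> d" if "\<gamma> \<in> G" for \<gamma> unfolding d_def using insert.prems(1) that by simp
  have inner: "?in j z = 0" if j: "j \<le> d" for j z
  proof -
    have "(\<Sum>j\<le>d. of_nat n ^ j *s ?in j z) = 0" for n
    proof -
      let ?z = "z(i := of_nat n)"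
      have p: "(\<Prod>i\<in>insert i S. ?z i ^ \<gamma> i) = of_nat n ^ \<gamma> i * (\<Prod>i\<in>S. z i ^ \<gamma> i)" for \<gamma>
      proof -
        have "(\<Prod>l\<in>S. ?z l ^ \<gamma> l) = (\<Prod>l\<in>S. z l ^ \<gamma> l)"
          using insert.hyps by (intro prod.cong) auto
        then show ?thesis using insert.hyps by simp
      qed
      have "(\<Sum>j\<le>d. of_nat n ^ j *s ?in j z) = (\<Sum>j\<le>d. \<Sum>\<gamma>\<in>?G j. (\<Prod>i\<in>insert i S. ?z i ^ \<gamma> i) *s v \<gamma>)"
        unfolding scale_sum_right p by (intro sum.cong refl) simp
      also have "\<dots> = (\<Sum>\<gamma>\<in>G. (\<Prod>i\<in>insert i S. ?z i ^ \<gamma> i) *s v \<gamma>)"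
        using insert.prems(1) le_d by (intro sum.group) auto
      also have "\<dots> = 0" by (rule insert.prems(3))
      finally show ?thesis .
    qed
    then have "?in j z \<in> {0}"
      using exp_poly_coeffs[where W = "{0}" and A = "{()}" and lam = "\<lambda>_. 1" and N = "0" and d = "\<lambda>_. d"
          and G = "\<lambda>_ j. ?in j z" and i = "()" and j = j] j by simp
    then show ?thesis by simp
  qed
  define j where "j = \<gamma> i"
  let ?r = "\<lambda>\<gamma>. \<gamma>(i := undefined)"
  have G: "\<gamma> \<in> (\<Pi>\<^sub>E i\<in>insert i S. UNIV)" if "\<gamma> \<in> G" for \<gamma> using insert.prems(2) that by blast
  have bk: "(?r \<gamma>)(i := j) = \<gamma>" if "\<gamma> \<in> ?G j" for \<gamma> using that by auto
  have inj: "inj_on ?r (?G j)" by (rule inj_on_inverseI[of _ "\<lambda>\<gamma>. \<gamma>(i := j)"]) (rule bk)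
  have "(\<Sum>\<gamma>\<in>?r ` ?G j. (\<Prod>i\<in>S. z i ^ \<gamma> i) *s v (\<gamma>(i := j))) = ?in j z" for z
    unfolding sum.reindex[OF inj] o_def
  proof (intro sum.cong refl)
    fix \<gamma> assume \<gamma>: "\<gamma> \<in> ?G j"
    have "(\<Prod>l\<in>S. z l ^ (?r \<gamma>) l) = (\<Prod>l\<in>S. z l ^ \<gamma> l)" using insert.hyps by (intro prod.cong) auto
    then show "(\<Prod>l\<in>S. z l ^ (?r \<gamma>) l) *s v ((?r \<gamma>)(i := j)) = (\<Prod>l\<in>S. z l ^ \<gamma> l) *s v \<gamma>"
      by (simp only: bk[OF \<gamma>])
  qed
  then have *: "(\<Sum>\<gamma>\<in>?r ` ?G j. (\<Prod>i\<in>S. z i ^ \<gamma> i) *s v (\<gamma>(i := j))) = 0" for z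
    using inner[of j z] le_d[OF insert.prems(4)] by (simp add: j_def)
  have "v ((?r \<gamma>)(i := j)) = 0"
  proof (rule insert.IH[of "?r ` ?G j" "\<lambda>\<gamma>. v (\<gamma>(i := j))", OF _ _ *])
    show "finite (?r ` ?G j)" using insert.prems(1) by simp
    show "?r ` ?G j \<subseteq> (\<Pi>\<^sub>E i\<in>S. UNIV)" using G insert.hyps by (fastforce simp: PiE_iff extensional_def)
    show "?r \<gamma> \<in> ?r ` ?G j" using insert.prems(4) by (auto simp: j_def)
  qed
  then show ?case using bk[of \<gamma>] insert.prems(4) by (simp add: j_def)
qed

lemma (in hv_tensor) pf_upd:
  "i \<in> P \<Longrightarrow> finite P \<Longrightarrow> pf P (q(i := p)) c = (\<lambda>z. (poly p (z i) * (\<Prod>j\<in>P - {i}. poly (q j) (z j))) *s c)"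
  unfolding pf_def
  by (rule ext, subst prod.remove[of _ i]) (auto intro!: arg_cong2[where f = scale] prod.cong)

lemma (in hv_tensor) pf_restrict: "pf S (restrict q S) c = pf S q c"
  unfolding pf_def by (intro ext arg_cong2[where f = scale] prod.cong) auto

lemma Omega_sel [simp]:
  "carrier (Omega l a b) = UNIV" "f \<oplus>\<^bsub>Omega l a b\<^esub> g = f + g" "c \<odot>\<^bsub>Omega l a b\<^esub> f = Polynomial.smult c f"
  "act (Omega l a b) x f = (\<Sum>i\<in>Poly_Mapping.keys x. Polynomial.smult (Poly_Mapping.lookup x i) (omega_basis l a b i f))"
  by (simp_all add: Omega_def)

text \<open>The one-dimensional trivial module: with \<open>C = \<complex>\<close> the functions of the previous section describe
  the tensor product of the polynomial modules alone.\<close>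

definition zero_op :: "hv_index \<Rightarrow> complex \<Rightarrow> complex" where "zero_op a v = 0"

lemma trivial_rep: "hv_rep ((*) :: complex \<Rightarrow> complex \<Rightarrow> complex) UNIV zero_op"
proof -
  interpret cvs "(*) :: complex \<Rightarrow> complex \<Rightarrow> complex" by (rule cvs_times)
  show ?thesis by unfold_locales (simp_all add: zero_op_def)
qed

locale omega_tensor =
  fixes S :: "nat set" and lam al be :: "nat \<Rightarrow> complex"
  assumes fin_S: "finite S" and lam_nonzero: "i \<in> S \<Longrightarrow> lam i \<noteq> 0"
begin

sublocale cx: hv_tensor "(*) :: complex \<Rightarrow> complex \<Rightarrow> complex" UNIV zero_op S lam al be
  by (intro hv_tensor.intro trivial_rep hv_tensor_axioms.intro fin_S lam_nonzero)

declare cx.scale_scale [simp del]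

abbreviation "OM \<equiv> \<lambda>i. Omega (lam i) (al i) (be i)"
abbreviation "XA \<equiv> \<Pi>\<^sub>E i\<in>S. (UNIV :: complex poly set)"
abbreviation "NA \<equiv> pm.span (family_tensor_rels S OM)"
abbreviation "\<Gamma> \<equiv> \<Pi>\<^sub>E i\<in>S. (UNIV :: nat set)"

definition phiA :: "((nat \<Rightarrow> complex poly) \<Rightarrow>\<^sub>0 complex) \<Rightarrow> (nat \<Rightarrow> complex) \<Rightarrow> complex" where
  "phiA = lcomb (fscale (*)) (\<lambda>f. cx.pf S f 1)"

definition actA :: "hv_elem \<Rightarrow> ((nat \<Rightarrow> complex poly) \<Rightarrow>\<^sub>0 complex) \<Rightarrow> ((nat \<Rightarrow> complex poly) \<Rightarrow>\<^sub>0 complex)" where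
  "actA x = lin_ext (\<lambda>f. \<Sum>i\<in>S. pm_basis (f(i := act (OM i) x (f i))))"

definition monoA :: "(nat \<Rightarrow> nat) \<Rightarrow> nat \<Rightarrow> complex poly" where
  "monoA \<gamma> = restrict (\<lambda>i. monom 1 (\<gamma> i)) S"

lemma phiA_linear: "Vector_Spaces.linear pm_scale (fscale (*)) phiA"
  unfolding phiA_def by (rule cx.F.linear_lcomb)

interpretation phiA: Vector_Spaces.linear pm_scale "fscale (*)" phiA by (rule phiA_linear)

lemma phiA_basis [simp]: "phiA (pm_basis f) = cx.pf S f 1"
proof -
  have "fscale (*) 1 g = g" for g :: "(nat \<Rightarrow> complex) \<Rightarrow> complex" by (simp add: fun_eq_iff)
  then show ?thesis unfolding phiA_def cx.F.lcomb_single by simp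
qed

lemma monoA_pf: "cx.pf S (monoA \<gamma>) 1 = (\<lambda>z. \<Prod>i\<in>S. z i ^ \<gamma> i)"
  unfolding monoA_def cx.pf_restrict by (simp add: cx.pf_def poly_monom)

lemma monoA_XA: "monoA \<gamma> \<in> XA" by (simp add: monoA_def)

lemma restrict_UNIV_XA: "restrict q S \<in> XA"
  by (simp add: PiE_iff)

lemma family_rels:
  assumes "i \<in> S" "f \<in> XA"
  shows "pm_basis (f(i := v + v')) - pm_basis (f(i := v)) - pm_basis (f(i := v')) \<in> NA"
    "pm_basis (f(i := Polynomial.smult c v)) - pm_scale c (pm_basis (f(i := v))) \<in> NA"
proof -
  have "pm_basis (f(i := v \<oplus>\<^bsub>OM i\<^esub> v')) - pm_basis (f(i := v)) - pm_basis (f(i := v')) \<in> family_tensor_rels S OM"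
    unfolding family_tensor_rels_def using assms by (intro UnI1 CollectI exI[of _ f] exI[of _ i] exI[of _ v] exI[of _ v']) simp
  then show "pm_basis (f(i := v + v')) - pm_basis (f(i := v)) - pm_basis (f(i := v')) \<in> NA"
    by (intro pm.span_base) simp
  have "pm_basis (f(i := c \<odot>\<^bsub>OM i\<^esub> v)) - pm_scale c (pm_basis (f(i := v))) \<in> family_tensor_rels S OM"
    unfolding family_tensor_rels_def using assms by (intro UnI2 CollectI exI[of _ f] exI[of _ i] exI[of _ v] exI[of _ c]) simp
  then show "pm_basis (f(i := Polynomial.smult c v)) - pm_scale c (pm_basis (f(i := v))) \<in> NA"
    by (intro pm.span_base) simp
qed

lemma phiA_NA: "p \<in> NA \<Longrightarrow> phiA p = 0"
proof -
  have "phiA r = 0" if "r \<in> family_tensor_rels S OM" for r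
    using that unfolding family_tensor_rels_def Omega_sel
  proof (elim UnE CollectE exE conjE; hypsubst)
    fix f i v v' assume i: "i \<in> S"
    show "phiA (pm_basis (f(i := v + v')) - pm_basis (f(i := v)) - pm_basis (f(i := v'))) = 0"
      unfolding phiA.diff phiA_basis cx.pf_upd[OF i fin_S] by (rule ext) (simp add: distrib_right)
  next
    fix f i c v assume i: "i \<in> S"
    show "phiA (pm_basis (f(i := Polynomial.smult c v)) - pm_scale c (pm_basis (f(i := v)))) = 0"
      unfolding phiA.diff phiA.scale phiA_basis cx.pf_upd[OF i fin_S] by (rule ext) simp
  qed
  moreover have "pm.subspace {p. phiA p = 0}"
    by (rule pm.subspaceI) (simp_all only: mem_Collect_eq phiA.add phiA.scale phiA.zero add_0 cx.F.scale_zero_right)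
  ultimately have "NA \<subseteq> {p. phiA p = 0}" by (intro pm.span_minimal) auto
  then show "p \<in> NA \<Longrightarrow> phiA p = 0" by blast
qed

lemma XA_upd: "f \<in> XA \<Longrightarrow> i \<in> S \<Longrightarrow> f(i := p) \<in> XA"
  by (auto simp: PiE_iff extensional_def)

lemma NA_XA: "NA \<subseteq> {p. Poly_Mapping.keys p \<subseteq> XA}"
proof (rule pm.span_minimal[OF _ subspace_free])
  show "family_tensor_rels S OM \<subseteq> {p. Poly_Mapping.keys p \<subseteq> XA}"
    unfolding family_tensor_rels_def Omega_sel
  proof (intro Un_least subsetI; elim CollectE exE conjE; hypsubst)
    have b: "pm_basis (f(i := v)) \<in> {p. Poly_Mapping.keys p \<subseteq> XA}" if "i \<in> S" "f \<in> XA" for f i v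
      using XA_upd[OF that(2,1), of v] by simp
    show "pm_basis (f(i := v + v')) - pm_basis (f(i := v)) - pm_basis (f(i := v')) \<in> {p. Poly_Mapping.keys p \<subseteq> XA}"
      if "i \<in> S" "f \<in> XA" for f i v v'
      by (rule pm.subspace_diff[OF subspace_free pm.subspace_diff[OF subspace_free b b] b]) (fact that)+
    show "pm_basis (f(i := Polynomial.smult c v)) - pm_scale c (pm_basis (f(i := v))) \<in> {p. Poly_Mapping.keys p \<subseteq> XA}"
      if "i \<in> S" "f \<in> XA" for f i c v
      by (rule pm.subspace_diff[OF subspace_free b pm.subspace_scale[OF subspace_free b]]) (fact that)+
  qed
qed

text \<open>Expanding one factor after another, the tensors of monomials span.\<close>

lemma monomials_span:
  assumes K: "pm.subspace K" and NK: "NA \<subseteq> K" and mono: "\<And>\<gamma>. \<gamma> \<in> \<Gamma> \<Longrightarrow> pm_basis (monoA \<gamma>) \<in> K"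
  shows "{p. Poly_Mapping.keys p \<subseteq> XA} \<subseteq> K"
proof -
  have 1: "pm_basis f \<in> K" if "finite P" "P \<subseteq> S" "f \<in> XA" "\<forall>i\<in>S - P. \<exists>n. f i = monom 1 n" for P f
    using that
  proof (induction P arbitrary: f rule: finite_induct)
    case empty
    then have "\<forall>i\<in>S. \<exists>n. f i = monom 1 n" by simp
    from bchoice[OF this] obtain n where n: "\<And>i. i \<in> S \<Longrightarrow> f i = monom 1 (n i)" by blast
    have "f = monoA (restrict n S)"
      using empty(2) n by (auto simp: monoA_def fun_eq_iff PiE_iff extensional_def restrict_def)
    then show ?case using mono[of "restrict n S"] by simp
  next
    case (insert i P)
    have i: "i \<in> S" using insert.prems by blast
    have add: "pm_basis (f(i := v + v')) \<in> K" if "pm_basis (f(i := v)) \<in> K" "pm_basis (f(i := v')) \<in> K" for v v'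
    proof -
      have "pm_basis (f(i := v + v')) - pm_basis (f(i := v)) - pm_basis (f(i := v')) \<in> K"
        using family_rels(1)[OF i insert.prems(2)] NK by blast
      from pm.subspace_add[OF K pm.subspace_add[OF K this that(2)] that(1)] show ?thesis by simp
    qed
    have scale: "pm_basis (f(i := Polynomial.smult c v)) \<in> K" if "pm_basis (f(i := v)) \<in> K" for c v
    proof -
      have "pm_basis (f(i := Polynomial.smult c v)) - pm_scale c (pm_basis (f(i := v))) \<in> K"
        using family_rels(2)[OF i insert.prems(2)] NK by blast
      from pm.subspace_add[OF K this pm.subspace_scale[OF K that, of c]] show ?thesis by simp
    qed
    have m: "pm_basis (f(i := monom 1 n)) \<in> K" for n
      by (rule insert.IH) (use insert.prems XA_upd i in auto)
    have m': "pm_basis (f(i := monom c n)) \<in> K" for c n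
      using scale[OF m[of n], of c] by (simp add: smult_monom)
    have zero: "pm_basis (f(i := 0)) \<in> K" using m'[of 0 0] by (simp only: monom_0 pCons_0_0)
    have "pm_basis (f(i := (\<Sum>n\<in>A. monom (c n) n))) \<in> K" if "finite A" for A c
      using that
    proof (induction A rule: finite_induct)
      case (insert n A)
      show ?case unfolding sum.insert[OF insert(1,2)] by (rule add[OF m' insert(3)])
    qed (simp only: sum.empty zero)
    from this[of "{..degree (f i)}" "coeff (f i)"] show ?case
      by (simp add: poly_as_sum_of_monoms)
  qed
  have "pm_basis ` XA \<subseteq> K" using 1[OF fin_S order_refl] by auto
  then show ?thesis unfolding free_span by (intro pm.span_minimal K)
qed

lemma inj_monoA: "inj_on monoA \<Gamma>"
proof (rule inj_onI)
  fix \<gamma> \<gamma>' assume g: "\<gamma> \<in> \<Gamma>" "\<gamma>' \<in> \<Gamma>" "monoA \<gamma> = monoA \<gamma>'"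
  have "\<gamma> i = \<gamma>' i" if "i \<in> S" for i
    using fun_cong[OF g(3), of i] that by (simp add: monoA_def monom_eq_iff')
  then show "\<gamma> = \<gamma>'" using g by (intro PiE_ext) auto
qed

text \<open>Modulo the relations an element is a combination of tensors of monomials, and the corresponding
  monomial functions are independent.\<close>

lemma phiA_kernel:
  assumes p: "Poly_Mapping.keys p \<subseteq> XA"
  shows "phiA p = 0 \<longleftrightarrow> p \<in> NA"
proof
  assume 0: "phiA p = 0"
  let ?B = "pm.span (pm_basis ` monoA ` \<Gamma>)"
  have "{p. Poly_Mapping.keys p \<subseteq> XA} \<subseteq> {x + y |x y. x \<in> NA \<and> y \<in> ?B}"
  proof (rule monomials_span)
    show "pm.subspace {x + y |x y. x \<in> NA \<and> y \<in> ?B}" by (intro pm.subspace_sums pm.subspace_span)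
    show "NA \<subseteq> {x + y |x y. x \<in> NA \<and> y \<in> ?B}"
    proof
      fix x assume "x \<in> NA"
      then show "x \<in> {x + y |x y. x \<in> NA \<and> y \<in> ?B}"
        by (intro CollectI exI[of _ x] exI[of _ 0]) (simp add: pm.span_zero)
    qed
    fix \<gamma> assume "\<gamma> \<in> \<Gamma>"
    then have "pm_basis (monoA \<gamma>) \<in> ?B" by (intro pm.span_base) blast
    then show "pm_basis (monoA \<gamma>) \<in> {x + y |x y. x \<in> NA \<and> y \<in> ?B}"
      by (intro CollectI exI[of _ 0] exI[of _ "pm_basis (monoA \<gamma>)"]) (simp add: pm.span_zero)
  qed
  then have "p \<in> {x + y |x y. x \<in> NA \<and> y \<in> ?B}" by (rule subsetD) (simp only: mem_Collect_eq p)
  then obtain x y where xy: "x \<in> NA" "y \<in> ?B" "p = x + y" by (elim CollectE exE conjE)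
  then have y0: "phiA y = 0" using 0 phiA_NA[OF xy(1)] by (simp add: phiA.add)
  have keys: "Poly_Mapping.keys y \<subseteq> monoA ` \<Gamma>" using xy(2) unfolding free_span[symmetric] by blast
  let ?G = "{\<gamma> \<in> \<Gamma>. monoA \<gamma> \<in> Poly_Mapping.keys y}"
  have inj: "inj_on monoA ?G" using inj_monoA by (rule inj_on_subset) blast
  have img: "monoA ` ?G = Poly_Mapping.keys y" using keys by blast
  have fin: "finite ?G" by (rule finite_imageD[OF _ inj]) (simp only: img finite_keys)
  have "(\<Sum>\<gamma>\<in>?G. (\<Prod>i\<in>S. z i ^ \<gamma> i) * Poly_Mapping.lookup y (monoA \<gamma>)) = phiA y z" for z
  proof -
    have "phiA y z = (\<Sum>f\<in>monoA ` ?G. Poly_Mapping.lookup y f * cx.pf S f 1 z)"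
      unfolding phiA_def lcomb_def img by simp
    also have "\<dots> = (\<Sum>\<gamma>\<in>?G. (\<Prod>i\<in>S. z i ^ \<gamma> i) * Poly_Mapping.lookup y (monoA \<gamma>))"
      unfolding sum.reindex[OF inj] o_def monoA_pf by (simp add: mult.commute)
    finally show ?thesis ..
  qed
  then have s0: "(\<Sum>\<gamma>\<in>?G. (\<Prod>i\<in>S. z i ^ \<gamma> i) * Poly_Mapping.lookup y (monoA \<gamma>)) = 0" for z
    by (simp add: y0)
  have "Poly_Mapping.lookup y (monoA \<gamma>) = 0" if "\<gamma> \<in> ?G" for \<gamma>
    by (rule cx.monomials_independent[OF fin_S fin _ s0 that]) blast
  then have G_empty: "?G = {}" unfolding in_keys_iff by blast
  then have "Poly_Mapping.keys y = {}" using img unfolding G_empty by simp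
  then have "Poly_Mapping.lookup y f = 0" for f by (metis empty_iff in_keys_iff)
  then have "y = 0" by (intro poly_mapping_eqI) simp
  then show "p \<in> NA" using xy by simp
qed (rule phiA_NA)

lemma phiA_image: "phiA ` {p. Poly_Mapping.keys p \<subseteq> XA} = cx.TP S"
proof -
  have "phiA ` {p. Poly_Mapping.keys p \<subseteq> XA} = cx.F.span (phiA ` pm_basis ` XA)"
    unfolding free_span by (rule phiA.span_image[symmetric])
  also have "phiA ` pm_basis ` XA = (\<lambda>f. cx.pf S f 1) ` XA" by (simp only: image_image phiA_basis)
  also have "cx.F.span \<dots> = cx.TP S"
  proof
    show "cx.F.span ((\<lambda>f. cx.pf S f 1) ` XA) \<subseteq> cx.TP S"
      by (rule cx.F.span_minimal[OF _ cx.TP_subspace]) (use cx.pf_TP in auto)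
    show "cx.TP S \<subseteq> cx.F.span ((\<lambda>f. cx.pf S f 1) ` XA)"
    proof
      fix f assume "f \<in> cx.TP S"
      then show "f \<in> cx.F.span ((\<lambda>f. cx.pf S f 1) ` XA)"
      proof (rule cx.TP_induct[OF _ cx.F.subspace_span])
        fix q and c :: complex
        have "cx.pf S q c = fscale (*) c (cx.pf S (restrict q S) 1)"
          unfolding cx.pf_restrict by (simp add: cx.pf_def fun_eq_iff)
        then show "cx.pf S q c \<in> cx.F.span ((\<lambda>f. cx.pf S f 1) ` XA)"
          by (simp only:) (intro cx.F.span_scale cx.F.span_base image_eqI[OF refl] restrict_UNIV_XA)
      qed
    qed
  qed
  finally show ?thesis .
qed

lemma pf_act: "i \<in> S \<Longrightarrow> cx.pf S (f(i := act (OM i) x p)) 1 =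
    lcomb (fscale (*)) (\<lambda>a. cx.pf S (f(i := omega_basis (lam i) (al i) (be i) a p)) 1) x"
  by (rule ext) (simp add: cx.pf_upd fin_S cx.F_lcomb_apply lcomb_def poly_sum sum_distrib_right sum_distrib_left mult_ac)

lemma actA_linear: "Vector_Spaces.linear pm_scale pm_scale (actA x)"
  unfolding actA_def lin_ext_lcomb by (rule pm.linear_lcomb)

interpretation actA: Vector_Spaces.linear pm_scale pm_scale "actA x" for x by (rule actA_linear)

lemma actA_basis: "actA x (pm_basis f) = (\<Sum>i\<in>S. pm_basis (f(i := act (OM i) x (f i))))"
  by (simp add: actA_def lin_ext_lcomb)

lemma phiA_actA: "phiA (actA x p) = cx.T.ext x (phiA p)"
proof -
  have 1: "phiA (actA x (pm_basis f)) = cx.T.ext x (phiA (pm_basis f))" for f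
  proof -
    have "phiA (actA x (pm_basis f)) = (\<Sum>i\<in>S. lcomb (fscale (*))
        (\<lambda>a. cx.pf S (f(i := omega_basis (lam i) (al i) (be i) a (f i))) 1) x)"
      unfolding actA_basis phiA.sum phiA_basis by (intro sum.cong refl pf_act)
    also have "\<dots> = lcomb (fscale (*)) (\<lambda>a. \<Sum>i\<in>S. cx.pf S (f(i := omega_basis (lam i) (al i) (be i) a (f i))) 1) x"
      unfolding lcomb_def by (subst sum.swap) (simp only: cx.F.scale_sum_right)
    also have "\<dots> = cx.T.ext x (phiA (pm_basis f))"
    proof -
      have "cx.pf S f (zero_op a 1) = 0" for a by (simp add: cx.pf_def fun_eq_iff zero_op_def)
      then show ?thesis unfolding cx.T.ext_def phiA_basis cx.tact_pf by simp
    qed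
    finally show ?thesis .
  qed
  have "pm.subspace {p. phiA (actA x p) = cx.T.ext x (phiA p)}"
    using cx.T.ext_scale_right[of x 0 0]
    by (intro pm.subspaceI)
      (simp_all only: mem_Collect_eq actA.add actA.scale actA.zero phiA.add phiA.scale phiA.zero
        cx.T.ext_add_right cx.T.ext_scale_right cx.F.scale_zero_left)
  then have "pm.span (pm_basis ` UNIV) \<subseteq> {p. phiA (actA x p) = cx.T.ext x (phiA p)}"
    by (intro pm.span_minimal) (use 1 in auto)
  then show ?thesis using pm_in_span_basis[of p UNIV] by blast
qed

sublocale A: quotient_transport "fscale (*) :: complex \<Rightarrow> ((nat \<Rightarrow> complex) \<Rightarrow> complex) \<Rightarrow> (nat \<Rightarrow> complex) \<Rightarrow> complex"
  "cx.TP S" cx.tact XA NA actA phiA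
proof (rule quotient_transport.intro[OF cx.T.hv_rep_axioms], rule quotient_transport_axioms.intro)
  show "Vector_Spaces.linear pm_scale (fscale (*)) phiA" by (rule phiA_linear)
  show "Poly_Mapping.keys (actA g p) \<subseteq> XA" if "Poly_Mapping.keys p \<subseteq> XA" for g p
    unfolding actA_def lin_ext_lcomb
  proof (rule lcomb_free)
    fix f assume "f \<in> Poly_Mapping.keys p"
    then have f: "f \<in> XA" using that by blast
    have "(\<Sum>i\<in>S. pm_basis (f(i := act (OM i) g (f i)))) \<in> {p. Poly_Mapping.keys p \<subseteq> XA}"
      using XA_upd[OF f] by (intro pm.subspace_sum[OF subspace_free]) (simp del: Omega_sel)
    then show "Poly_Mapping.keys (\<Sum>i\<in>S. pm_basis (f(i := act (OM i) g (f i)))) \<subseteq> XA" by simp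
  qed
qed (simp_all only: NA_XA phiA_kernel phiA_image actA.add phiA_actA)

lemma family_eq: "lie_tensor_family S OM = A.T"
proof -
  have "(\<lambda>i\<in>S. carrier (OM i)) = (\<lambda>i\<in>S. UNIV)" by simp
  then show ?thesis by (simp add: lie_tensor_family_def Let_def actA_def[abs_def] del: Omega_sel(2-))
qed

end

section \<open>The full tensor product\<close>

locale tensor_transport =
  omega_tensor S lam al be + hv_tensor scale C op S lam al be + W: hv_transport scale C op W \<psi>
  for scale :: "complex \<Rightarrow> 'e::ab_group_add \<Rightarrow> 'e" (infixr "*s" 75) and C op
    and S :: "nat set" and lam al be :: "nat \<Rightarrow> complex"
    and W :: "(hv_elem, 'w) lie_module" and \<psi> :: "'w \<Rightarrow> 'e"
begin

abbreviation "XT \<equiv> carrier A.T \<times> carrier W"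
abbreviation "NT \<equiv> pm.span (tensor_rels A.T W)"

definition eT :: "((nat \<Rightarrow> complex poly) \<Rightarrow>\<^sub>0 complex) set \<times> 'w \<Rightarrow> (nat \<Rightarrow> complex) \<Rightarrow> 'e" where
  "eT = (\<lambda>(a, w) z. A.Phi a z *s \<psi> w)"

definition phiT :: "((((nat \<Rightarrow> complex poly) \<Rightarrow>\<^sub>0 complex) set \<times> 'w) \<Rightarrow>\<^sub>0 complex) \<Rightarrow> (nat \<Rightarrow> complex) \<Rightarrow> 'e" where
  "phiT = lcomb (fscale scale) eT"

definition actT :: "hv_elem \<Rightarrow> ((((nat \<Rightarrow> complex poly) \<Rightarrow>\<^sub>0 complex) set \<times> 'w) \<Rightarrow>\<^sub>0 complex) \<Rightarrow>
    ((((nat \<Rightarrow> complex poly) \<Rightarrow>\<^sub>0 complex) set \<times> 'w) \<Rightarrow>\<^sub>0 complex)" where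
  "actT x = lin_ext (\<lambda>(v, w). pm_basis (act A.T x v, w) + pm_basis (v, act W x w))"

lemma phiT_linear: "Vector_Spaces.linear pm_scale (fscale scale) phiT"
  unfolding phiT_def by (rule F.linear_lcomb)

interpretation phiT: Vector_Spaces.linear pm_scale "fscale scale" phiT by (rule phiT_linear)

lemma phiT_basis: "phiT (pm_basis x) = eT x"
proof -
  have "fscale scale 1 g = g" for g :: "(nat \<Rightarrow> complex) \<Rightarrow> 'e" by (simp add: fun_eq_iff)
  then show ?thesis unfolding phiT_def F.lcomb_single by simp
qed

lemma actT_linear: "Vector_Spaces.linear pm_scale pm_scale (actT x)"
  unfolding actT_def lin_ext_lcomb by (rule pm.linear_lcomb)

interpretation actT: Vector_Spaces.linear pm_scale pm_scale "actT x" for x by (rule actT_linear)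

lemma actT_basis: "actT x (pm_basis (v, w)) = pm_basis (act A.T x v, w) + pm_basis (v, act W x w)"
  by (simp add: actT_def lin_ext_lcomb)

lemma rels_cases:
  assumes "r \<in> tensor_rels A.T W"
  obtains (add_left) v v' w where "v \<in> carrier A.T" "v' \<in> carrier A.T" "w \<in> carrier W"
      "r = pm_basis (v \<oplus>\<^bsub>A.T\<^esub> v', w) - pm_basis (v, w) - pm_basis (v', w)"
  | (add_right) v w w' where "v \<in> carrier A.T" "w \<in> carrier W" "w' \<in> carrier W"
      "r = pm_basis (v, w \<oplus>\<^bsub>W\<^esub> w') - pm_basis (v, w) - pm_basis (v, w')"
  | (smult_left) c v w where "v \<in> carrier A.T" "w \<in> carrier W"
      "r = pm_basis (c \<odot>\<^bsub>A.T\<^esub> v, w) - pm_scale c (pm_basis (v, w))"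
  | (smult_right) c v w where "v \<in> carrier A.T" "w \<in> carrier W"
      "r = pm_basis (v, c \<odot>\<^bsub>W\<^esub> w) - pm_scale c (pm_basis (v, w))"
  using assms unfolding tensor_rels_def by (elim UnE CollectE exE conjE)

lemma rels_mem0:
  "v \<in> carrier A.T \<Longrightarrow> v' \<in> carrier A.T \<Longrightarrow> w \<in> carrier W \<Longrightarrow>
    pm_basis (v \<oplus>\<^bsub>A.T\<^esub> v', w) - pm_basis (v, w) - pm_basis (v', w) \<in> tensor_rels A.T W"
  "v \<in> carrier A.T \<Longrightarrow> w \<in> carrier W \<Longrightarrow> w' \<in> carrier W \<Longrightarrow>
    pm_basis (v, w \<oplus>\<^bsub>W\<^esub> w') - pm_basis (v, w) - pm_basis (v, w') \<in> tensor_rels A.T W"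
  "v \<in> carrier A.T \<Longrightarrow> w \<in> carrier W \<Longrightarrow> pm_basis (c \<odot>\<^bsub>A.T\<^esub> v, w) - pm_scale c (pm_basis (v, w)) \<in> tensor_rels A.T W"
  "v \<in> carrier A.T \<Longrightarrow> w \<in> carrier W \<Longrightarrow> pm_basis (v, c \<odot>\<^bsub>W\<^esub> w) - pm_scale c (pm_basis (v, w)) \<in> tensor_rels A.T W"
  unfolding tensor_rels_def by blast+

lemmas rels_mem = rels_mem0[THEN pm.span_base]

lemma phiT_NT: "p \<in> NT \<Longrightarrow> phiT p = 0"
proof -
  have "phiT r = 0" if "r \<in> tensor_rels A.T W" for r
    using that
  proof (cases rule: rels_cases)
    case (add_left v v' w)
    show ?thesis unfolding add_left(4) phiT.diff phiT_basis
      by (rule ext) (simp only: eT_def case_prod_conv A.add_T(2)[OF add_left(1,2)] minus_apply plus_fun_apply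
          scale_left_distrib zero_fun_apply add_diff_cancel_left' diff_self)
  next
    case (add_right v w w')
    show ?thesis unfolding add_right(4) phiT.diff phiT_basis
      by (rule ext) (simp only: eT_def case_prod_conv W.add_T(2)[OF add_right(2,3)] minus_apply
          scale_right_distrib zero_fun_apply add_diff_cancel_left' diff_self)
  next
    case (smult_left c v w)
    show ?thesis unfolding smult_left(3) phiT.diff phiT.scale phiT_basis
      by (rule ext) (simp only: eT_def case_prod_conv A.smult_T(2)[OF smult_left(1)] minus_apply fscale_apply
          scale_scale zero_fun_apply diff_self)
  next
    case (smult_right c v w)
    show ?thesis unfolding smult_right(3) phiT.diff phiT.scale phiT_basis
      by (rule ext) (simp only: eT_def case_prod_conv W.smult_T(2)[OF smult_right(2)] minus_apply fscale_apply
          scale_scale mult.commute zero_fun_apply diff_self)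
  qed
  moreover have "pm.subspace {p. phiT p = 0}"
    by (rule pm.subspaceI) (simp_all only: mem_Collect_eq phiT.add phiT.scale phiT.zero add_0 F.scale_zero_right)
  ultimately have "NT \<subseteq> {p. phiT p = 0}" by (intro pm.span_minimal) auto
  then show "p \<in> NT \<Longrightarrow> phiT p = 0" by blast
qed

lemma NT_XT: "NT \<subseteq> {p. Poly_Mapping.keys p \<subseteq> XT}"
proof (rule pm.span_minimal[OF _ subspace_free], rule subsetI)
  have b: "pm_basis (v, w) \<in> {p. Poly_Mapping.keys p \<subseteq> XT}" if "v \<in> carrier A.T" "w \<in> carrier W" for v w
    using that by (simp del: with_act_sel)
  fix r assume "r \<in> tensor_rels A.T W"
  then show "r \<in> {p. Poly_Mapping.keys p \<subseteq> XT}"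
  proof (cases rule: rels_cases)
    case (add_left v v' w)
    show ?thesis unfolding add_left(4)
      by (intro pm.subspace_diff[OF subspace_free] b A.add_T(1) add_left)
  next
    case (add_right v w w')
    show ?thesis unfolding add_right(4)
      by (intro pm.subspace_diff[OF subspace_free] b W.add_T(1) add_right)
  next
    case (smult_left c v w)
    show ?thesis unfolding smult_left(3)
      by (intro pm.subspace_diff[OF subspace_free] pm.subspace_scale[OF subspace_free] b A.smult_T(1) smult_left)
  next
    case (smult_right c v w)
    show ?thesis unfolding smult_right(3)
      by (intro pm.subspace_diff[OF subspace_free] pm.subspace_scale[OF subspace_free] b W.smult_T(1) smult_right)
  qed
qed

interpretation Afq: free_quotient "free_space XA" NA by (rule A.fq)

text \<open>Modulo the relations every tensor is a sum of monomials tensored with vectors of \<open>W\<close>, and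
  such a sum is determined by the function it represents.\<close>

lemma phiT_kernel:
  assumes p: "Poly_Mapping.keys p \<subseteq> XT"
  shows "phiT p = 0 \<longleftrightarrow> p \<in> NT"
proof
  assume 0: "phiT p = 0"
  obtain \<pi> where \<pi>: "Vector_Spaces.linear pm_scale pm_scale \<pi>" "\<And>x. x \<in> NT \<Longrightarrow> \<pi> x = 0" "\<And>x. x - \<pi> x \<in> NT"
    by (rule pm.projection_along[OF pm.subspace_span[of "tensor_rels A.T W"]]; rule that; assumption)
  interpret \<pi>: Vector_Spaces.linear pm_scale pm_scale \<pi> by (rule \<pi>(1))
  have \<pi>_eq: "\<pi> x = \<pi> y" if "x - y \<in> NT" for x y using \<pi>(2)[OF that] by (simp add: \<pi>.diff)
  define am where "am \<gamma> = Afq.cls (pm_basis (monoA \<gamma>))" for \<gamma>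
  have am: "am \<gamma> \<in> carrier A.T" "A.Phi (am \<gamma>) = (\<lambda>z. \<Prod>i\<in>S. z i ^ \<gamma> i)" for \<gamma>
  proof -
    have "Poly_Mapping.keys (pm_basis (monoA \<gamma>)) \<subseteq> XA" using monoA_XA[of \<gamma>] by (simp del: PiE_iff)
    then show "am \<gamma> \<in> carrier A.T" unfolding am_def A.T_carrier by blast
    show "A.Phi (am \<gamma>) = (\<lambda>z. \<Prod>i\<in>S. z i ^ \<gamma> i)"
      unfolding am_def A.Phi_cls phiA_basis monoA_pf ..
  qed
  define wi where "wi = the_inv_into (carrier W) \<psi>"
  have inj\<psi>: "inj_on \<psi> (carrier W)" and img\<psi>: "\<psi> ` carrier W = C" using W.bij by (auto simp: bij_betw_def)
  have wi: "wi c \<in> carrier W" "\<psi> (wi c) = c" if "c \<in> C" for c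
    using that the_inv_into_into[OF inj\<psi>, of c] f_the_inv_into_f[OF inj\<psi>, of c] by (auto simp: wi_def img\<psi>)
  have wi\<psi>: "wi (\<psi> w) = w" if "w \<in> carrier W" for w
    using the_inv_into_f_f[OF inj\<psi> that] by (simp add: wi_def)
  have wi_add: "wi (c + c') = wi c \<oplus>\<^bsub>W\<^esub> wi c'" if "c \<in> C" "c' \<in> C" for c c'
    using wi\<psi>[OF W.add_T(1)[OF wi(1)[OF that(1)] wi(1)[OF that(2)]]] that
    by (simp add: W.add_T(2) wi)
  have wi_scale: "wi (d *s c) = d \<odot>\<^bsub>W\<^esub> wi c" if "c \<in> C" for c d
    using wi\<psi>[OF W.smult_T(1)[OF wi(1)[OF that], of d]] that by (simp add: W.smult_T(2) wi)
  define T where "T \<gamma> c = \<pi> (pm_basis (am \<gamma>, wi c))" for \<gamma> c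
  have T_add: "T \<gamma> (c + c') = T \<gamma> c + T \<gamma> c'" if "c \<in> C" "c' \<in> C" for \<gamma> c c'
  proof -
    have "\<pi> (pm_basis (am \<gamma>, wi c \<oplus>\<^bsub>W\<^esub> wi c') - pm_basis (am \<gamma>, wi c) - pm_basis (am \<gamma>, wi c')) = 0"
      using wi that by (intro \<pi>(2) rels_mem(2) am(1))
    then show ?thesis using that by (simp add: T_def wi_add \<pi>.diff \<pi>.add diff_diff_eq)
  qed
  have T_scale: "T \<gamma> (d *s c) = pm_scale d (T \<gamma> c)" if "c \<in> C" for \<gamma> c d
  proof -
    have "\<pi> (pm_basis (am \<gamma>, d \<odot>\<^bsub>W\<^esub> wi c) - pm_scale d (pm_basis (am \<gamma>, wi c))) = 0"
      using wi that by (intro \<pi>(2) rels_mem(4) am(1))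
    then show ?thesis using that by (simp add: T_def wi_scale \<pi>.diff \<pi>.scale)
  qed
  let ?B = "{T \<gamma> c |\<gamma> c. \<gamma> \<in> \<Gamma> \<and> c \<in> C}"
  have span: "\<pi> (pm_basis (Afq.cls q, w)) \<in> pm.span ?B" if q: "Poly_Mapping.keys q \<subseteq> XA" and w: "w \<in> carrier W" for q w
  proof -
    let ?F = "{q. Poly_Mapping.keys q \<subseteq> XA}"
    let ?K = "{q. q \<in> ?F \<and> \<pi> (pm_basis (Afq.cls q, w)) \<in> pm.span ?B}"
    have c: "Afq.cls q \<in> carrier A.T" if "q \<in> ?F" for q using that unfolding A.T_carrier by blast
    have zero: "\<pi> (pm_basis (Afq.cls 0, w)) = 0"
    proof -
      have c0: "Afq.cls 0 \<in> carrier A.T" by (rule c) simp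
      have "0 \<odot>\<^bsub>A.T\<^esub> Afq.cls 0 = Afq.cls 0" by (simp add: Afq.quotient_smult)
      then have "pm_basis (Afq.cls 0, w) - pm_scale 0 (pm_basis (Afq.cls 0, w)) \<in> NT"
        using rels_mem(3)[OF c0 w, of 0] by simp
      then show ?thesis using \<pi>(2) by simp
    qed
    have "?F \<subseteq> ?K"
    proof (rule monomials_span)
      show "pm.subspace ?K"
      proof (rule pm.subspaceI)
        show "0 \<in> ?K" using zero by (simp add: pm.span_zero)
        show "x + y \<in> ?K" if xy: "x \<in> ?K" "y \<in> ?K" for x y
        proof -
          have f: "x \<in> ?F" "y \<in> ?F" using xy by auto
          have "Afq.cls x \<oplus>\<^bsub>A.T\<^esub> Afq.cls y = Afq.cls (x + y)" by (simp add: Afq.quotient_add)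
          then have "pm_basis (Afq.cls (x + y), w) - pm_basis (Afq.cls x, w) - pm_basis (Afq.cls y, w) \<in> NT"
            using rels_mem(1)[OF c[OF f(1)] c[OF f(2)] w] by simp
          from \<pi>(2)[OF this] have "\<pi> (pm_basis (Afq.cls (x + y), w)) = \<pi> (pm_basis (Afq.cls x, w)) + \<pi> (pm_basis (Afq.cls y, w))"
            by (simp add: \<pi>.diff \<pi>.add diff_diff_eq)
          then show ?thesis using xy pm.subspace_add[OF subspace_free f] by (auto intro: pm.span_add)
        qed
        show "pm_scale d x \<in> ?K" if x: "x \<in> ?K" for d x
        proof -
          have f: "x \<in> ?F" using x by auto
          have "d \<odot>\<^bsub>A.T\<^esub> Afq.cls x = Afq.cls (pm_scale d x)" by (simp add: Afq.quotient_smult)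
          then have "pm_basis (Afq.cls (pm_scale d x), w) - pm_scale d (pm_basis (Afq.cls x, w)) \<in> NT"
            using rels_mem(3)[OF c[OF f] w, of d] by simp
          from \<pi>(2)[OF this] have "\<pi> (pm_basis (Afq.cls (pm_scale d x), w)) = pm_scale d (\<pi> (pm_basis (Afq.cls x, w)))"
            by (simp add: \<pi>.diff \<pi>.scale)
          then show ?thesis using x pm.subspace_scale[OF subspace_free f] by (auto intro: pm.span_scale)
        qed
      qed
      show "NA \<subseteq> ?K"
      proof
        fix n assume n: "n \<in> NA"
        then have "Afq.cls n = Afq.cls 0" by (simp add: Afq.cls_eq_iff)
        moreover have "n \<in> ?F" using n NA_XA by blast
        ultimately show "n \<in> ?K" using zero by (simp add: pm.span_zero)
      qed
      show "pm_basis (monoA \<gamma>) \<in> ?K" if "\<gamma> \<in> \<Gamma>" for \<gamma>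
      proof -
        have "T \<gamma> (\<psi> w) \<in> ?B" using that W.mem_C[OF w] by blast
        then have "\<pi> (pm_basis (Afq.cls (pm_basis (monoA \<gamma>)), w)) \<in> pm.span ?B"
          unfolding T_def wi\<psi>[OF w] am_def by (rule pm.span_base)
        then show ?thesis using monoA_XA[of \<gamma>] by simp
      qed
    qed
    then show ?thesis using q by blast
  qed
  have "pm.span (pm_basis ` XT) \<subseteq> {q. \<pi> q \<in> pm.span ?B}"
  proof (rule pm.span_minimal)
    show "pm.subspace {q. \<pi> q \<in> pm.span ?B}"
      by (rule pm.subspaceI) (simp_all add: \<pi>.zero \<pi>.add \<pi>.scale pm.span_zero pm.span_add pm.span_scale)
    show "pm_basis ` XT \<subseteq> {q. \<pi> q \<in> pm.span ?B}"
    proof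
      fix x assume "x \<in> pm_basis ` XT"
      then obtain a w where aw: "a \<in> carrier A.T" "w \<in> carrier W" "x = pm_basis (a, w)" by blast
      obtain q where "a = Afq.cls q" "Poly_Mapping.keys q \<subseteq> XA" using aw(1) unfolding A.T_carrier by blast
      then show "x \<in> {q. \<pi> q \<in> pm.span ?B}" using span[of q w] aw by simp
    qed
  qed
  then have \<pi>p: "\<pi> p \<in> pm.span ?B" using p unfolding free_span[symmetric] by blast
  obtain G v where G: "finite G" "G \<subseteq> \<Gamma>" "\<And>\<gamma>. \<gamma> \<in> G \<Longrightarrow> v \<gamma> \<in> C \<and> v \<gamma> \<noteq> 0"
    "\<pi> p = (\<Sum>\<gamma>\<in>G. T \<gamma> (v \<gamma>))"
  proof (rule pm.span_family_rep[where T = T and M = C and A = \<Gamma>, OF cvs_axioms T_add T_scale C_subspace \<pi>p])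
    fix G v assume "finite G" "G \<subseteq> \<Gamma>" "\<And>\<gamma>. \<gamma> \<in> G \<Longrightarrow> v \<gamma> \<in> C \<and> v \<gamma> \<noteq> 0" "\<pi> p = (\<Sum>\<gamma>\<in>G. T \<gamma> (v \<gamma>))"
    then show thesis by (rule that)
  qed
  have phi\<pi>: "phiT (\<pi> q) = phiT q" for q
    using phiT_NT[OF \<pi>(3)[of q]] by (simp only: phiT.diff) simp
  have phiTT: "phiT (T \<gamma> c) = (\<lambda>z. (\<Prod>i\<in>S. z i ^ \<gamma> i) *s c)" if "c \<in> C" for \<gamma> c
    unfolding T_def phi\<pi> phiT_basis by (simp add: eT_def am wi[OF that])
  have "(\<Sum>\<gamma>\<in>G. (\<Prod>i\<in>S. z i ^ \<gamma> i) *s v \<gamma>) = 0" for z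
  proof -
    have "0 = phiT (\<pi> p) z" using 0 by (simp add: phi\<pi>)
    also have "\<dots> = (\<Sum>\<gamma>\<in>G. phiT (T \<gamma> (v \<gamma>)) z)" unfolding G(4) phiT.sum by (rule sum_fun_apply)
    also have "\<dots> = (\<Sum>\<gamma>\<in>G. (\<Prod>i\<in>S. z i ^ \<gamma> i) *s v \<gamma>)" by (intro sum.cong refl) (simp add: phiTT G(3))
    finally show ?thesis ..
  qed
  then have "v \<gamma> = 0" if "\<gamma> \<in> G" for \<gamma> by (rule monomials_independent[OF fin_S G(1,2) _ that])
  then have "G = {}" using G(3) by blast
  then have "\<pi> p = 0" using G(4) by simp
  then show "p \<in> NT" using \<pi>(3)[of p] by simp
qed (rule phiT_NT)

lemma eT_TP: "a \<in> carrier A.T \<Longrightarrow> w \<in> carrier W \<Longrightarrow> eT (a, w) \<in> TP S"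
proof -
  assume a: "a \<in> carrier A.T" and w: "w \<in> carrier W"
  have "A.Phi a \<in> {g. (\<lambda>z. g z *s \<psi> w) \<in> TP S}"
  proof (rule cx.TP_induct[OF A.mem_C[OF a]])
    show "cx.F.subspace {g. (\<lambda>z. g z *s \<psi> w) \<in> TP S}"
    proof (rule cx.F.subspaceI)
      show "0 \<in> {g. (\<lambda>z. g z *s \<psi> w) \<in> TP S}"
        using F.subspace_0[OF TP_subspace[of S]] by (simp add: zero_fun_def)
      show "f + g \<in> {g. (\<lambda>z. g z *s \<psi> w) \<in> TP S}" if "f \<in> {g. (\<lambda>z. g z *s \<psi> w) \<in> TP S}" "g \<in> {g. (\<lambda>z. g z *s \<psi> w) \<in> TP S}" for f g
      proof -
        have "(\<lambda>z. (f + g) z *s \<psi> w) = (\<lambda>z. f z *s \<psi> w) + (\<lambda>z. g z *s \<psi> w)"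
          by (rule ext) (simp add: scale_left_distrib)
        then show ?thesis using F.subspace_add[OF TP_subspace] that by (simp only: mem_Collect_eq)
      qed
      show "fscale (*) c f \<in> {g. (\<lambda>z. g z *s \<psi> w) \<in> TP S}" if "f \<in> {g. (\<lambda>z. g z *s \<psi> w) \<in> TP S}" for c f
      proof -
        have "(\<lambda>z. fscale (*) c f z *s \<psi> w) = fscale scale c (\<lambda>z. f z *s \<psi> w)"
          by (rule ext) simp
        then show ?thesis using F.subspace_scale[OF TP_subspace] that by (simp only: mem_Collect_eq)
      qed
    qed
    fix q and c :: complex
    have "(\<lambda>z. cx.pf S q c z *s \<psi> w) = pf S q (c *s \<psi> w)"
      by (rule ext) (simp add: cx.pf_def pf_def)
    then show "cx.pf S q c \<in> {g. (\<lambda>z. g z *s \<psi> w) \<in> TP S}"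
      using pf_TP[of "c *s \<psi> w" S q] subspace_scale[OF C_subspace W.mem_C[OF w]] by simp
  qed
  then show ?thesis by (simp add: eT_def)
qed

lemma phiT_image: "phiT ` {p. Poly_Mapping.keys p \<subseteq> XT} = TP S"
proof -
  have "phiT ` {p. Poly_Mapping.keys p \<subseteq> XT} = F.span (eT ` XT)"
    unfolding free_span phiT.span_image[symmetric] image_image phiT_basis ..
  also have "\<dots> = TP S"
  proof
    show "F.span (eT ` XT) \<subseteq> TP S"
      by (rule F.span_minimal[OF _ TP_subspace]) (use eT_TP in blast)
    show "TP S \<subseteq> F.span (eT ` XT)"
    proof
      fix f assume "f \<in> TP S"
      then show "f \<in> F.span (eT ` XT)"
      proof (rule TP_induct[OF _ F.subspace_span])
        fix q c assume c: "c \<in> C"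
        obtain a where a: "a \<in> carrier A.T" "A.Phi a = cx.pf S q 1"
          using A.surj[OF cx.pf_TP[OF UNIV_I]] by blast
        obtain w where w: "w \<in> carrier W" "\<psi> w = c" using W.surj[OF c] by blast
        have "pf S q c = eT (a, w)" by (rule ext) (simp add: eT_def a w pf_def cx.pf_def)
        then show "pf S q c \<in> F.span (eT ` XT)" using a(1) w(1) by (auto intro!: F.span_base)
      qed
    qed
  qed
  finally show ?thesis .
qed

lemma dop_times: "dop i b (\<lambda>z. f z *s c) z = cx.dop i b f z *s c"
  by (cases b) simp_all

lemma ext_times: "T.ext g (\<lambda>z. f z *s c) z = cx.T.ext g f z *s c + f z *s ext g c"
proof -
  have "tact b (\<lambda>z. f z *s c) z = cx.tact b f z *s c + f z *s op b c" for b
    by (simp add: tact_def cx.tact_def zero_op_def dop_times op_scale scale_sum_left)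
  then show ?thesis
    unfolding T.ext_def cx.T.ext_def ext_def F_lcomb_apply cx.F_lcomb_apply
    by (simp only: lcomb_add_fun lcomb_scale_fun) (simp add: lcomb_def scale_sum_left)
qed

lemma phiT_actT: "Poly_Mapping.keys p \<subseteq> XT \<Longrightarrow> phiT (actT g p) = T.ext g (phiT p)"
proof -
  have 1: "phiT (actT g (pm_basis (a, w))) = T.ext g (phiT (pm_basis (a, w)))"
    if "a \<in> carrier A.T" "w \<in> carrier W" for a w
  proof
    fix z
    have "T.ext g (eT (a, w)) z = cx.T.ext g (A.Phi a) z *s \<psi> w + A.Phi a z *s ext g (\<psi> w)"
      using ext_times[of g "A.Phi a" "\<psi> w" z] by (simp only: eT_def case_prod_conv)
    then show "phiT (actT g (pm_basis (a, w))) z = T.ext g (phiT (pm_basis (a, w))) z"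
      unfolding actT_basis phiT.add phiT_basis plus_fun_apply
      by (simp only: eT_def case_prod_conv A.act_T(2)[OF that(1)] W.act_T(2)[OF that(2)])
  qed
  have "pm.subspace {p. phiT (actT g p) = T.ext g (phiT p)}"
    using T.ext_scale_right[of g 0 0]
    by (intro pm.subspaceI)
      (simp_all only: mem_Collect_eq actT.add actT.scale actT.zero phiT.add phiT.scale phiT.zero
        T.ext_add_right T.ext_scale_right F.scale_zero_left)
  then have "pm.span (pm_basis ` XT) \<subseteq> {p. phiT (actT g p) = T.ext g (phiT p)}"
    by (intro pm.span_minimal) (use 1 in blast)
  then show "Poly_Mapping.keys p \<subseteq> XT \<Longrightarrow> ?thesis" unfolding free_span[symmetric] by blast
qed

sublocale TT: quotient_transport "fscale scale :: complex \<Rightarrow> ((nat \<Rightarrow> complex) \<Rightarrow> 'e) \<Rightarrow> (nat \<Rightarrow> complex) \<Rightarrow> 'e"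
  "TP S" tact XT NT actT phiT
proof (rule quotient_transport.intro[OF T.hv_rep_axioms], rule quotient_transport_axioms.intro)
  show "Vector_Spaces.linear pm_scale (fscale scale) phiT" by (rule phiT_linear)
  show "Poly_Mapping.keys (actT g p) \<subseteq> XT" if "Poly_Mapping.keys p \<subseteq> XT" for g p
    unfolding actT_def lin_ext_lcomb
  proof (rule lcomb_free)
    fix x assume "x \<in> Poly_Mapping.keys p"
    with that obtain a w where x: "x = (a, w)" "a \<in> carrier A.T" "w \<in> carrier W" by blast
    have "Poly_Mapping.keys (pm_basis (act A.T g a, w)) \<subseteq> XT" "Poly_Mapping.keys (pm_basis (a, act W g w)) \<subseteq> XT"
      using A.act_T(1)[OF x(2), of g] W.act_T(1)[OF x(3), of g] x(2,3) by (simp_all del: with_act_sel)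
    then show "Poly_Mapping.keys (case x of (v, w) \<Rightarrow> pm_basis (act A.T g v, w) + pm_basis (v, act W g w)) \<subseteq> XT"
      using keys_add[of "pm_basis (act A.T g a, w)" "pm_basis (a, act W g w)"] unfolding x(1) case_prod_conv by blast
  qed
qed (fact NT_XT phiT_kernel phiT_image actT.add phiT_actT)+

lemma tensor_eq: "lie_tensor (lie_tensor_family S OM) W = TT.T"
  unfolding family_eq by (simp only: lie_tensor_def Let_def actT_def[abs_def])

lemma irreducible_tensor_iff:
  "irreducible_lie_module hv (lie_tensor (lie_tensor_family S OM) W) \<longleftrightarrow> T.simple"
  unfolding tensor_eq by (rule TT.irreducible_T)

end

theorem mainTheorem4:
  fixes m e :: nat
    and S' :: "nat set"
    and lam al be :: "nat \<Rightarrow> complex"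
    and c0 c1 c2 c3 :: complex
    and M :: "(hv_elem, 'v) lie_module"
  assumes "m \<ge> 1"
    and "S' \<subseteq> {1..m}"
    and "\<And>i. i \<in> {1..m} \<Longrightarrow> lam i \<noteq> 0"
    and "\<And>i. i \<in> S' \<Longrightarrow> be i \<noteq> 0"
    and "\<And>j. j \<in> {1..m} - S' \<Longrightarrow> al j \<noteq> 0 \<and> be j = 0"
    and "irreducible_lie_module (hv_sub e) M"
    and "\<And>v. v \<in> carrier M \<Longrightarrow> act M (hv_I 0) v = c0 \<odot>\<^bsub>M\<^esub> v"
    and "\<And>v. v \<in> carrier M \<Longrightarrow> act M hv_C1 v = c1 \<odot>\<^bsub>M\<^esub> v"
    and "\<And>v. v \<in> carrier M \<Longrightarrow> act M hv_C2 v = c2 \<odot>\<^bsub>M\<^esub> v"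
    and "\<And>v. v \<in> carrier M \<Longrightarrow> act M hv_C3 v = c3 \<odot>\<^bsub>M\<^esub> v"
    and "c3 = 0"
    and "\<exists>k::nat.
           (k \<noteq> 0 \<longrightarrow> inj_on (act M (hv_I (int k))) (carrier M)) \<and>
           (k = 0 \<longrightarrow> (\<forall>n::int. n \<noteq> 0 \<longrightarrow> c0 + (of_int n - 1) * c2 \<noteq> 0)) \<and>
           (\<forall>n::int. n > int k \<longrightarrow> (\<forall>v\<in>carrier M. act M (hv_I n) v = \<zero>\<^bsub>M\<^esub>)) \<and>
           (\<forall>n'::int. n' > int k + int e \<longrightarrow> (\<forall>v\<in>carrier M. act M (hv_L n') v = \<zero>\<^bsub>M\<^esub>))"
  shows "irreducible_lie_module hv
           (lie_tensor
             (lie_tensor_family {1..m} (\<lambda>i. Omega (lam i) (al i) (be i)))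
             (induced_module hv (hv_sub e) M))
         \<longleftrightarrow> inj_on lam {1..m}"
proof -
  obtain k :: nat where k: "k \<noteq> 0 \<Longrightarrow> inj_on (act M (hv_I (int k))) (carrier M)"
    "k = 0 \<Longrightarrow> \<forall>n::int. n \<noteq> 0 \<longrightarrow> c0 + (of_int n - 1) * c2 \<noteq> 0"
    "\<And>n v. n > int k \<Longrightarrow> v \<in> carrier M \<Longrightarrow> act M (hv_I n) v = \<zero>\<^bsub>M\<^esub>"
    "\<And>n v. n > int k + int e \<Longrightarrow> v \<in> carrier M \<Longrightarrow> act M (hv_L n) v = \<zero>\<^bsub>M\<^esub>"
    using assms(12) by blast
  interpret hv_sub_module e M
    by (rule hv_sub_module.intro) (use assms(6) in \<open>simp add: irreducible_lie_module_def\<close>)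
  interpret Ind: hv_induced pm_scale IC iop "\<iota> ` carrier M" e k c0 c1 c2
    by (rule induced_hypotheses[OF assms(6-9) assms(10)[unfolded assms(11)] k])
  interpret omega: omega_tensor "{1..m}" lam al be
    by unfold_locales (simp_all add: assms(3))
  interpret tens: tensor_transport pm_scale IC iop "{1..m}" lam al be ind.T ind.Phi
    by (intro tensor_transport.intro omega.omega_tensor_axioms hv_tensor.intro hv_tensor_axioms.intro
        ind.hv_rep_axioms ind.hv_transport_axioms) (simp_all add: assms(3))
  have "inj_on lam {1..m}" if "tens.T.simple"
  proof (rule inj_onI, rule ccontr)
    fix i j assume ij: "i \<in> {1..m}" "j \<in> {1..m}" "lam i = lam j" "i \<noteq> j"
    have "IC \<noteq> {0}" using Ind.simple_C by (simp add: ind.simple_def)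
    from tens.tensor_not_simple[OF this ij(1,2,4,3)] that show False by blast
  qed
  moreover have "tens.T.simple" if "inj_on lam {1..m}"
  proof (rule tens.tensor_simple[OF Ind.simple_C _ that])
    show "tens.restricted_rep"
      unfolding tens.restricted_rep_def by (metis Ind.restricted)
    show "al i \<noteq> 0 \<or> be i \<noteq> 0" if "i \<in> {1..m}" for i
      using assms(4,5) that by blast
  qed
  ultimately show ?thesis
    using tens.irreducible_tensor_iff unfolding induced_module_eq by blast
qed

end
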